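(* Let $u:\mathbb R^2\to\mathbb S^2$ be a harmonic map with finite energy and degree $m\in\mathbb Z$. Then all the bounded maps in the kernel of $L_u$ (that is, all elements of $\ker L_u$) are generated by harmonic maps close to $u$. In particular, the real dimension of the bounded kernel space $\ker L_u$ is $4|m|+2$.
   Context: Identify $\mathbb R^2$ with $\mathbb C$ via $z=x+iy$; $\mathbb S^2\subset\mathbb R^3$ is the unit sphere. A (smooth) map $u:\mathbb R^2\to\mathbb S^2$ is harmonic if $\Delta u+|\nabla u|^2u=0$, where $|\nabla u|^2=\sum_{j=1}^2\sum_{i=1}^3(\partial u_i/\partial x_j)^2$; its energy is $\mathcal E(u)=\int_{\mathbb R^2}|\nabla u|^2dx$. The degree is $$\deg(u)=\frac1{4\pi}\int_{\mathbb R^2}u_x\cdot(u\times u_y)\,dx\,dy .$$ Linearized operator: for a map $v:\mathbb C\to\mathbb R^3$ tangent along $u$ (i.e. $v(z)\cdot u(z)=0$ for all $z$), $$L_u[v]=\Delta v+|\nabla u|^2v+2(\nabla u\cdot\nabla v)u,\qquad \nabla u\cdot\nabla v=u_x\cdot v_x+u_y\cdot v_y .$$ The bounded kernel $\ker L_u$ is the real vector space of all $C^2$ maps $v:\mathbb C\to\mathbb R^3$ with $v\cdot u=0$ everywhere, $\sup_{z\in\mathbb C}(|v|+|\partial v|+|\partial^2v|)<\infty$, and $L_u[v]=0$. Stereographic projection: $\mathcal S:\mathbb C\to\mathbb S^2\setminus\{(0,0,1)\}$, $\mathcal S(w)=\frac1{1+|w|^2}(2\,\mathrm{Re}\,w,\,2\,\mathrm{Im}\,w,\,|w|^2-1)$,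 extended by $\mathcal S(\infty)=(0,0,1)$; thus $\mathcal S(q/p)=\frac{1}{|p|^2+|q|^2}(2\,\mathrm{Re}(q\bar p),2\,\mathrm{Im}(q\bar p),|q|^2-|p|^2)$ for $(p,q)\ne(0,0)$. Known classification: finite-energy harmonic maps of degree $m\ge0$ (resp. $m<0$) are exactly the maps $u=\mathcal S(q/p)$ with $p,q$ coprime polynomials in $z$ (resp. in $\bar z$), with $\max\{\deg p,\deg q\}=|m|$ (the constant map $(0,0,1)$ corresponding to $p=0$, $q=1$). "Generated by harmonic maps close to $u$" means: if $u=\mathcal S(q/p)$ as in this classification, then $v$ is a real linear combination of maps of the form $$\frac{d}{dt}\Big|_{t=0}\mathcal S\!\left(\frac{q+t\,b}{p+t\,a}\right),\qquad t\in\mathbb R,$$ where $a,b$ are complex polynomials in $z$ (resp. in $\bar z$ if $m<0$) of degree at most $|m|$, i.e. of derivatives of the families of harmonic maps obtained by varying the $2|m|+2$ complex coefficients of the rational function. *)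

theory Defs
  imports
    "HOL-Analysis.Analysis"
    "HOL-Library.Function_Algebras"
    "HOL-Computational_Algebra.Polynomial"
begin

text \<open>
  The plane is the type \<^typ>\<open>complex\<close>, and maps into the sphere (or along it) are functions
  \<open>complex \<Rightarrow> real^3\<close>. Functions into a real vector space form a real vector space
  pointwise, so that the library's \<^const>\<open>span\<close>, \<^const>\<open>subspace\<close> and \<^const>\<open>dim\<close> apply to sets of maps.
\<close>

instantiation "fun" :: (type, real_vector) real_vector
begin

definition scaleR_fun :: "real \<Rightarrow> ('a \<Rightarrow> 'b) \<Rightarrow> 'a \<Rightarrow> 'b"
  where "scaleR_fun c f = (\<lambda>x. c *\<^sub>R f x)"

instance
  by standard (auto simp: scaleR_fun_def fun_eq_iff scaleR_add_right scaleR_add_left)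

end

lemma scaleR_fun_apply [simp]: "(c *\<^sub>R f) x = c *\<^sub>R f x"
  by (simp add: scaleR_fun_def)

definition partial :: "complex \<Rightarrow> (complex \<Rightarrow> real^3) \<Rightarrow> complex \<Rightarrow> real^3"
  where "partial w f z = vector_derivative (\<lambda>t::real. f (z + t *\<^sub>R w)) (at 0)"

abbreviation dx :: "(complex \<Rightarrow> real^3) \<Rightarrow> complex \<Rightarrow> real^3" where "dx \<equiv> partial 1"
abbreviation dy :: "(complex \<Rightarrow> real^3) \<Rightarrow> complex \<Rightarrow> real^3" where "dy \<equiv> partial \<i>"

text \<open>\<open>Ck k f\<close> says that \<open>f\<close> is of class $C^k$ in the real sense on the whole plane.\<close>

primrec Ck :: "nat \<Rightarrow> (complex \<Rightarrow> real^3) \<Rightarrow> bool"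
  where
    "Ck 0 f \<longleftrightarrow> continuous_on UNIV f"
  | "Ck (Suc k) f \<longleftrightarrow> (\<forall>z. f differentiable (at z)) \<and> Ck k (dx f) \<and> Ck k (dy f)"

definition smooth :: "(complex \<Rightarrow> real^3) \<Rightarrow> bool"
  where "smooth f \<longleftrightarrow> (\<forall>k. Ck k f)"

definition laplacian :: "(complex \<Rightarrow> real^3) \<Rightarrow> complex \<Rightarrow> real^3"
  where "laplacian f z = dx (dx f) z + dy (dy f) z"

definition grad_inner :: "(complex \<Rightarrow> real^3) \<Rightarrow> (complex \<Rightarrow> real^3) \<Rightarrow> complex \<Rightarrow> real"
  where "grad_inner f g z = dx f z \<bullet> dx g z + dy f z \<bullet> dy g z"

definition grad_sq :: "(complex \<Rightarrow> real^3) \<Rightarrow> complex \<Rightarrow> real"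
  where "grad_sq f z = (norm (dx f z))\<^sup>2 + (norm (dy f z))\<^sup>2"

definition harmonic_map :: "(complex \<Rightarrow> real^3) \<Rightarrow> bool"
  where "harmonic_map u \<longleftrightarrow>
    smooth u \<and> (\<forall>z. norm (u z) = 1) \<and> (\<forall>z. laplacian u z + grad_sq u z *\<^sub>R u z = 0)"

definition energy :: "(complex \<Rightarrow> real^3) \<Rightarrow> ennreal"
  where "energy u = (\<integral>\<^sup>+ z. ennreal (grad_sq u z) \<partial>lborel)"

definition map_degree :: "(complex \<Rightarrow> real^3) \<Rightarrow> real"
  where "map_degree u = 1 / (4 * pi) * (\<integral> z. dx u z \<bullet> cross3 (u z) (dy u z) \<partial>lborel)"

definition lin_op :: "(complex \<Rightarrow> real^3) \<Rightarrow> (complex \<Rightarrow> real^3) \<Rightarrow> complex \<Rightarrow> real^3"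
  where "lin_op u v z =
    laplacian v z + grad_sq u z *\<^sub>R v z + (2 * grad_inner u v z) *\<^sub>R u z"

text \<open>
  The norms of pairs below are the Euclidean norms of the arrays of first and of second
  partial derivatives.
\<close>

definition bounded_C2 :: "(complex \<Rightarrow> real^3) \<Rightarrow> bool"
  where "bounded_C2 v \<longleftrightarrow>
    bdd_above (range (\<lambda>z. norm (v z) + norm (dx v z, dy v z)
      + norm ((dx (dx v) z, dx (dy v) z), (dy (dx v) z, dy (dy v) z))))"

definition bounded_kernel :: "(complex \<Rightarrow> real^3) \<Rightarrow> (complex \<Rightarrow> real^3) set"
  where "bounded_kernel u =
    {v. Ck 2 v \<and> (\<forall>z. v z \<bullet> u z = 0) \<and> bounded_C2 v \<and> (\<forall>z. lin_op u v z = 0)}"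

lemma differentiable_line:
  assumes "f differentiable (at z)"
  shows "((\<lambda>t::real. f (z + t *\<^sub>R w)) has_vector_derivative partial w f z) (at 0)"
proof -
  have "(\<lambda>t::real. z + t *\<^sub>R w) differentiable (at 0)"
    by (intro derivative_intros)
  moreover have "f differentiable (at (z + 0 *\<^sub>R w))"
    using assms by simp
  ultimately have "(f \<circ> (\<lambda>t::real. z + t *\<^sub>R w)) differentiable (at 0)"
    by (rule differentiable_chain_at)
  then show ?thesis
    unfolding partial_def o_def by (simp add: vector_derivative_works)
qed

lemma partial_add:
  assumes "\<And>z. f differentiable (at z)" "\<And>z. g differentiable (at z)"
  shows "partial w (f + g) = partial w f + partial w g"
proof
  fix z
  have "((\<lambda>t::real. (f + g) (z + t *\<^sub>R w)) has_vector_derivative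
      (partial w f z + partial w g z)) (at 0)"
    unfolding plus_fun_apply
    by (intro has_vector_derivative_add differentiable_line assms)
  then show "partial w (f + g) z = (partial w f + partial w g) z"
    unfolding partial_def[of w "f + g"] by (simp add: vector_derivative_at)
qed

lemma partial_scaleR:
  assumes "\<And>z. f differentiable (at z)"
  shows "partial w (c *\<^sub>R f) = c *\<^sub>R partial w f"
proof
  fix z
  have "((\<lambda>t::real. (c *\<^sub>R f) (z + t *\<^sub>R w)) has_vector_derivative
      (c *\<^sub>R partial w f z)) (at 0)"
    unfolding scaleR_fun_apply
    using bounded_linear.has_vector_derivative[OF bounded_linear_scaleR_right
        differentiable_line[OF assms]] by blast
  then show "partial w (c *\<^sub>R f) z = (c *\<^sub>R partial w f) z"
    unfolding partial_def[of w "c *\<^sub>R f"] by (simp add: vector_derivative_at)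
qed

lemma partial_zero: "partial w 0 = 0"
  by (simp add: partial_def fun_eq_iff)

lemma Ck_add: "Ck k f \<Longrightarrow> Ck k g \<Longrightarrow> Ck k (f + g)"
proof (induction k arbitrary: f g)
  case 0
  then show ?case by (simp add: plus_fun_def continuous_on_add)
next
  case (Suc k)
  moreover have "(f + g) differentiable (at z)" for z
    using Suc.prems by (auto simp: plus_fun_def)
  ultimately show ?case
    using partial_add[of f g] by (simp del: plus_fun_apply)
qed

lemma Ck_scaleR: "Ck k f \<Longrightarrow> Ck k (c *\<^sub>R f)"
proof (induction k arbitrary: f)
  case 0
  then show ?case by (simp add: scaleR_fun_def continuous_on_scaleR)
next
  case (Suc k)
  moreover have "(c *\<^sub>R f) differentiable (at z)" for z
    using Suc.prems by (auto simp: scaleR_fun_def)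
  ultimately show ?case
    using partial_scaleR[of f _ c] by (simp del: scaleR_fun_apply)
qed

lemma Ck_zero: "Ck k 0"
proof (induction k)
  case 0
  show ?case by (simp add: zero_fun_def)
next
  case (Suc k)
  moreover have "(0 :: complex \<Rightarrow> real^3) differentiable (at z)" for z
    by (simp add: zero_fun_def)
  ultimately show ?case by (simp add: partial_zero del: zero_fun_apply)
qed

lemma subspace_bounded_kernel: "subspace (bounded_kernel u)"
proof (rule subspaceI)
  show "0 \<in> bounded_kernel u"
    by (simp add: bounded_kernel_def Ck_zero bounded_C2_def lin_op_def laplacian_def
        grad_inner_def partial_zero)
next
  fix v w assume v: "v \<in> bounded_kernel u" and w: "w \<in> bounded_kernel u"
  then have C: "Ck 2 v" "Ck 2 w" by (simp_all add: bounded_kernel_def)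
  then have d: "partial a (v + w) = partial a v + partial a w"
      "b \<in> {1, \<i>} \<Longrightarrow> partial a (partial b v + partial b w)
         = partial a (partial b v) + partial a (partial b w)" for a b
    by (auto simp: numeral_2_eq_2 intro!: partial_add)
  have "bounded_C2 (v + w)"
  proof -
    from v w obtain M N where
      M: "\<And>z. norm (v z) + norm (dx v z, dy v z)
        + norm ((dx (dx v) z, dx (dy v) z), (dy (dx v) z, dy (dy v) z)) \<le> M" and
      N: "\<And>z. norm (w z) + norm (dx w z, dy w z)
        + norm ((dx (dx w) z, dx (dy w) z), (dy (dx w) z, dy (dy w) z)) \<le> N"
      unfolding bounded_kernel_def bounded_C2_def bdd_above_def by blast
    show ?thesis
      unfolding bounded_C2_def
    proof (rule bdd_aboveI2)
      fix z
      show "norm ((v + w) z) + norm (dx (v + w) z, dy (v + w) z)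
        + norm ((dx (dx (v + w)) z, dx (dy (v + w)) z), (dy (dx (v + w)) z, dy (dy (v + w)) z))
        \<le> M + N"
        using M[of z] N[of z] norm_triangle_ineq[of "v z" "w z"]
          norm_triangle_ineq[of "(dx v z, dy v z)" "(dx w z, dy w z)"]
          norm_triangle_ineq[of "((dx (dx v) z, dx (dy v) z), (dy (dx v) z, dy (dy v) z))"
            "((dx (dx w) z, dx (dy w) z), (dy (dx w) z, dy (dy w) z))"]
        by (simp add: d)
    qed
  qed
  moreover have "lin_op u (v + w) z = lin_op u v z + lin_op u w z" for z
    by (simp add: lin_op_def laplacian_def grad_inner_def d algebra_simps inner_add_right
        scaleR_add_left)
  ultimately show "v + w \<in> bounded_kernel u"
    using v w by (simp add: bounded_kernel_def Ck_add inner_add_left)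
next
  fix c v assume v: "v \<in> bounded_kernel u"
  then have C: "Ck 2 v" by (simp add: bounded_kernel_def)
  then have d: "partial a (c *\<^sub>R v) = c *\<^sub>R partial a v"
      "b \<in> {1, \<i>} \<Longrightarrow> partial a (c *\<^sub>R partial b v) = c *\<^sub>R partial a (partial b v)" for a b
    by (auto simp: numeral_2_eq_2 intro!: partial_scaleR)
  have "bounded_C2 (c *\<^sub>R v)"
  proof -
    from v obtain M where
      M: "\<And>z. norm (v z) + norm (dx v z, dy v z)
        + norm ((dx (dx v) z, dx (dy v) z), (dy (dx v) z, dy (dy v) z)) \<le> M"
      unfolding bounded_kernel_def bounded_C2_def bdd_above_def by blast
    show ?thesis
      unfolding bounded_C2_def
    proof (rule bdd_aboveI2)
      fix z
      show "norm ((c *\<^sub>R v) z) + norm (dx (c *\<^sub>R v) z, dy (c *\<^sub>R v) z)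
        + norm ((dx (dx (c *\<^sub>R v)) z, dx (dy (c *\<^sub>R v)) z),
            (dy (dx (c *\<^sub>R v)) z, dy (dy (c *\<^sub>R v)) z))
        \<le> \<bar>c\<bar> * M"
        using mult_left_mono[OF M[of z], of "\<bar>c\<bar>"]
          norm_scaleR[of c "(dx v z, dy v z)"]
          norm_scaleR[of c "((dx (dx v) z, dx (dy v) z), (dy (dx v) z, dy (dy v) z))"]
        by (simp add: d distrib_left)
    qed
  qed
  moreover have "lin_op u (c *\<^sub>R v) z = c *\<^sub>R lin_op u v z" for z
    by (simp add: lin_op_def laplacian_def grad_inner_def d algebra_simps scaleR_add_right)
  ultimately show "c *\<^sub>R v \<in> bounded_kernel u"
    using v by (simp add: bounded_kernel_def Ck_scaleR)
qed

definition stereo :: "complex \<Rightarrow> real^3"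
  where "stereo w = (1 / (1 + (cmod w)\<^sup>2)) *\<^sub>R vector [2 * Re w, 2 * Im w, (cmod w)\<^sup>2 - 1]"

text \<open>\<open>stereo_quot q p\<close> is the stereographic image of the point $q/p$ of the Riemann sphere.\<close>

definition stereo_quot :: "complex \<Rightarrow> complex \<Rightarrow> real^3"
  where "stereo_quot q p = (if p = 0 then vector [0, 0, 1] else stereo (q / p))"

lemma stereo_quot_homogeneous:
  assumes "(p, q) \<noteq> (0, 0)"
  shows "stereo_quot q p = (1 / ((cmod p)\<^sup>2 + (cmod q)\<^sup>2)) *\<^sub>R
    vector [2 * Re (q * cnj p), 2 * Im (q * cnj p), (cmod q)\<^sup>2 - (cmod p)\<^sup>2]"
proof (cases "p = 0")
  case True
  with assms show ?thesis
    by (simp add: stereo_quot_def vec_eq_iff forall_3)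
next
  case False
  define P where "P = (cmod p)\<^sup>2"
  define Q where "Q = (cmod q)\<^sup>2"
  have P: "P > 0" and Q: "Q \<ge> 0" and PQ: "P + Q \<noteq> 0"
    using False by (auto simp: P_def Q_def add_pos_nonneg less_imp_neq[symmetric])
  have eq: "q / p = q * cnj p / of_real P"
    using complex_div_cnj[of q p] by (simp add: P_def)
  have R: "Re (q / p) = Re (q * cnj p) / P" and I: "Im (q / p) = Im (q * cnj p) / P"
    unfolding eq by (simp_all only: Re_divide_of_real Im_divide_of_real)
  have N: "(cmod (q / p))\<^sup>2 = Q / P"
    by (simp add: P_def Q_def norm_divide power_divide)
  have S: "1 / (1 + Q / P) = P / (P + Q)"
    using P by (simp add: field_simps)
  have T: "P * (Q / P - 1) = Q - P"
    using P by (simp add: field_simps)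
  show ?thesis
    unfolding stereo_quot_def stereo_def R I N P_def[symmetric] Q_def[symmetric] S
    using False P PQ T by (simp add: vec_eq_iff forall_3 divide_simps)
qed

text \<open>
  In degree \<open>m < 0\<close> polynomials are evaluated at the conjugate variable.
\<close>

definition coord :: "int \<Rightarrow> complex \<Rightarrow> complex"
  where "coord m z = (if m \<ge> 0 then z else cnj z)"

definition rational_map :: "int \<Rightarrow> complex poly \<Rightarrow> complex poly \<Rightarrow> complex \<Rightarrow> real^3"
  where "rational_map m q p z = stereo_quot (poly q (coord m z)) (poly p (coord m z))"

definition represents :: "int \<Rightarrow> complex poly \<Rightarrow> complex poly \<Rightarrow> (complex \<Rightarrow> real^3) \<Rightarrow> bool"
  where "represents m q p u \<longleftrightarrow>
    coprime p q \<and> max (degree p) (degree q) = nat \<bar>m\<bar> \<and> u = rational_map m q p"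

definition variations :: "int \<Rightarrow> complex poly \<Rightarrow> complex poly \<Rightarrow> (complex \<Rightarrow> real^3) set"
  where "variations m q p =
    {v. \<exists>a b. degree a \<le> nat \<bar>m\<bar> \<and> degree b \<le> nat \<bar>m\<bar> \<and>
      (\<forall>z. ((\<lambda>t::real. rational_map m (q + smult (of_real t) b) (p + smult (of_real t) a) z)
              has_vector_derivative v z) (at 0))}"

text \<open>
  The pair \<open>(q, p)\<close> representing \<open>u\<close> is determined only up to a common nonzero constant. The
  definition asks for the property for every such pair and, to exclude a vacuous reading, for
  the existence of one.
\<close>

definition generated_by_harmonic_maps ::
    "int \<Rightarrow> (complex \<Rightarrow> real^3) \<Rightarrow> (complex \<Rightarrow> real^3) \<Rightarrow> bool"
  where "generated_by_harmonic_maps m u v \<longleftrightarrow>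
    (\<exists>q p. represents m q p u) \<and>
    (\<forall>q p. represents m q p u \<longrightarrow> v \<in> span (variations m q p))"

end

theory Submission
  imports
    Defs
    "HOL-Complex_Analysis.Complex_Analysis"
    "HOL-Computational_Algebra.Fundamental_Theorem_Algebra"
    "HOL-Computational_Algebra.Field_as_Ring"
    "HOL-Computational_Algebra.Polynomial_Factorial"
begin

text \<open>
  A harmonic map \<open>u\<close> of finite energy is conformal, because its Hopf differential \<open>u\<^sub>z \<cdot> u\<^sub>z\<close> is
  entire and integrable. In a stereographic coordinate \<open>w\<close> conformality reads \<open>w\<^sub>z cnj(w\<^sub>z\<^sub>') = 0\<close>,
  where \<open>z'\<close> is the conjugate variable; the harmonic map equation then says that \<open>w\<^sub>z\<close> and
  \<open>cnj(w\<^sub>z\<^sub>')\<close> are holomorphic, so that by unique continuation one of them vanishes everywhere. The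
  two cases are exchanged by reflecting the domain. If \<open>w\<close> is meromorphic, finite energy bounds
  the spherical area it covers, so near infinity it omits a set of values of positive area, and by
  the great Picard theorem it is a quotient \<open>q/p\<close> of polynomials. The degree is
  obtained by integrating the Laplacian of \<open>log (\<bar>p\<bar>\<^sup>2 + \<bar>q\<bar>\<^sup>2)\<close> over large squares.

  If \<open>v\<close> is in the bounded kernel, then \<open>u\<^sub>z \<cdot> v\<^sub>z\<close> is entire, and it tends to 0 at infinity
  because the gradient of \<open>u\<close> does; hence it vanishes. Now \<open>u\<^sub>z\<close> is a multiple of the conjugate
  of the isotropic vector \<open>F = (p\<^sup>2 - q\<^sup>2, \<i>(p\<^sup>2 + q\<^sup>2), 2pq)\<close>, so this says that
  \<open>r = (v \<cdot> F)/2\<close> is entire. By growth it is a polynomial of degree at most \<open>2m\<close>, and \<open>v\<close>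
  is recovered from it as \<open>2 Re (r cnj F) / (\<bar>p\<bar>\<^sup>2 + \<bar>q\<bar>\<^sup>2)\<^sup>2\<close>. Since \<open>p\<close> and \<open>q\<close> are coprime,
  \<open>r = b p - a q\<close> with \<open>a\<close>, \<open>b\<close> of degree at most \<open>m\<close>, and then \<open>v\<close> is the derivative of
  \<open>(q + t b)/(p + t a)\<close>.
\<close>

subsection \<open>Wirtinger derivatives\<close>

text \<open>The number 4m + 2 comes from one redundancy. Among pairs of degree at most m, the map
  (a, b) -> b p - a q has exactly the complex multiples of (p, q) as its kernel, since rescaling
  both polynomials does not move q/p. So 2m + 2 complex coefficients leave the 2m + 1 coefficients
  of \<open>r\<close>. Two obstacles shape the argument. A stereographic chart misses a pole, and at
  zeros of the energy density the orientation of \<open>u\<close> is invisible. Orientation is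
  therefore carried by the Jacobian, which both polar charts compute alike, and unique continuation
  controls the zeros. For the kernel, the vanishing of u_z . v_z says nothing where u_z = 0: for m >
  0 these are finitely many points, filled in by continuity, while for m = 0 the identity is empty
  and \<open>v\<close> is treated as a bounded field with harmonic components. The vector
  \<open>F\<close> is what remains of u_z after its scalar factor is removed. It is polynomial and
  has no zeros, and its real and imaginary parts span the tangent plane, so it turns tangent fields
  into complex scalar functions on the whole plane, zeros of u_z included.\<close>

definition wirt :: "(complex \<Rightarrow> complex) \<Rightarrow> complex \<Rightarrow> complex \<Rightarrow> complex \<Rightarrow> bool"
  where "wirt f a b z \<longleftrightarrow> (f has_derivative (\<lambda>h. a * h + b * cnj h)) (at z)"

text \<open>The calculus rules below return coefficients in unsimplified form; this separates
  differentiating from the algebra that identifies the result.\<close>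

lemma wirt_cong: "wirt f a b z \<Longrightarrow> a = a' \<Longrightarrow> b = b' \<Longrightarrow> wirt f a' b' z"
  by simp

lemma wirt_const [intro]: "wirt (\<lambda>_. c) 0 0 z"
  by (simp add: wirt_def)

lemma wirt_ident [intro]: "wirt (\<lambda>z. z) 1 0 z"
  by (simp add: wirt_def)

lemma wirt_cnj [intro]:
  assumes "wirt f a b z" shows "wirt (\<lambda>z. cnj (f z)) (cnj b) (cnj a) z"
  using has_derivative_cnj[OF assms[unfolded wirt_def]]
  by (simp add: wirt_def algebra_simps)

lemma wirt_add [intro]:
  assumes "wirt f a b z" "wirt g c d z" shows "wirt (\<lambda>z. f z + g z) (a + c) (b + d) z"
  using has_derivative_add[OF assms[unfolded wirt_def]]
  by (simp add: wirt_def algebra_simps)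

lemma wirt_diff [intro]:
  assumes "wirt f a b z" "wirt g c d z" shows "wirt (\<lambda>z. f z - g z) (a - c) (b - d) z"
  using has_derivative_diff[OF assms[unfolded wirt_def]]
  by (simp add: wirt_def algebra_simps)

lemma wirt_minus [intro]:
  assumes "wirt f a b z" shows "wirt (\<lambda>z. - f z) (- a) (- b) z"
  using has_derivative_minus[OF assms[unfolded wirt_def]]
  by (simp add: wirt_def algebra_simps)

lemma wirt_mult [intro]:
  assumes "wirt f a b z" "wirt g c d z"
  shows "wirt (\<lambda>z. f z * g z) (a * g z + f z * c) (b * g z + f z * d) z"
  using has_derivative_mult[OF assms[unfolded wirt_def]]
  by (simp add: wirt_def algebra_simps)

lemma wirt_inverse [intro]:
  assumes "wirt f a b z" "f z \<noteq> 0"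
  shows "wirt (\<lambda>z. inverse (f z)) (- (a / (f z)\<^sup>2)) (- (b / (f z)\<^sup>2)) z"
  using Deriv.has_derivative_inverse[OF assms(2) assms(1)[unfolded wirt_def]]
  by (simp add: wirt_def algebra_simps power2_eq_square divide_inverse)

lemma wirt_divide [intro]:
  assumes "wirt f a b z" "wirt g c d z" "g z \<noteq> 0"
  shows "wirt (\<lambda>z. f z / g z) ((a * g z - f z * c) / (g z)\<^sup>2) ((b * g z - f z * d) / (g z)\<^sup>2) z"
  unfolding divide_inverse
  by (rule wirt_cong[OF wirt_mult[OF assms(1) wirt_inverse[OF assms(2,3)]]])
     (use assms(3) in \<open>simp_all add: field_simps power2_eq_square\<close>)

lemma wirt_sum [intro]:
  assumes "\<And>i. i \<in> I \<Longrightarrow> wirt (f i) (a i) (b i) z"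
  shows "wirt (\<lambda>z. \<Sum>i\<in>I. f i z) (\<Sum>i\<in>I. a i) (\<Sum>i\<in>I. b i) z"
  using has_derivative_sum[of I f "\<lambda>i h. a i * h + b i * cnj h"] assms
  by (simp add: wirt_def sum.distrib sum_distrib_right)

lemma wirt_field_derivative:
  assumes "(f has_field_derivative a) (at z)" shows "wirt f a 0 z"
  using assms by (simp add: wirt_def has_field_derivative_def)

text \<open>A vanishing second coefficient is the Cauchy-Riemann equation. This is how holomorphy is
  established throughout.\<close>

lemma field_derivative_wirt:
  assumes "wirt f a 0 z" shows "(f has_field_derivative a) (at z)"
  using assms by (simp add: wirt_def has_field_derivative_def)

lemma wirt_unique:
  assumes "wirt f a b z" "wirt f c d z" shows "a = c" "b = d"
proof -
  have "(\<lambda>h. a * h + b * cnj h) = (\<lambda>h. c * h + d * cnj h)"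
    using assms has_derivative_unique unfolding wirt_def by blast
  from fun_cong[OF this, of 1] fun_cong[OF this, of \<i>]
  have "a + b = c + d" "a * \<i> - b * \<i> = c * \<i> - d * \<i>" by simp_all
  then have "a + b = c + d" "a - b = c - d"
    by (simp_all flip: left_diff_distrib)
  then show "a = c" "b = d" by (simp_all add: complex_eq_iff)
qed

lemma wirt_isCont: "wirt f a b z \<Longrightarrow> isCont f z"
  unfolding wirt_def by (rule has_derivative_continuous)

lemma wirt_vector_derivative_x:
  assumes "wirt L a b (Complex x y)"
  shows "((\<lambda>x. L (Complex x y)) has_vector_derivative a + b) (at x within S)"
proof -
  have "((\<lambda>x. Complex x y) has_vector_derivative 1) (at x within S)"
    unfolding has_vector_derivative_complex_iff by (auto intro!: derivative_eq_intros)
  then have "((\<lambda>x. Complex x y) has_derivative (\<lambda>h. of_real h)) (at x within S)"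
    by (simp add: has_vector_derivative_def scaleR_conv_of_real)
  from has_derivative_compose[OF this assms[unfolded wirt_def]] show ?thesis
    by (simp add: has_vector_derivative_def scaleR_conv_of_real algebra_simps)
qed

lemma wirt_vector_derivative_y:
  assumes "wirt L a b (Complex x y)"
  shows "((\<lambda>y. L (Complex x y)) has_vector_derivative \<i> * (a - b)) (at y within S)"
proof -
  have "((\<lambda>y. Complex x y) has_vector_derivative \<i>) (at y within S)"
    unfolding has_vector_derivative_complex_iff by (auto intro!: derivative_eq_intros)
  then have "((\<lambda>y. Complex x y) has_derivative (\<lambda>h. of_real h * \<i>)) (at y within S)"
    by (simp add: has_vector_derivative_def scaleR_conv_of_real)
  from has_derivative_compose[OF this assms[unfolded wirt_def]] show ?thesis
    by (simp add: has_vector_derivative_def scaleR_conv_of_real algebra_simps)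
qed

lemma continuous_on_Complex_args:
  fixes f :: "complex \<Rightarrow> 'a::topological_space"
  assumes "continuous_on UNIV f"
  shows "continuous_on U (\<lambda>x. f (Complex x y))" "continuous_on U (\<lambda>y. f (Complex x y))"
    "continuous_on V (\<lambda>(x, y). f (Complex x y))"
  unfolding case_prod_beta
  by (rule continuous_on_compose2[OF assms];
      auto intro!: continuous_on_Complex continuous_on_fst continuous_on_snd continuous_on_id)+

section \<open>Symmetry of mixed partial derivatives\<close>

lemma second_difference:
  fixes g gv gvw :: "complex \<Rightarrow> real"
  assumes gv: "\<And>z. ((\<lambda>t. g (z + t *\<^sub>R v)) has_real_derivative gv z) (at 0)"
    and gvw: "\<And>z. ((\<lambda>t. gv (z + t *\<^sub>R w)) has_real_derivative gvw z) (at 0)"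
    and h: "h > 0"
  obtains s t where "0 < s" "s < h" "0 < t" "t < h"
    "g (z + h *\<^sub>R v + h *\<^sub>R w) - g (z + h *\<^sub>R v) - g (z + h *\<^sub>R w) + g z
      = h\<^sup>2 * gvw (z + s *\<^sub>R v + t *\<^sub>R w)"
proof -
  have shift: "((\<lambda>t. f (z + t *\<^sub>R d)) has_real_derivative f' (z + s *\<^sub>R d)) (at s)"
    if "\<And>z. ((\<lambda>t. f (z + t *\<^sub>R d)) has_real_derivative f' z) (at 0)"
    for f f' :: "complex \<Rightarrow> real" and z d s
    using DERIV_shift[of "\<lambda>t. f (z + t *\<^sub>R d)" "f' (z + s *\<^sub>R d)" 0 s] that[of "z + s *\<^sub>R d"]
    by (simp add: algebra_simps)
  let ?\<phi> = "\<lambda>s. g (z + h *\<^sub>R w + s *\<^sub>R v) - g (z + s *\<^sub>R v)"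
  have "\<exists>s>0. s < h \<and> ?\<phi> h - ?\<phi> 0 = (h - 0) * (gv (z + h *\<^sub>R w + s *\<^sub>R v) - gv (z + s *\<^sub>R v))"
    by (rule MVT2[OF h], rule DERIV_diff[OF shift[OF gv] shift[OF gv]])
  then obtain s where s: "0 < s" "s < h"
    "?\<phi> h - ?\<phi> 0 = h * (gv (z + h *\<^sub>R w + s *\<^sub>R v) - gv (z + s *\<^sub>R v))"
    by auto
  let ?\<psi> = "\<lambda>t. gv (z + s *\<^sub>R v + t *\<^sub>R w)"
  have "\<exists>t>0. t < h \<and> ?\<psi> h - ?\<psi> 0 = (h - 0) * gvw (z + s *\<^sub>R v + t *\<^sub>R w)"
    by (rule MVT2[OF h], rule shift[OF gvw])
  then obtain t where t: "0 < t" "t < h" "?\<psi> h - ?\<psi> 0 = h * gvw (z + s *\<^sub>R v + t *\<^sub>R w)"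
    by auto
  show ?thesis
    using that[OF s(1,2) t(1,2)] s(3) t(3) by (simp add: algebra_simps power2_eq_square)
qed

text \<open>The second difference of \<open>g\<close> is symmetric in \<open>v\<close> and
  \<open>w\<close>. By the mean value theorem it is \<open>h\<^sup>2\<close> times a value of either
  mixed derivative near \<open>z\<close>, and continuity at \<open>z\<close> forces the two to
  agree.\<close>

lemma mixed_partials_eq:
  fixes g gv gw gvw gwv :: "complex \<Rightarrow> real"
  assumes "\<And>z. ((\<lambda>t. g (z + t *\<^sub>R v)) has_real_derivative gv z) (at 0)"
    and "\<And>z. ((\<lambda>t. gv (z + t *\<^sub>R w)) has_real_derivative gvw z) (at 0)"
    and "\<And>z. ((\<lambda>t. g (z + t *\<^sub>R w)) has_real_derivative gw z) (at 0)"
    and "\<And>z. ((\<lambda>t. gw (z + t *\<^sub>R v)) has_real_derivative gwv z) (at 0)"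
    and c: "isCont gvw z" "isCont gwv z"
  shows "gvw z = gwv z"
proof (rule ccontr)
  assume ne: "gvw z \<noteq> gwv z"
  define e where "e = dist (gvw z) (gwv z) / 2"
  have e: "e > 0" using ne by (simp add: e_def)
  have ee: "e + e = dist (gvw z) (gwv z)" unfolding e_def by (rule field_sum_of_halves)
  obtain d1 where d1: "d1 > 0" "\<And>x. dist x z < d1 \<Longrightarrow> dist (gvw x) (gvw z) < e"
    using c(1) e unfolding continuous_at_eps_delta by blast
  obtain d2 where d2: "d2 > 0" "\<And>x. dist x z < d2 \<Longrightarrow> dist (gwv x) (gwv z) < e"
    using c(2) e unfolding continuous_at_eps_delta by blast
  \<comment> \<open>So small that the intermediate points produced by both orders of differentiation
    stay within both continuity radii.\<close>
  define h where "h = min d1 d2 / (norm v + norm w + 1)"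
  have nn: "norm v + norm w + 1 > 0" by (simp add: add_nonneg_pos)
  have h: "h > 0" using d1 d2 nn by (simp add: h_def)
  have hh: "h * (norm v + norm w + 1) = min d1 d2" using nn by (simp add: h_def)
  have near: "dist (z + s *\<^sub>R a + t *\<^sub>R b) z < min d1 d2"
    if "0 < s" "s < h" "0 < t" "t < h" "norm a + norm b = norm v + norm w" for s t and a b :: complex
  proof -
    have "dist (z + s *\<^sub>R a + t *\<^sub>R b) z \<le> s * norm a + t * norm b"
      using that norm_triangle_ineq[of "s *\<^sub>R a" "t *\<^sub>R b"] by (simp add: dist_norm add.assoc)
    also have "\<dots> \<le> h * norm a + h * norm b"
      using that by (intro add_mono mult_right_mono) auto
    also have "\<dots> = h * (norm v + norm w)" using that(5) by (simp flip: distrib_left)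
    also have "\<dots> < h * (norm v + norm w) + h" using h by simp
    also have "\<dots> = min d1 d2" using hh by (simp only: distrib_left mult_1_right)
    finally show ?thesis .
  qed
  obtain s t where 1: "0 < s" "s < h" "0 < t" "t < h"
    "g (z + h *\<^sub>R v + h *\<^sub>R w) - g (z + h *\<^sub>R v) - g (z + h *\<^sub>R w) + g z
      = h\<^sup>2 * gvw (z + s *\<^sub>R v + t *\<^sub>R w)"
    using second_difference[OF assms(1,2) h] by blast
  obtain s' t' where 2: "0 < s'" "s' < h" "0 < t'" "t' < h"
    "g (z + h *\<^sub>R w + h *\<^sub>R v) - g (z + h *\<^sub>R w) - g (z + h *\<^sub>R v) + g z
      = h\<^sup>2 * gwv (z + s' *\<^sub>R w + t' *\<^sub>R v)"
    using second_difference[OF assms(3,4) h] by blast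
  have "h\<^sup>2 * gvw (z + s *\<^sub>R v + t *\<^sub>R w) = h\<^sup>2 * gwv (z + s' *\<^sub>R w + t' *\<^sub>R v)"
    unfolding 1(5)[symmetric] 2(5)[symmetric] by (simp add: algebra_simps)
  then have eq: "gvw (z + s *\<^sub>R v + t *\<^sub>R w) = gwv (z + s' *\<^sub>R w + t' *\<^sub>R v)" using h by simp
  have "dist (gvw (z + s *\<^sub>R v + t *\<^sub>R w)) (gvw z) < e"
    by (rule d1(2)) (use near[OF 1(1-4), of v w] in simp)
  moreover have "dist (gwv (z + s' *\<^sub>R w + t' *\<^sub>R v)) (gwv z) < e"
    by (rule d2(2)) (use near[OF 2(1-4), of w v] in simp)
  ultimately have "dist (gvw z) (gwv z) < e + e"
    using dist_triangle3[of "gvw z" "gwv z" "gvw (z + s *\<^sub>R v + t *\<^sub>R w)"] eq by simp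
  then show False unfolding ee by (rule less_irrefl[THEN notE, rotated])
qed

section \<open>From real partial derivatives to Wirtinger derivatives\<close>

lemma partial_component:
  assumes "f differentiable (at z)"
  shows "((\<lambda>t. f (z + t *\<^sub>R w) $ i) has_real_derivative partial w f z $ i) (at 0)"
  using bounded_linear.has_vector_derivative[OF bounded_linear_vec_nth differentiable_line[OF assms]]
  by (simp add: has_real_derivative_iff_has_vector_derivative)

lemma Ck_2D:
  assumes "Ck 2 f"
  shows "f differentiable (at z)" "dx f differentiable (at z)" "dy f differentiable (at z)"
    "isCont (dx (dx f)) z" "isCont (dx (dy f)) z" "isCont (dy (dx f)) z" "isCont (dy (dy f)) z"
  using assms by (auto simp: numeral_2_eq_2 continuous_on_eq_continuous_at)

lemma dx_dy_commute:
  assumes "Ck 2 f" shows "dx (dy f) z = dy (dx f) z"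
proof (rule vec_eq_iff[THEN iffD2], rule allI)
  fix i
  show "dx (dy f) z $ i = dy (dx f) z $ i"
    by (rule mixed_partials_eq[of "\<lambda>z. f z $ i" \<i> "\<lambda>z. dy f z $ i" 1 "\<lambda>z. dx (dy f) z $ i"
          "\<lambda>z. dx f z $ i" "\<lambda>z. dy (dx f) z $ i"])
      (rule partial_component bounded_linear.continuous[OF bounded_linear_vec_nth]
        Ck_2D[OF assms])+
qed

lemma partial_eqI:
  assumes "(f has_derivative f') (at z)" shows "partial w f z = f' w"
proof -
  interpret bounded_linear f' using assms by (rule has_derivative_bounded_linear)
  have "((\<lambda>t::real. z + t *\<^sub>R w) has_derivative (\<lambda>t. t *\<^sub>R w)) (at 0)"
    by (auto intro!: derivative_eq_intros)
  moreover have "(f has_derivative f') (at (z + 0 *\<^sub>R w))" using assms by simp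
  ultimately have "((\<lambda>t::real. f (z + t *\<^sub>R w)) has_derivative (\<lambda>t. f' (t *\<^sub>R w))) (at 0)"
    using has_derivative_compose by blast
  then have "((\<lambda>t::real. f (z + t *\<^sub>R w)) has_vector_derivative f' w) (at 0)"
    by (simp add: has_vector_derivative_def scaleR)
  then show ?thesis unfolding partial_def by (simp add: vector_derivative_at)
qed

lemma has_derivative_partial:
  assumes "f differentiable (at z)"
  shows "(f has_derivative (\<lambda>h. Re h *\<^sub>R dx f z + Im h *\<^sub>R dy f z)) (at z)"
proof -
  obtain f' where f': "(f has_derivative f') (at z)" using assms by (auto simp: differentiable_def)
  interpret bounded_linear f' using f' by (rule has_derivative_bounded_linear)
  have "f' h = Re h *\<^sub>R f' 1 + Im h *\<^sub>R f' \<i>" for h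
  proof -
    have "h = Re h *\<^sub>R 1 + Im h *\<^sub>R \<i>" by (simp add: complex_eq_iff)
    then show ?thesis by (metis add scaleR)
  qed
  then have "f' = (\<lambda>h. Re h *\<^sub>R dx f z + Im h *\<^sub>R dy f z)"
    unfolding partial_eqI[OF f'] by (rule ext)
  then show ?thesis using f' by metis
qed

text \<open>Components of \<open>f\<close> are real, so this single number carries both Wirtinger
  derivatives: the second is its conjugate.\<close>

definition dz :: "(complex \<Rightarrow> real^3) \<Rightarrow> 3 \<Rightarrow> complex \<Rightarrow> complex"
  where "dz f i z = Complex (dx f z $ i / 2) (- dy f z $ i / 2)"

lemma wirt_component:
  assumes "f differentiable (at z)"
  shows "wirt (\<lambda>z. complex_of_real (f z $ i)) (dz f i z) (cnj (dz f i z)) z"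
proof -
  have "((\<lambda>z. complex_of_real (f z $ i)) has_derivative
      (\<lambda>h. complex_of_real ((Re h *\<^sub>R dx f z + Im h *\<^sub>R dy f z) $ i))) (at z)"
    by (intro has_derivative_of_real
        bounded_linear.has_derivative[OF bounded_linear_vec_nth] has_derivative_partial assms)
  moreover have "(\<lambda>h. complex_of_real ((Re h *\<^sub>R dx f z + Im h *\<^sub>R dy f z) $ i))
      = (\<lambda>h. dz f i z * h + cnj (dz f i z) * cnj h)"
    by (simp add: fun_eq_iff dz_def complex_eq_iff algebra_simps)
  ultimately show ?thesis by (simp add: wirt_def)
qed

text \<open>The Laplacian is four times the mixed Wirtinger derivative. Only the derivative in the
  conjugate variable enters later, hence the other one is left existential.\<close>

lemma wirt_dz:
  assumes "Ck 2 f"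
  shows "\<exists>a. wirt (dz f i) a (of_real (laplacian f z $ i / 4)) z"
proof -
  note d = Ck_2D[OF assms]
  have eq: "dz f i = (\<lambda>z. (1/2) * (of_real (dx f z $ i) - \<i> * of_real (dy f z $ i)))"
    by (simp add: fun_eq_iff dz_def complex_eq_iff)
  have w: "wirt (\<lambda>z. (1/2) * (of_real (dx f z $ i) - \<i> * of_real (dy f z $ i)))
      ((1/2) * (dz (dx f) i z - \<i> * dz (dy f) i z))
      ((1/2) * (cnj (dz (dx f) i z) - \<i> * cnj (dz (dy f) i z))) z"
    by (rule wirt_cong[OF wirt_mult[OF wirt_const wirt_diff[OF wirt_component[OF d(2)]
            wirt_mult[OF wirt_const wirt_component[OF d(3)]]]]]) simp_all
  \<comment> \<open>The imaginary part is a difference of mixed partial derivatives; here their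
    symmetry is used.\<close>
  have b: "(1/2) * (cnj (dz (dx f) i z) - \<i> * cnj (dz (dy f) i z))
      = of_real (laplacian f z $ i / 4)"
    by (simp add: laplacian_def dz_def complex_eq_iff dx_dy_commute[OF assms])
  show ?thesis unfolding eq using w unfolding b by (rule exI)
qed

subsection \<open>Integrals over the plane\<close>

lemma measurable_Complex [measurable]: "(\<lambda>(x, y). Complex x y) \<in> borel_measurable (lborel \<Otimes>\<^sub>M lborel)"
proof -
  have "continuous_on UNIV (\<lambda>p::real \<times> real. Complex (fst p) (snd p))"
    by (intro continuous_intros)
  then have "(\<lambda>p::real \<times> real. Complex (fst p) (snd p)) \<in> borel_measurable borel"
    by (rule borel_measurable_continuous_onI)
  then show ?thesis by (simp add: lborel_prod case_prod_beta)
qed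

lemma lborel_complex: "lborel = distr (lborel \<Otimes>\<^sub>M lborel) borel (\<lambda>(x, y). Complex x y)"
proof (rule lborel_eqI)
  fix l u :: complex assume le: "\<And>b. b \<in> Basis \<Longrightarrow> l \<bullet> b \<le> u \<bullet> b"
  then have le': "Re l \<le> Re u" "Im l \<le> Im u" using le[of 1] le[of \<i>] by auto
  have "(\<lambda>(x, y). Complex x y) -` box l u \<inter> space (lborel \<Otimes>\<^sub>M lborel)
      = box (Re l) (Re u) \<times> box (Im l) (Im u)"
    by (auto simp: box_def Basis_complex_def space_pair_measure)
  then show "emeasure (distr (lborel \<Otimes>\<^sub>M lborel) borel (\<lambda>(x, y). Complex x y)) (box l u)
      = (\<Prod>b\<in>Basis. (u - l) \<bullet> b)"
    using le' by (simp add: emeasure_distr lborel.emeasure_pair_measure_Times Basis_complex_def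
        ennreal_mult)
qed simp

lemma nn_integral_complex:
  assumes [measurable]: "f \<in> borel_measurable borel"
  shows "(\<integral>\<^sup>+ z. f z \<partial>lborel) = (\<integral>\<^sup>+ x. \<integral>\<^sup>+ y. f (Complex x y) \<partial>lborel \<partial>lborel)"
  by (subst lborel_complex, subst nn_integral_distr)
     (simp_all add: lborel.nn_integral_fst[symmetric] case_prod_beta)

lemma norm_integral_le_nn_integral:
  fixes g :: "real \<Rightarrow> complex"
  assumes "continuous_on {a..b} g"
  shows "ennreal (norm (integral {a..b} g))
    \<le> (\<integral>\<^sup>+ x. indicator {a..b} x * ennreal (norm (g x)) \<partial>lborel)"
proof -
  have "set_integrable lborel {a..b} g" using assms by (rule borel_integrable_atLeastAtMost')
  then have "integral {a..b} g = (LINT x : {a..b} | lborel. g x)"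
    "integrable lborel (\<lambda>x. indicator {a..b} x *\<^sub>R g x)"
    by (simp_all add: set_borel_integral_eq_integral set_integrable_def)
  then have "ennreal (norm (integral {a..b} g))
      \<le> (\<integral>\<^sup>+ x. ennreal (norm (indicator {a..b} x *\<^sub>R g x)) \<partial>lborel)"
    using integral_norm_bound_ennreal unfolding set_lebesgue_integral_def by metis
  also have "(\<lambda>x. ennreal (norm (indicator {a..b} x *\<^sub>R g x)))
      = (\<lambda>x. indicator {a..b} x * ennreal (norm (g x)))"
    by (auto simp: indicator_def fun_eq_iff)
  finally show ?thesis .
qed

text \<open>A complex derivative is determined by difference quotients along any one ray, so
  constancy in a single direction is enough.\<close>

lemma derivative_0_if_const_on_ray:
  fixes f :: "complex \<Rightarrow> complex"
  assumes f: "(f has_field_derivative d) (at z)" and c: "c \<noteq> 0"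
    and const: "\<And>a::real. a \<ge> 0 \<Longrightarrow> f (z + of_real a * c) = f z"
  shows "d = 0"
proof -
  have "((\<lambda>a::real. z + of_real a * c) has_vector_derivative c) (at 0 within {0..1})"
    by (auto intro!: derivative_eq_intros)
  from field_vector_diff_chain_within[OF this, of f d]
  have "((\<lambda>a::real. f (z + of_real a * c)) has_vector_derivative c * d) (at 0 within {0..1})"
    using has_field_derivative_at_within[OF f] by (simp add: o_def)
  moreover have "((\<lambda>a::real. f (z + of_real a * c)) has_vector_derivative 0) (at 0 within {0..1})"
    by (rule has_vector_derivative_transform[of _ _ _ "\<lambda>_. f z"]) (use const in auto)
  ultimately have "c * d = 0"
    using vector_derivative_unique_within_closed_interval[of 0 1 0 "\<lambda>a::real. f (z + of_real a * c)"] by fastforce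
  then show ?thesis using c by simp
qed

text \<open>
  Integrating over a rectangle of fixed shape gives an entire function of its position, bounded
  by the \<open>L\<^sup>1\<close> norm, hence constant; subdividing a large rectangle shows that the constant is 0.
\<close>

lemma entire_integrable_eq_0:
  assumes hol: "f holomorphic_on UNIV"
    and fin: "(\<integral>\<^sup>+ z. ennreal (norm (f z)) \<partial>lborel) < \<infinity>"
  shows "f z = 0"
proof -
  obtain g where "\<And>x. x \<in> UNIV \<Longrightarrow> (g has_field_derivative f x) (at x within UNIV)"
    by (rule holomorphic_convex_primitive'[OF _ _ hol]) auto
  then have g: "(g has_field_derivative f x) (at x)" for x by simp
  then have "g holomorphic_on UNIV"
    by (auto simp: holomorphic_on_def field_differentiable_def)
  then obtain k where "\<And>x. x \<in> UNIV \<Longrightarrow> (k has_field_derivative g x) (at x within UNIV)"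
    using holomorphic_convex_primitive'[of UNIV g] by auto
  then have k: "(k has_field_derivative g x) (at x)" for x by simp
  have cf: "continuous_on UNIV f" using hol by (rule holomorphic_on_imp_continuous_on)
  have cg: "continuous_on UNIV g" by (rule DERIV_continuous_on[of UNIV g f]) (simp add: g)
  have fm [measurable]: "f \<in> borel_measurable borel"
    using cf by (rule borel_measurable_continuous_onI)
  define M where "M = enn2real (\<integral>\<^sup>+ z. ennreal (norm (f z)) \<partial>lborel)"
  have M: "(\<integral>\<^sup>+ z. ennreal (norm (f z)) \<partial>lborel) = ennreal M" "M \<ge> 0"
    using fin by (simp_all add: M_def)
  \<comment> \<open>Since \<open>k\<close> is a second primitive of \<open>f\<close>, this mixed
    second difference is \<i> times the integral of \<open>f\<close> over the rectangle with lower
    left corner \<open>z\<close> and sides \<open>a\<close>, \<open>b\<close>.\<close>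
  define G where "G a b z = k (z + of_real a + \<i> * of_real b) - k (z + of_real a)
      - k (z + \<i> * of_real b) + k z" for a b :: real and z
  have Gbound: "norm (G a b z) \<le> M" if ab: "a \<ge> 0" "b \<ge> 0" for a b z
  proof -
    define x0 where "x0 = Re z"
    define y0 where "y0 = Im z"
    have z: "z = Complex x0 y0" by (simp add: x0_def y0_def)
    have inner: "integral {y0..y0+b} (\<lambda>y. f (Complex x y))
        = - \<i> * (g (Complex x (y0+b)) - g (Complex x y0))" for x
    proof (rule integral_unique)
      have d: "((\<lambda>y. - \<i> * g (Complex x y)) has_vector_derivative f (Complex x y)) (at y within {y0..y0+b})" for y
        using has_vector_derivative_mult_right[OF
            wirt_vector_derivative_y[OF wirt_field_derivative[OF g]], of "- \<i>"] by simp
      have "((\<lambda>y. f (Complex x y)) has_integral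
          - \<i> * g (Complex x (y0+b)) - - \<i> * g (Complex x y0)) {y0..y0+b}"
        by (rule fundamental_theorem_of_calculus[OF _ d]) (use ab in simp)
      then show "((\<lambda>y. f (Complex x y)) has_integral
          - \<i> * (g (Complex x (y0+b)) - g (Complex x y0))) {y0..y0+b}"
        by (simp only: right_diff_distrib)
    qed
    define F where "F x = - \<i> * (g (Complex x (y0+b)) - g (Complex x y0))" for x
    have outer: "integral {x0..x0+a} F = - \<i> * G a b z"
    proof (rule integral_unique)
      define K where "K x = - \<i> * (k (Complex x (y0+b)) - k (Complex x y0))" for x
      have "(K has_vector_derivative F x) (at x within {x0..x0+a})" for x
        using wirt_vector_derivative_x[OF wirt_field_derivative[OF k], of _ _ "{x0..x0+a}"]
        unfolding K_def F_def by (intro has_vector_derivative_mult_right has_vector_derivative_diff) simp_all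
      note d = this
      have "(F has_integral K (x0+a) - K x0) {x0..x0+a}"
        by (rule fundamental_theorem_of_calculus[OF _ d]) (use ab in simp)
      moreover have "K (x0+a) - K x0 = - \<i> * G a b z"
      proof -
        have e: "z + of_real a + \<i> * of_real b = Complex (x0+a) (y0+b)" "z + of_real a = Complex (x0+a) y0"
          "Complex (x0+a) y0 + \<i> * of_real b = Complex (x0+a) (y0+b)"
          "z + \<i> * of_real b = Complex x0 (y0+b)"
          by (simp_all add: z complex_eq_iff)
        show ?thesis unfolding K_def G_def e by (simp add: z algebra_simps)
      qed
      ultimately show "(F has_integral - \<i> * G a b z) {x0..x0+a}" by simp
    qed
    have "ennreal (norm (G a b z)) = ennreal (norm (integral {x0..x0+a} F))"
      by (simp add: outer norm_mult)
    also have "\<dots> \<le> (\<integral>\<^sup>+ x. indicator {x0..x0+a} x * ennreal (norm (F x)) \<partial>lborel)"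
      by (rule norm_integral_le_nn_integral) (unfold F_def, intro continuous_intros continuous_on_Complex_args cg)
    also have "\<dots> \<le> (\<integral>\<^sup>+ x. \<integral>\<^sup>+ y. ennreal (norm (f (Complex x y))) \<partial>lborel \<partial>lborel)"
    proof (rule nn_integral_mono)
      fix x
      have "ennreal (norm (F x)) \<le> (\<integral>\<^sup>+ y. indicator {y0..y0+b} y * ennreal (norm (f (Complex x y))) \<partial>lborel)"
        unfolding F_def inner[symmetric] by (intro norm_integral_le_nn_integral continuous_on_Complex_args cf)
      also have "\<dots> \<le> (\<integral>\<^sup>+ y. ennreal (norm (f (Complex x y))) \<partial>lborel)"
        by (intro nn_integral_mono) (auto simp: indicator_def)
      finally show "indicator {x0..x0+a} x * ennreal (norm (F x)) \<le> \<dots>"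
        by (auto simp: indicator_def)
    qed
    also have "\<dots> = ennreal M"
      unfolding M(1)[symmetric] by (rule nn_integral_complex[symmetric]) measurable
    finally show ?thesis using M(2) by simp
  qed
  have G0: "G a b z = 0" if ab: "a \<ge> 0" "b \<ge> 0" for a b z
  proof -
    have const: "G a b z = G a b 0" if ab: "a \<ge> 0" "b \<ge> 0" for a b z
    proof -
      have "k holomorphic_on UNIV" using k by (auto simp: holomorphic_on_def field_differentiable_def)
      then have kk: "(\<lambda>z. k (z + c)) holomorphic_on UNIV" for c
        using holomorphic_on_compose_gen[of "\<lambda>z. z + c" UNIV k UNIV, unfolded o_def]
          holomorphic_on_add[OF holomorphic_on_ident holomorphic_on_const] by blast
      have "G a b holomorphic_on UNIV"
        unfolding G_def using kk[of "of_real a + \<i> * of_real b"] kk[of "of_real a"] kk[of "\<i> * of_real b"] kk[of 0]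
        by (intro holomorphic_intros) (simp_all add: add.assoc)
      moreover have "bounded (range (G a b))"
        using Gbound[OF ab] by (auto simp: bounded_iff)
      ultimately have "G a b constant_on UNIV" by (rule Liouville_theorem)
      then show ?thesis unfolding constant_on_def by (metis UNIV_I)
    qed
    \<comment> \<open>Two adjacent copies of a rectangle make one of twice the width, and by the
      preceding step both carry the same integral. Iterating, \<open>2 ^ n\<close> times this
      integral stays below the \<open>L\<^sup>1\<close> norm.\<close>
    have double: "G (2 * a) b 0 = 2 * G a b 0" if ab: "a \<ge> 0" "b \<ge> 0" for a b
    proof -
      have "G (2 * a) b 0 = G a b 0 + G a b (of_real a)"
        by (simp add: G_def algebra_simps)
      then show ?thesis using const[OF ab, of "of_real a"] by simp
    qed
    have pow: "G (2 ^ n * a) b 0 = 2 ^ n * G a b 0" for n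
    proof (induction n)
      case (Suc n)
      then show ?case using double[of "2 ^ n * a" b] ab by (simp add: mult.assoc)
    qed simp
    have "2 ^ n * norm (G a b 0) \<le> M" for n
      using Gbound[of "2 ^ n * a" b 0] ab by (simp add: pow norm_mult norm_power)
    then have "norm (G a b 0) = 0"
    proof -
      { assume "norm (G a b 0) \<noteq> 0"
        then have "norm (G a b 0) > 0" by simp
        then obtain n where "M / norm (G a b 0) < 2 ^ n" using real_arch_pow[of 2] by auto
        then have "M < 2 ^ n * norm (G a b 0)" using \<open>norm (G a b 0) > 0\<close> by (simp add: field_simps)
        then have False using \<open>2 ^ n * norm (G a b 0) \<le> M\<close> by simp }
      then show ?thesis by blast
    qed
    then show ?thesis using const[OF ab, of z] by simp
  qed
  \<comment> \<open>Differentiating \<open>G = 0\<close> in \<open>z\<close> and moving along the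
    real axis removes one primitive; the conclusion below removes the other along the imaginary
    axis.\<close>
  have gper: "g (z + \<i> * of_real b) = g z" if b: "b \<ge> 0" for z b
  proof -
    have "((\<lambda>z. k (z + \<i> * of_real b) - k z) has_field_derivative g (z + \<i> * of_real b) - g z) (at z)"
      using DERIV_shift[of k "g (z + \<i> * of_real b)" z "\<i> * of_real b"] k by (intro DERIV_diff) auto
    then have "g (z + \<i> * of_real b) - g z = 0"
      by (rule derivative_0_if_const_on_ray[of _ _ _ 1]) (use G0 b in \<open>simp_all add: G_def algebra_simps\<close>)
    then show ?thesis by simp
  qed
  show ?thesis
    by (rule derivative_0_if_const_on_ray[of g _ z \<i>]) (use g gper in \<open>simp_all add: mult.commute\<close>)
qed

subsection \<open>The Hopf differential\<close>

lemma wirt_inner: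
  assumes "f differentiable (at z)" "g differentiable (at z)"
  shows "wirt (\<lambda>z. of_real (f z \<bullet> g z))
    (\<Sum>i\<in>UNIV. dz f i z * of_real (g z $ i) + of_real (f z $ i) * dz g i z)
    (\<Sum>i\<in>UNIV. cnj (dz f i z) * of_real (g z $ i) + of_real (f z $ i) * cnj (dz g i z)) z"
proof -
  have "(\<lambda>z. complex_of_real (f z \<bullet> g z))
      = (\<lambda>z. \<Sum>i\<in>UNIV. complex_of_real (f z $ i) * of_real (g z $ i))"
    by (simp add: inner_vec_def fun_eq_iff)
  then show ?thesis
    using wirt_sum[of UNIV "\<lambda>i z. complex_of_real (f z $ i) * of_real (g z $ i)",
        OF wirt_mult[OF wirt_component[OF assms(1)] wirt_component[OF assms(2)]]]
    by simp
qed

lemma dz_inner_const: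
  assumes "\<And>z. f differentiable (at z)" "\<And>z. g differentiable (at z)" "\<And>z. f z \<bullet> g z = c"
  shows "(\<Sum>i\<in>UNIV. dz f i z * of_real (g z $ i) + of_real (f z $ i) * dz g i z) = 0"
  using wirt_unique(1)[OF wirt_inner[OF assms(1,2), of z], of 0 0] assms(3) by auto

text \<open>A bilinear form, so that \<open>hopf u u\<close> is the Hopf differential and
  \<open>hopf u v\<close> is half of its derivative at \<open>u\<close> in direction
  \<open>v\<close>.\<close>

definition hopf :: "(complex \<Rightarrow> real^3) \<Rightarrow> (complex \<Rightarrow> real^3) \<Rightarrow> complex \<Rightarrow> complex"
  where "hopf f g z = (\<Sum>i\<in>UNIV. dz f i z * dz g i z)"

text \<open>Up to the factor 1/4, the sum in the last hypothesis is the derivative of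
  \<open>hopf f g\<close> in the conjugate variable.\<close>

lemma hopf_holomorphic:
  assumes f: "Ck 2 f" and g: "Ck 2 g"
    and eq: "\<And>z. (\<Sum>i\<in>UNIV. of_real (laplacian f z $ i) * dz g i z
      + dz f i z * of_real (laplacian g z $ i)) = 0"
  shows "hopf f g holomorphic_on UNIV"
proof -
  have "\<exists>d. (hopf f g has_field_derivative d) (at z)" for z
  proof -
    have "\<forall>i. \<exists>a. wirt (dz f i) a (of_real (laplacian f z $ i / 4)) z"
      using wirt_dz[OF f] by blast
    then obtain a where a: "\<forall>i. wirt (dz f i) (a i) (of_real (laplacian f z $ i / 4)) z"
      by (rule choice[THEN exE])
    have "\<forall>i. \<exists>a. wirt (dz g i) a (of_real (laplacian g z $ i / 4)) z"
      using wirt_dz[OF g] by blast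
    then obtain b where b: "\<forall>i. wirt (dz g i) (b i) (of_real (laplacian g z $ i / 4)) z"
      by (rule choice[THEN exE])
    have "wirt (hopf f g) (\<Sum>i\<in>UNIV. a i * dz g i z + dz f i z * b i)
      (\<Sum>i\<in>UNIV. of_real (laplacian f z $ i / 4) * dz g i z
        + dz f i z * of_real (laplacian g z $ i / 4)) z"
      unfolding hopf_def[abs_def] by (intro wirt_sum wirt_mult a[rule_format] b[rule_format])
    moreover have "(\<Sum>i\<in>UNIV. of_real (laplacian f z $ i / 4) * dz g i z
        + dz f i z * of_real (laplacian g z $ i / 4)) = 0"
    proof -
      have "(\<Sum>i\<in>UNIV. of_real (laplacian f z $ i / 4) * dz g i z
        + dz f i z * of_real (laplacian g z $ i / 4))
        = (1/4) * (\<Sum>i\<in>UNIV. of_real (laplacian f z $ i) * dz g i z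
      + dz f i z * of_real (laplacian g z $ i))"
        by (simp add: sum_distrib_left algebra_simps)
      then show ?thesis using eq by simp
    qed
    ultimately show ?thesis using field_derivative_wirt by metis
  qed
  then show ?thesis by (auto simp: holomorphic_on_def field_differentiable_def)
qed

lemma grad_sq_dz: "grad_sq f z = 4 * (\<Sum>i\<in>UNIV. (cmod (dz f i z))\<^sup>2)"
  unfolding grad_sq_def dz_def cmod_power2 power2_norm_eq_inner inner_vec_def sum_3
  by (simp add: power2_eq_square)

lemma isCont_dz: "Ck 2 f \<Longrightarrow> isCont (dz f i) z"
  using wirt_dz wirt_isCont by blast

lemma grad_sq_continuous: "Ck 2 f \<Longrightarrow> continuous_on UNIV (grad_sq f)"
  unfolding grad_sq_dz
  by (intro continuous_at_imp_continuous_on ballI continuous_intros isCont_dz)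

lemma harmonic_mapD:
  assumes "harmonic_map u"
  shows "Ck k u" "u differentiable (at z)" "u z \<bullet> u z = 1" "laplacian u z = - (grad_sq u z *\<^sub>R u z)"
proof -
  show C: "Ck k u" for k using assms by (simp add: harmonic_map_def smooth_def)
  show "u differentiable (at z)" using C[of 2] by (rule Ck_2D)
  show "u z \<bullet> u z = 1" using assms by (simp add: harmonic_map_def norm_eq_1)
  show "laplacian u z = - (grad_sq u z *\<^sub>R u z)"
    using assms by (simp add: harmonic_map_def eq_neg_iff_add_eq_0)
qed

lemma harmonic_tangent:
  assumes "harmonic_map u" shows "(\<Sum>i\<in>UNIV. of_real (u z $ i) * dz u i z) = 0"
proof -
  have "(\<Sum>i\<in>UNIV. dz u i z * of_real (u z $ i) + of_real (u z $ i) * dz u i z)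
      = 2 * (\<Sum>i\<in>UNIV. of_real (u z $ i) * dz u i z)"
    by (simp add: sum_distrib_left algebra_simps)
  then show ?thesis
    using dz_inner_const[OF harmonic_mapD(2,2,3), OF assms assms assms, of z] by simp
qed

text \<open>Holomorphy is orthogonality: the Laplacian of a harmonic map is normal to the sphere,
  while \<open>dz u\<close> is tangential. Integrability is a pointwise bound by the energy
  density.\<close>

lemma hopf_eq_0:
  assumes u: "harmonic_map u" and fin: "energy u < \<infinity>"
  shows "hopf u u z = 0"
proof (rule entire_integrable_eq_0[of "hopf u u"])
  show "hopf u u holomorphic_on UNIV"
  proof (rule hopf_holomorphic)
    fix z
    have "(\<Sum>i\<in>UNIV. of_real (laplacian u z $ i) * dz u i z + dz u i z * of_real (laplacian u z $ i))
      = - 2 * of_real (grad_sq u z) * (\<Sum>i\<in>UNIV. of_real (u z $ i) * dz u i z)"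
      by (simp add: harmonic_mapD[OF u] sum_distrib_left algebra_simps sum.distrib)
    then show "(\<Sum>i\<in>UNIV. of_real (laplacian u z $ i) * dz u i z + dz u i z * of_real (laplacian u z $ i)) = 0"
      using harmonic_tangent[OF u] by simp
  qed (rule harmonic_mapD[OF u])+
  have "norm (hopf u u z) \<le> grad_sq u z" for z
  proof -
    have "norm (hopf u u z) \<le> (\<Sum>i\<in>UNIV. (cmod (dz u i z))\<^sup>2)"
      unfolding hopf_def by (rule order_trans[OF norm_sum]) (simp add: norm_mult power2_eq_square)
    also have "\<dots> \<le> grad_sq u z"
      unfolding grad_sq_dz by (simp add: sum_nonneg)
    finally show ?thesis .
  qed
  then have "(\<integral>\<^sup>+ z. ennreal (norm (hopf u u z)) \<partial>lborel) \<le> energy u"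
    unfolding energy_def by (intro nn_integral_mono ennreal_leI) auto
  then show "(\<integral>\<^sup>+ z. ennreal (norm (hopf u u z)) \<partial>lborel) < \<infinity>"
    using fin by (rule le_less_trans)
qed

subsection \<open>Stereographic charts of a conformal harmonic map\<close>

text \<open>Where one factor is nonzero, an open set, the other vanishes, and the identity theorem
  extends this to all of \<open>S\<close>.\<close>

lemma holomorphic_product_eq_0:
  assumes S: "open S" "connected S" and f: "f holomorphic_on S" and g: "g holomorphic_on S"
    and eq: "\<And>z. z \<in> S \<Longrightarrow> f z * g z = 0"
  shows "(\<forall>z\<in>S. f z = 0) \<or> (\<forall>z\<in>S. g z = 0)"
proof (cases "\<forall>z\<in>S. f z = 0")
  case False
  then obtain z1 where z1: "z1 \<in> S" "f z1 \<noteq> 0" by blast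
  have "open (S \<inter> f -` (- {0}))"
    using continuous_open_preimage[OF holomorphic_on_imp_continuous_on[OF f] S(1), of "- {0}"] by (simp add: open_Compl)
  moreover have "z1 \<in> S \<inter> f -` (- {0})" using z1 by simp
  moreover have "\<And>z. z \<in> S \<inter> f -` (- {0}) \<Longrightarrow> g z = 0" using eq by auto
  ultimately have "\<forall>z\<in>S. g z = 0"
    using analytic_continuation_open[of "S \<inter> f -` (- {0})" S g "\<lambda>_. 0"] S g by auto
  then show ?thesis by blast
qed blast

text \<open>Real form of the squared modulus of \<open>num\<close> below: \<open>x1\<close>,
  \<open>x2\<close>, \<open>x3\<close> and \<open>y1\<close>, \<open>y2\<close>, \<open>y3\<close>
  are the real and imaginary parts of \<open>A\<close>, \<open>B\<close>, \<open>T\<close>, both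
  orthogonal to the unit vector \<open>(a, b, t)\<close>. The last bracket is their triple product
  with it and carries the orientation.\<close>

lemma norm_num_identity:
  fixes a b t x1 x2 x3 y1 y2 y3 :: real
  assumes "a\<^sup>2 + b\<^sup>2 + t\<^sup>2 = 1" "a * x1 + b * x2 + t * x3 = 0" "a * y1 + b * y2 + t * y3 = 0"
  shows "((x1 - y2) * (1 - t) + (a * x3 - b * y3))\<^sup>2 + ((y1 + x2) * (1 - t) + (a * y3 + b * x3))\<^sup>2
    = (1 - t)\<^sup>2 * (x1\<^sup>2 + x2\<^sup>2 + x3\<^sup>2 + y1\<^sup>2 + y2\<^sup>2 + y3\<^sup>2
      + 2 * (a * (x2 * y3 - y2 * x3) + b * (x3 * y1 - y3 * x1) + t * (x1 * y2 - y1 * x2)))"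
  using assms by algebra

text \<open>Conjugates are replaced by independent variables to obtain a polynomial identity. The
  hypotheses are tangency, its conjugate, the sphere equation and the formula for the energy
  density.\<close>

lemma num_quotient_identity:
  fixes C C' Cb Cb' c cc t T Tb k :: complex
  assumes "C * cc + c * Cb' + 2 * t * T = 0" "Cb * c + cc * C' + 2 * t * Tb = 0"
    and "c * cc = (1 - t) * (1 + t)" and "2 * k = C * Cb + C' * Cb' + 2 * T * Tb"
  shows "((- k * c * (1 - t) + (1 - t) * (C * Tb + C' * T) + 2 * c * T * Tb) * (1 - t)) * 2
    = (cc * (C * (1 - t) + c * T) * (C' * (1 - t) + c * Tb)) * 2"
  using assms by algebra

text \<open>
  A conformal harmonic map into the sphere, in components and abstracted so that it also applies
  after the rotation by a half turn that exchanges the poles: \<open>A\<close>, \<open>B\<close>, \<open>T\<close> are the Wirtinger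
  derivatives of the components \<open>a\<close>, \<open>b\<close>, \<open>t\<close>, and \<open>k\<close> is a quarter of the energy density.
\<close>

locale conformal_sphere =
  fixes a b t k :: "complex \<Rightarrow> real" and A B T :: "complex \<Rightarrow> complex"
  assumes wa: "wirt (\<lambda>z. of_real (a z)) (A z) (cnj (A z)) z"
    and wb: "wirt (\<lambda>z. of_real (b z)) (B z) (cnj (B z)) z"
    and wt: "wirt (\<lambda>z. of_real (t z)) (T z) (cnj (T z)) z"
    and wA: "\<exists>p. wirt A p (- of_real (k z * a z)) z"
    and wB: "\<exists>p. wirt B p (- of_real (k z * b z)) z"
    and wT: "\<exists>p. wirt T p (- of_real (k z * t z)) z"
    and sphere: "(a z)\<^sup>2 + (b z)\<^sup>2 + (t z)\<^sup>2 = 1"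
    and k: "k z = (cmod (A z))\<^sup>2 + (cmod (B z))\<^sup>2 + (cmod (T z))\<^sup>2"
    and conformal: "(A z)\<^sup>2 + (B z)\<^sup>2 + (T z)\<^sup>2 = 0"
begin

text \<open>The Jacobian of the map in Wirtinger form. Unlike \<open>num\<close>, it is unchanged by
  the half turn that exchanges the poles, so orientation is expressed through it.\<close>

definition j :: "complex \<Rightarrow> real"
  where "j z = 4 * (a z * Im (cnj (B z) * T z) + b z * Im (cnj (T z) * A z) + t z * Im (cnj (A z) * B z))"

text \<open>Up to the factor \<open>(1 - t z)\<^sup>2\<close>, the derivative of the chart
  \<open>w\<close> in \<open>z\<close> for \<sigma> = \<i>, and the conjugate of its derivative in
  the conjugate variable for \<sigma> = -\<i>.\<close>

definition num :: "complex \<Rightarrow> complex \<Rightarrow> complex"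
  where "num \<sigma> z = (A z + \<sigma> * B z) * (1 - of_real (t z)) + (of_real (a z) + \<sigma> * of_real (b z)) * T z"

definition w :: "complex \<Rightarrow> complex"
  where "w z = (of_real (a z) + \<i> * of_real (b z)) / (1 - of_real (t z))"

lemma tangent: "a z * A z + b z * B z + t z * T z = 0"
proof -
  have "wirt (\<lambda>z. complex_of_real (a z) * a z + complex_of_real (b z) * b z + complex_of_real (t z) * t z)
    (A z * a z + a z * A z + (B z * b z + b z * B z) + (T z * t z + t z * T z))
    (cnj (A z) * a z + a z * cnj (A z) + (cnj (B z) * b z + b z * cnj (B z)) + (cnj (T z) * t z + t z * cnj (T z))) z"
    by (intro wirt_add wirt_mult wa wb wt)
  moreover have "complex_of_real (a z) * a z + complex_of_real (b z) * b z + complex_of_real (t z) * t z = 1" for z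
    using arg_cong[OF sphere[of z], of complex_of_real] by (simp add: power2_eq_square)
  ultimately have "wirt (\<lambda>z. 1)
    (A z * a z + a z * A z + (B z * b z + b z * B z) + (T z * t z + t z * T z))
    (cnj (A z) * a z + a z * cnj (A z) + (cnj (B z) * b z + b z * cnj (B z)) + (cnj (T z) * t z + t z * cnj (T z))) z"
    by simp
  from wirt_unique(1)[OF this wirt_const]
  have "2 * (a z * A z + b z * B z + t z * T z) = 0" by (simp add: algebra_simps)
  then show ?thesis by (metis mult_eq_0_iff zero_neq_numeral)
qed

lemma num_mult: "num \<i> z * num (-\<i>) z = 0"
proof -
  have s: "complex_of_real (a z)^2 + of_real (b z)^2 = 1 - of_real (t z)^2"
    using arg_cong[OF sphere[of z], of complex_of_real] by (simp add: algebra_simps)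
  have "num \<i> z * num (-\<i>) z = ((A z)\<^sup>2 + (B z)\<^sup>2) * (1 - of_real (t z))\<^sup>2
      + (1 - of_real (t z)) * T z * 2 * (a z * A z + b z * B z) + (of_real (a z)^2 + of_real (b z)^2) * (T z)\<^sup>2"
    unfolding num_def by (simp add: algebra_simps power2_eq_square)
  moreover have "(A z)\<^sup>2 + (B z)\<^sup>2 = - (T z)\<^sup>2" using conformal[of z] by (simp add: eq_neg_iff_add_eq_0)
  moreover have "a z * A z + b z * B z = - of_real (t z) * T z" using tangent[of z] by (simp add: eq_neg_iff_add_eq_0)
  ultimately have "num \<i> z * num (-\<i>) z = - (T z)\<^sup>2 * (1 - of_real (t z))\<^sup>2
      + (1 - of_real (t z)) * T z * 2 * (- of_real (t z) * T z) + (1 - of_real (t z)^2) * (T z)\<^sup>2" by (simp only: s)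
  also have "\<dots> = 0" by (simp add: algebra_simps power2_eq_square)
  finally show ?thesis .
qed

text \<open>The energy density splits into a holomorphic and an antiholomorphic part, whose
  difference is the Jacobian. This lemma gives the holomorphic part, the next one the
  antiholomorphic part.\<close>

lemma norm_num_p: "2 * (cmod (num \<i> z))\<^sup>2 = (1 - t z)\<^sup>2 * (2 * k z + j z)"
proof -
  have tan: "a z * Re (A z) + b z * Re (B z) + t z * Re (T z) = 0"
    "a z * Im (A z) + b z * Im (B z) + t z * Im (T z) = 0"
    using tangent[of z] by (simp_all add: complex_eq_iff)
  show ?thesis
    using norm_num_identity[OF sphere[of z] tan]
    by (simp add: num_def k j_def cmod_power2 algebra_simps)
qed

lemma norm_num_m: "2 * (cmod (num (-\<i>) z))\<^sup>2 = (1 - t z)\<^sup>2 * (2 * k z - j z)"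
proof -
  have tan: "a z * Re (A z) + (- b z) * (- Re (B z)) + t z * Re (T z) = 0"
    "a z * Im (A z) + (- b z) * (- Im (B z)) + t z * Im (T z) = 0"
    using tangent[of z] by (simp_all add: complex_eq_iff)
  have s: "(a z)\<^sup>2 + (- b z)\<^sup>2 + (t z)\<^sup>2 = 1" using sphere[of z] by simp
  show ?thesis
    using norm_num_identity[OF s tan]
    by (simp add: num_def k j_def cmod_power2 algebra_simps)
qed

lemma wirt_w:
  assumes "t z \<noteq> 1"
  shows "wirt w (num \<i> z / (1 - of_real (t z))\<^sup>2) (cnj (num (-\<i>) z) / (1 - of_real (t z))\<^sup>2) z"
proof -
  have nz: "1 - complex_of_real (t z) \<noteq> 0"
    using assms by (metis eq_iff_diff_eq_0 of_real_1 of_real_eq_iff)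
  show ?thesis
    unfolding w_def[abs_def]
    by (rule wirt_cong[OF wirt_divide[OF wirt_add[OF wa wirt_mult[OF wirt_const wb]]
            wirt_diff[OF wirt_const wt] nz]]) (simp_all add: num_def algebra_simps)
qed

text \<open>In the chart the harmonic map equation equates (1 + |w|^2) times the mixed derivative of
  \<open>w\<close> with twice the product of \<open>cnj w\<close> and both first derivatives of
  \<open>w\<close>. By \<open>num_mult\<close> one of these first derivatives vanishes at each
  point, so the mixed derivative is zero.\<close>

lemma num_quotient_holomorphic:
  assumes \<sigma>: "\<sigma> = \<i> \<or> \<sigma> = -\<i>" and S: "\<And>z. z \<in> S \<Longrightarrow> t z \<noteq> 1"
  shows "(\<lambda>z. num \<sigma> z / (1 - of_real (t z))\<^sup>2) holomorphic_on S"
proof -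
  have "\<exists>d. ((\<lambda>z. num \<sigma> z / (1 - of_real (t z))\<^sup>2) has_field_derivative d) (at z)" if "t z \<noteq> 1" for z
  proof -
    have nz: "1 - complex_of_real (t z) \<noteq> 0"
      using that by (metis eq_iff_diff_eq_0 of_real_1 of_real_eq_iff)
    obtain p q r where p: "wirt A p (- of_real (k z * a z)) z" and q: "wirt B q (- of_real (k z * b z)) z"
      and r: "wirt T r (- of_real (k z * t z)) z"
      using wA[of z] wB[of z] wT[of z] by blast
    define s where "s = 1 - complex_of_real (t z)"
    define C where "C = A z + \<sigma> * B z"
    define C' where "C' = cnj (A z) + \<sigma> * cnj (B z)"
    define c where "c = of_real (a z) + \<sigma> * of_real (b z)"
    \<comment> \<open>Apart from a factor \<open>s\<close>, this is the numerator of the derivative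
      in the conjugate variable.\<close>
    define E where "E = - of_real (k z) * c * s + s * (C * cnj (T z) + C' * T z) + 2 * c * T z * cnj (T z)"
    have sg: "cnj \<sigma> = - \<sigma>" "\<sigma> * \<sigma> = -1" using \<sigma> by auto
    have sg': "\<sigma> * (\<sigma> * x) = - x" for x using sg(2) by (simp flip: mult.assoc)
    have "\<exists>d. wirt (num \<sigma>) d (- of_real (k z) * c - C * cnj (T z) + C' * T z) z"
      unfolding num_def[abs_def]
      by (rule exI, rule wirt_cong[OF wirt_add[OF
              wirt_mult[OF wirt_add[OF p wirt_mult[OF wirt_const q]] wirt_diff[OF wirt_const wt]]
              wirt_mult[OF wirt_add[OF wa wirt_mult[OF wirt_const wb]] r]] refl])
        (simp add: C_def C'_def c_def algebra_simps)
    then obtain d where "wirt (num \<sigma>) d (- of_real (k z) * c - C * cnj (T z) + C' * T z) z" ..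
    from wirt_divide[OF this wirt_mult[OF wirt_diff[OF wirt_const wt] wirt_diff[OF wirt_const wt]], of 1 1] nz
    have "wirt (\<lambda>z. num \<sigma> z / ((1 - of_real (t z)) * (1 - of_real (t z))))
      ((d * (s * s) - num \<sigma> z * ((0 - T z) * s + s * (0 - T z))) / (s * s)\<^sup>2)
      (((- of_real (k z) * c - C * cnj (T z) + C' * T z) * (s * s) - num \<sigma> z * ((0 - cnj (T z)) * s + s * (0 - cnj (T z)))) / (s * s)\<^sup>2) z"
      by (simp add: s_def)
    moreover have "(- of_real (k z) * c - C * cnj (T z) + C' * T z) * (s * s) - num \<sigma> z * ((0 - cnj (T z)) * s + s * (0 - cnj (T z)))
        = s * E"
      unfolding E_def num_def C_def[symmetric] c_def[symmetric] s_def[symmetric]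
      by (simp add: algebra_simps)
    moreover have "E = 0"
    proof -
      have tan: "a z * A z + b z * B z + t z * T z = 0" by (rule tangent)
      have tan': "a z * cnj (A z) + b z * cnj (B z) + t z * cnj (T z) = 0"
        using arg_cong[OF tan, of cnj] by simp
      have 1: "C * cnj c + c * cnj C' + 2 * of_real (t z) * T z = 0"
      proof -
        have "C * cnj c + c * cnj C' + 2 * of_real (t z) * T z = 2 * (a z * A z + b z * B z + t z * T z)"
          by (simp add: C_def c_def C'_def algebra_simps sg sg')
        then show ?thesis by (simp add: tan)
      qed
      have 2: "cnj C * c + cnj c * C' + 2 * of_real (t z) * cnj (T z) = 0"
        using arg_cong[OF 1, of cnj] by (simp add: mult.commute)
      have 3: "c * cnj c = (1 - of_real (t z)) * (1 + of_real (t z))"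
      proof -
        have "c * cnj c = of_real ((a z)\<^sup>2 + (b z)\<^sup>2)"
          by (simp add: c_def algebra_simps sg sg' power2_eq_square)
        also have "(a z)\<^sup>2 + (b z)\<^sup>2 = (1 - t z) * (1 + t z)"
          using sphere[of z] by (simp add: algebra_simps power2_eq_square)
        finally show ?thesis by simp
      qed
      have 4: "2 * complex_of_real (k z) = C * cnj C + C' * cnj C' + 2 * T z * cnj (T z)"
      proof -
        have "complex_of_real (k z) = A z * cnj (A z) + B z * cnj (B z) + T z * cnj (T z)"
          by (simp add: k complex_norm_square del: of_real_power)
        then show ?thesis by (simp add: C_def C'_def algebra_simps sg sg')
      qed
      \<comment> \<open>The harmonic map equation in the chart: the last two factors are
        \<open>num \<sigma>\<close> and the conjugate of \<open>num (- \<sigma>)\<close>, one of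
        which is zero.\<close>
      have "(E * s) * 2 = (cnj c * (C * s + c * T z) * (C' * s + c * cnj (T z))) * 2"
        using num_quotient_identity[OF 1 2 3 4] unfolding E_def s_def by simp
      moreover have "C * s + c * T z = num \<sigma> z"
        by (simp add: num_def C_def s_def c_def)
      moreover have "C' * s + c * cnj (T z) = cnj (num (-\<sigma>) z)"
        by (simp add: num_def C'_def s_def c_def sg)
      moreover have "num \<sigma> z = 0 \<or> num (-\<sigma>) z = 0"
        using num_mult[of z] \<sigma> by auto
      ultimately show "E = 0" using nz by (auto simp: s_def)
    qed
    ultimately have "wirt (\<lambda>z. num \<sigma> z / ((1 - of_real (t z)) * (1 - of_real (t z))))
      ((d * (s * s) - num \<sigma> z * ((0 - T z) * s + s * (0 - T z))) / (s * s)\<^sup>2) 0 z" by simp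
    then show ?thesis unfolding power2_eq_square[of "1 - complex_of_real _"]
      using field_derivative_wirt by blast
  qed
  then show ?thesis
    using S unfolding holomorphic_on_def field_differentiable_def
    by (blast intro: has_field_derivative_at_within)
qed

text \<open>The alternative comes from two holomorphic functions with product zero. The second
  clause is unique continuation for zeros of the energy density; it is what allows the alternative
  to be passed between overlapping balls.\<close>

lemma local_dichotomy:
  assumes "t z0 \<noteq> 1"
  shows "\<exists>r>0. ((\<forall>z\<in>ball z0 r. j z = 2 * k z) \<or> (\<forall>z\<in>ball z0 r. j z = - 2 * k z)) \<and>
    (\<forall>S. open S \<longrightarrow> S \<noteq> {} \<longrightarrow> S \<subseteq> ball z0 r \<longrightarrow> (\<forall>z\<in>S. k z = 0) \<longrightarrow> (\<forall>z\<in>ball z0 r. k z = 0))"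
proof -
  have "isCont (\<lambda>z. Re (complex_of_real (t z))) z0"
    by (rule continuous_Re[OF wirt_isCont[OF wt]])
  then have "isCont t z0" by simp
  then obtain r where r: "r > 0" "\<And>z. dist z0 z < r \<Longrightarrow> t z \<noteq> 1"
    using assms continuous_at_avoid[of z0 t 1] by blast
  let ?U = "ball z0 r"
  have tU: "z \<in> ?U \<Longrightarrow> t z \<noteq> 1" for z using r by simp
  let ?P = "\<lambda>z. num \<i> z / (1 - of_real (t z))\<^sup>2" and ?M = "\<lambda>z. num (-\<i>) z / (1 - of_real (t z))\<^sup>2"
  have hP: "?P holomorphic_on ?U" and hM: "?M holomorphic_on ?U"
    using num_quotient_holomorphic tU by blast+
  have nz: "1 - complex_of_real (t z) \<noteq> 0" if "z \<in> ?U" for z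
    using tU[OF that] by (metis eq_iff_diff_eq_0 of_real_1 of_real_eq_iff)
  have "(\<forall>z\<in>?U. ?P z = 0) \<or> (\<forall>z\<in>?U. ?M z = 0)"
    by (rule holomorphic_product_eq_0[OF _ _ hP hM]) (use num_mult in auto)
  then have "(\<forall>z\<in>?U. j z = 2 * k z) \<or> (\<forall>z\<in>?U. j z = - 2 * k z)"
  proof (elim disjE)
    assume 0: "\<forall>z\<in>?U. ?P z = 0"
    have "j z = - 2 * k z" if z: "z \<in> ?U" for z
    proof -
      have "num \<i> z = 0" using bspec[OF 0 z] nz[OF z] by simp
      then have "2 * k z + j z = 0" using norm_num_p[of z] tU[OF z] by simp
      then show ?thesis by simp
    qed
    then show ?thesis by blast
  next
    assume 0: "\<forall>z\<in>?U. ?M z = 0"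
    have "j z = 2 * k z" if z: "z \<in> ?U" for z
    proof -
      have "num (-\<i>) z = 0" using bspec[OF 0 z] nz[OF z] by simp
      then have "2 * k z - j z = 0" using norm_num_m[of z] tU[OF z] by simp
      then show ?thesis by simp
    qed
    then show ?thesis by blast
  qed
  moreover have "\<forall>z\<in>?U. k z = 0"
    if S: "open S" "S \<noteq> {}" "S \<subseteq> ?U" and kS: "\<forall>z\<in>S. k z = 0" for S
  proof -
    have z0: "num \<i> z = 0" "num (-\<i>) z = 0" if "z \<in> S" for z
    proof -
      have "A z = 0" "B z = 0" "T z = 0"
        using kS that k[of z] by (auto simp: add_nonneg_eq_0_iff)
      then show "num \<i> z = 0" "num (-\<i>) z = 0" by (simp_all add: num_def)
    qed
    have P0: "?P z = 0" if "z \<in> ?U" for z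
      by (rule analytic_continuation_open[of S ?U ?P "\<lambda>_. 0"])
        (use S hP z0 that in \<open>simp_all\<close>)
    have M0: "?M z = 0" if "z \<in> ?U" for z
      by (rule analytic_continuation_open[of S ?U ?M "\<lambda>_. 0"])
        (use S hM z0 that in \<open>simp_all\<close>)
    show ?thesis
    proof (intro ballI)
      fix z assume z: "z \<in> ?U"
      have "num \<i> z = 0" using P0[OF z] nz[OF z] by simp
      then have p: "2 * k z + j z = 0" using norm_num_p[of z] tU[OF z] by simp
      have "num (-\<i>) z = 0" using M0[OF z] nz[OF z] by simp
      then have "2 * k z - j z = 0" using norm_num_m[of z] tU[OF z] by simp
      then show "k z = 0" using p by simp
    qed
  qed
  ultimately show ?thesis using r(1) by blast
qed

lemma holomorphic_w:
  assumes "t z \<noteq> 1" "j z = 2 * k z"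
  shows "\<exists>d. (w has_field_derivative d) (at z) \<and> (cmod d)\<^sup>2 * (1 - t z)\<^sup>2 = 2 * k z"
proof -
  have nz: "1 - t z \<noteq> 0" using assms by simp
  have "num (-\<i>) z = 0" using norm_num_m[of z] assms by simp
  then have "(w has_field_derivative num \<i> z / (1 - of_real (t z))\<^sup>2) (at z)"
    using wirt_w[OF assms(1)] field_derivative_wirt by simp
  moreover have "(cmod (num \<i> z / (1 - of_real (t z))\<^sup>2))\<^sup>2 * (1 - t z)\<^sup>2 = 2 * k z"
  proof -
    have cancel: "S * X / S\<^sup>2 * S = X" if "S \<noteq> 0" for S X :: real
      using that by (simp add: power2_eq_square)
    have "cmod (1 - complex_of_real (t z)) = \<bar>1 - t z\<bar>"
      by (metis norm_of_real of_real_1 of_real_diff)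
    then have "(cmod (num \<i> z / (1 - of_real (t z))\<^sup>2))\<^sup>2 = (cmod (num \<i> z))\<^sup>2 / ((1 - t z)\<^sup>2)\<^sup>2"
      by (simp add: norm_divide norm_power power_divide)
    also have "(cmod (num \<i> z))\<^sup>2 = (1 - t z)\<^sup>2 * (2 * k z)" using norm_num_p[of z] assms by simp
    finally show ?thesis using cancel[of "(1 - t z)\<^sup>2"] nz by simp
  qed
  ultimately show ?thesis by blast
qed

end

subsection \<open>Meromorphic functions omitting values near infinity\<close>

lemma norm_poly_le:
  assumes "degree P \<le> n" "norm z \<ge> 1"
  shows "norm (poly P z) \<le> (\<Sum>i\<le>n. norm (coeff P i)) * norm (z::complex) ^ n"
proof -
  have "poly P z = (\<Sum>i\<le>n. coeff P i * z ^ i)"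
    by (rule poly_altdef[THEN trans], rule sum.mono_neutral_left) (use assms in \<open>auto simp: coeff_eq_0\<close>)
  also have "norm \<dots> \<le> (\<Sum>i\<le>n. norm (coeff P i) * norm z ^ n)"
  proof (rule order_trans[OF norm_sum sum_mono])
    fix i assume "i \<in> {..n}"
    then have "norm z ^ i \<le> norm z ^ n" using assms(2) by (intro power_increasing) auto
    then show "norm (coeff P i * z ^ i) \<le> norm (coeff P i) * norm z ^ n"
      by (simp add: norm_mult norm_power mult_left_mono)
  qed
  finally show ?thesis by (simp add: sum_distrib_right)
qed

lemma entire_polynomial_growth:
  assumes "f holomorphic_on UNIV" "\<And>z. A \<le> norm z \<Longrightarrow> norm (f z) \<le> B * norm z ^ n"
  obtains P where "degree P \<le> n" "\<And>z. f z = poly P z"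
proof
  let ?P = "\<Sum>k\<le>n. monom ((deriv ^^ k) f 0 / fact k) k"
  show "degree ?P \<le> n"
    by (intro degree_sum_le) (auto intro: order_trans[OF degree_monom_le])
  show "f z = poly ?P z" for z
    using Liouville_polynomial[OF assms] by (simp add: poly_sum poly_monom)
qed

text \<open>Induction on the number of zeros: one zero is divided out with its full multiplicity, so
  that the quotient no longer vanishes there.\<close>

lemma entire_finite_zeros_factor:
  assumes "f holomorphic_on UNIV" "finite {z::complex. f z = 0}"
  shows "\<exists>P g. g holomorphic_on UNIV \<and> (\<forall>z. g z \<noteq> 0) \<and> (\<forall>z. f z = poly P z * g z)"
  using assms
proof (induction "card {z. f z = 0}" arbitrary: f)
  case 0
  then have "f z \<noteq> 0" for z by (auto simp: card_eq_0_iff)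
  then show ?case using 0 by (intro exI[of _ 1] exI[of _ f]) auto
next
  case (Suc N)
  have "{z. f z = 0} \<noteq> {}" using Suc.hyps(2) by (intro notI) simp
  then obtain \<xi> where \<xi>: "f \<xi> = 0" by blast
  have "\<not> f constant_on UNIV"
  proof
    assume "f constant_on UNIV"
    then have "{z. f z = 0} = UNIV" using \<xi> unfolding constant_on_def by auto
    then show False using Suc.prems(2) infinite_UNIV_char_0[where 'a=complex] by simp
  qed
  then obtain g r n where g: "0 < n" "0 < r" "g holomorphic_on ball \<xi> r"
    "\<And>w. w \<in> ball \<xi> r \<Longrightarrow> f w = (w - \<xi>) ^ n * g w" "\<And>w. w \<in> ball \<xi> r \<Longrightarrow> g w \<noteq> 0"
    using holomorphic_factor_zero_nonconstant[OF Suc.prems(1) open_UNIV connected_UNIV UNIV_I \<xi>] by metis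
  define G where "G z = (if z = \<xi> then g \<xi> else f z / (z - \<xi>) ^ n)" for z
  have fG: "f z = (z - \<xi>) ^ n * G z" for z
    using \<xi> g(1) by (auto simp: G_def)
  have "(\<lambda>z. f z / (z - \<xi>) ^ n) holomorphic_on (- {\<xi>})"
    by (intro holomorphic_intros holomorphic_on_subset[OF Suc.prems(1)]) auto
  then have 1: "G holomorphic_on (- {\<xi>})"
    by (rule holomorphic_transform) (auto simp: G_def)
  have 2: "G holomorphic_on ball \<xi> r"
    using g(3) by (rule holomorphic_transform) (auto simp: G_def g(4))
  have "G holomorphic_on (- {\<xi>} \<union> ball \<xi> r)"
    using 1 2 by (intro holomorphic_on_Un) (auto simp: open_Compl)
  moreover have "- {\<xi>} \<union> ball \<xi> r = UNIV" using g(2) by auto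
  ultimately have G: "G holomorphic_on UNIV" by simp
  have "G \<xi> \<noteq> 0" using g(2,5) by (simp add: G_def)
  then have zeros: "{z. f z = 0} = insert \<xi> {z. G z = 0}" "\<xi> \<notin> {z. G z = 0}"
    using \<xi> by (auto simp: fG)
  then have fin: "finite {z. G z = 0}" using Suc.prems(2) by (metis finite_insert)
  then have "N = card {z. G z = 0}" using Suc.hyps(2) zeros by simp
  from Suc.hyps(1)[OF this G fin] obtain P k where
    k: "k holomorphic_on UNIV" "\<forall>z. k z \<noteq> 0" "\<forall>z. G z = poly P z * k z" by blast
  show ?case
    by (rule exI[of _ "[:-\<xi>, 1:] ^ n * P"], rule exI[of _ k])
      (use k in \<open>auto simp: fG mult_ac\<close>)
qed

text \<open>The great Picard theorem is applied to \<open>p / (q - a p)\<close> at infinity.\<close>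

lemma entire_quotient_omitting_three_values:
  fixes p q :: "complex \<Rightarrow> complex"
  assumes p: "p holomorphic_on UNIV" and q: "q holomorphic_on UNIV"
    and abc: "a \<noteq> b" "b \<noteq> c" "a \<noteq> c"
    and omit: "\<And>z e. norm z > R \<Longrightarrow> e \<in> {a, b, c} \<Longrightarrow> q z \<noteq> e * p z"
  obtains P Q g where "g holomorphic_on UNIV" "\<And>z. g z \<noteq> 0"
    "\<And>z. p z = poly P z * g z" "\<And>z. q z = poly Q z * g z"
proof -
  define R0 where "R0 = max R 0 + 1"
  have R0: "R0 > 0" "R0 > R" by (auto simp: R0_def)
  let ?B = "ball (0::complex) (1 / R0)"
  have inv: "norm (inverse \<zeta>) > R" "norm (inverse \<zeta>) > R0" if "\<zeta> \<in> ?B - {0}" for \<zeta>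
  proof -
    have "norm \<zeta> < 1 / R0" "norm \<zeta> > 0" using that by auto
    then show "norm (inverse \<zeta>) > R0"
      using less_imp_inverse_less[of "norm \<zeta>" "1 / R0"] by (simp add: norm_inverse)
    then show "norm (inverse \<zeta>) > R" using R0 by linarith
  qed
  \<comment> \<open>This is 1/(q/p - a) at the point \<open>1/\<zeta>\<close>. Since q/p omits
    \<open>a\<close>, \<open>b\<close>, \<open>c\<close> near infinity, \<open>f\<close> is
    holomorphic on the punctured disc and omits the two values \<open>1 / (b - a)\<close> and
    \<open>1 / (c - a)\<close>.\<close>
  define f where "f \<zeta> = p (inverse \<zeta>) / (q (inverse \<zeta>) - a * p (inverse \<zeta>))" for \<zeta>
  have "inverse holomorphic_on ?B - {0}"
    by (rule holomorphic_on_inverse[OF holomorphic_on_ident]) auto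
  then have comp: "(\<lambda>\<zeta>. k (inverse \<zeta>)) holomorphic_on ?B - {0}" if "k holomorphic_on UNIV" for k
    using holomorphic_on_compose_gen[OF _ that, of inverse "?B - {0}"]
    by (auto simp: o_def)
  have "f holomorphic_on ?B - {0}"
    unfolding f_def using omit[OF inv(1), of _ a]
    by (intro holomorphic_intros comp p q) auto
  moreover have "f \<zeta> \<noteq> 1 / (b - a) \<and> f \<zeta> \<noteq> 1 / (c - a)" if "\<zeta> \<in> ?B - {0}" for \<zeta>
    using omit[OF inv(1)[OF that], of a] omit[OF inv(1)[OF that], of b] omit[OF inv(1)[OF that], of c] abc
    unfolding f_def by (auto simp: field_simps)
  moreover have "1 / (b - a) \<noteq> 1 / (c - a)" using abc by (auto simp: field_simps)
  ultimately obtain l where l: "(f \<longlongrightarrow> l) (at 0) \<or> ((inverse \<circ> f) \<longlongrightarrow> l) (at 0)"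
    using great_Picard[of ?B 0 "1 / (b - a)" "1 / (c - a)" f] R0 by auto
  \<comment> \<open>If \<open>f\<close> has a finite limit, then \<open>p\<close> is bounded by a
    multiple of \<open>q - a p\<close>. Otherwise \<open>f\<close> tends to infinity, q/p tends to
    \<open>a\<close>, and hence stays away from \<open>b\<close>.\<close>
  have "\<exists>e\<in>{a, b}. \<exists>d>0. \<exists>M. \<forall>\<zeta>. \<zeta> \<noteq> 0 \<longrightarrow> norm \<zeta> < d \<longrightarrow>
    norm (p (inverse \<zeta>)) \<le> M * norm (q (inverse \<zeta>) - e * p (inverse \<zeta>))"
  proof -
    have bd: "\<exists>d>0. \<exists>M. \<forall>\<zeta>. \<zeta> \<noteq> 0 \<longrightarrow> norm \<zeta> < d \<longrightarrow>
        norm (p (inverse \<zeta>)) \<le> M * norm (q (inverse \<zeta>) - a * p (inverse \<zeta>))"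
      if fl: "(f \<longlongrightarrow> l) (at 0)" for l
    proof -
      obtain d where d: "d > 0" "\<And>\<zeta>. \<zeta> \<noteq> 0 \<Longrightarrow> norm \<zeta> < d \<Longrightarrow> norm (f \<zeta> - l) < 1"
        using LIM_D[OF fl, of 1] by auto
      have "norm (p (inverse \<zeta>)) \<le> (norm l + 1) * norm (q (inverse \<zeta>) - a * p (inverse \<zeta>))"
        if \<zeta>: "\<zeta> \<noteq> 0" "norm \<zeta> < min d (1 / R0)" for \<zeta>
      proof -
        have ne: "q (inverse \<zeta>) - a * p (inverse \<zeta>) \<noteq> 0"
          using omit[OF inv(1), of \<zeta> a] \<zeta> by auto
        have "norm (f \<zeta>) \<le> norm l + 1"
          using d(2)[of \<zeta>] \<zeta> norm_triangle_ineq2[of "f \<zeta>" l] by auto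
        then have "norm (f \<zeta>) * norm (q (inverse \<zeta>) - a * p (inverse \<zeta>))
          \<le> (norm l + 1) * norm (q (inverse \<zeta>) - a * p (inverse \<zeta>))"
          by (rule mult_right_mono) simp
        then show ?thesis using ne by (simp add: f_def norm_divide)
      qed
      then show ?thesis using d(1) R0 by (intro exI[of _ "min d (1 / R0)"]) auto
    qed
    show ?thesis
    proof (cases "\<exists>l. (f \<longlongrightarrow> l) (at 0)")
      case True
      then show ?thesis using bd by blast
    next
      case False
      with l have il: "((inverse \<circ> f) \<longlongrightarrow> l) (at 0)" by blast
      have "l = 0"
      proof (rule ccontr)
        assume "l \<noteq> 0"
        then have "((\<lambda>\<zeta>. inverse ((inverse \<circ> f) \<zeta>)) \<longlongrightarrow> inverse l) (at 0)"
          using il by (rule tendsto_inverse[rotated])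
        then show False using False by (simp add: o_def)
      qed
      \<comment> \<open>Once \<open>q - a p\<close> is below half of |b - a| |p| in modulus, the
        triangle inequality keeps \<open>q - b p\<close> above the other half.\<close>
      define m where "m = norm (b - a) / 2"
      have m: "m > 0" using abc by (simp add: m_def)
      obtain d where d: "d > 0" "\<And>\<zeta>. \<zeta> \<noteq> 0 \<Longrightarrow> norm \<zeta> < d \<Longrightarrow> norm (inverse (f \<zeta>)) < m"
        using LIM_D[OF il m] \<open>l = 0\<close> by (auto simp: o_def)
      have "norm (p (inverse \<zeta>)) \<le> (1 / m) * norm (q (inverse \<zeta>) - b * p (inverse \<zeta>))"
        if \<zeta>: "\<zeta> \<noteq> 0" "norm \<zeta> < min d (1 / R0)" for \<zeta>
      proof (cases "p (inverse \<zeta>) = 0")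
        case False
        let ?p = "p (inverse \<zeta>)" and ?q = "q (inverse \<zeta>)"
        have "norm (?q - a * ?p) / norm ?p < m"
          using d(2)[of \<zeta>] \<zeta> by (simp add: f_def norm_inverse norm_divide)
        then have "norm (?q - a * ?p) < m * norm ?p" using False by (simp add: field_simps)
        moreover have "norm ((b - a) * ?p) \<le> norm (?q - a * ?p) + norm (?q - b * ?p)"
        proof -
          have "(b - a) * ?p = (?q - a * ?p) - (?q - b * ?p)" by (simp add: algebra_simps)
          then show ?thesis by (metis norm_triangle_ineq4)
        qed
        moreover have "norm ((b - a) * ?p) = 2 * (m * norm ?p)" by (simp add: m_def norm_mult)
        ultimately have "m * norm ?p \<le> norm (?q - b * ?p)" by linarith
        then show ?thesis using m by (simp add: field_simps)
      qed (use m in auto)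
      then show ?thesis using d(1) R0 by (intro bexI[of _ b] exI[of _ "min d (1 / R0)"] conjI exI[of _ "1 / m"]) auto
    qed
  qed
  then obtain e d M where e: "e \<in> {a, b}" and d: "d > 0"
    and M: "\<And>\<zeta>. \<zeta> \<noteq> 0 \<Longrightarrow> norm \<zeta> < d \<Longrightarrow>
      norm (p (inverse \<zeta>)) \<le> M * norm (q (inverse \<zeta>) - e * p (inverse \<zeta>))" by blast
  \<comment> \<open>The chosen combination has only finitely many zeros, hence is a polynomial times
    a nowhere zero \<open>g\<close>; the bound on \<open>p\<close> makes \<open>p/g\<close> a
    polynomial as well.\<close>
  define F where "F z = q z - e * p z" for z
  have F: "F holomorphic_on UNIV" unfolding F_def by (intro holomorphic_intros p q)
  have Fne: "F z \<noteq> 0" if "norm z > R" for z using omit[OF that, of e] e by (auto simp: F_def)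
  have "\<not> F constant_on UNIV \<or> (\<forall>z. F z \<noteq> 0)"
    using Fne[of "of_real R0"] R0 unfolding constant_on_def by auto
  then have "finite {z. F z = 0}"
  proof
    assume "\<not> F constant_on UNIV"
    then have "finite {z \<in> cball 0 R. F z = 0}"
      by (intro holomorphic_compact_finite_zeros[OF F]) auto
    moreover have "{z. F z = 0} = {z \<in> cball 0 R. F z = 0}" using Fne by force
    ultimately show ?thesis by simp
  qed simp
  from entire_finite_zeros_factor[OF F this] obtain S g where
    g: "g holomorphic_on UNIV" "\<And>z. g z \<noteq> 0" "\<And>z. F z = poly S z * g z" by blast
  define B where "B = (\<Sum>i\<le>degree S. norm (coeff S i))"
  have growth: "norm (p z / g z) \<le> (\<bar>M\<bar> * B) * norm z ^ degree S" if z: "max 1 (1 / d + 1) \<le> norm z" for z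
  proof -
    have z0: "z \<noteq> 0" "norm z \<ge> 1" using z by auto
    have "1 / d < norm z" using z by simp
    then have "norm (inverse z) < d" using d less_imp_inverse_less[of "1 / d" "norm z"] by (simp add: norm_inverse)
    then have "norm (p z) \<le> M * norm (F z)" using M[of "inverse z"] z0 by (simp add: F_def)
    also have "\<dots> \<le> \<bar>M\<bar> * norm (F z)" by (intro mult_right_mono) auto
    finally have "norm (p z / g z) \<le> \<bar>M\<bar> * norm (poly S z)"
      using g(2)[of z] by (simp add: g(3) norm_mult norm_divide field_simps)
    also have "\<dots> \<le> \<bar>M\<bar> * (B * norm z ^ degree S)"
      using norm_poly_le[OF order_refl z0(2)] by (intro mult_left_mono) (auto simp: B_def)
    finally show ?thesis by (simp add: mult.assoc)
  qed
  have "(\<lambda>z. p z / g z) holomorphic_on UNIV" by (intro holomorphic_intros p g)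
  from entire_polynomial_growth[OF this growth] obtain P where P: "\<And>z. p z / g z = poly P z"
    by blast
  show ?thesis
  proof (rule that[of g P "S + smult e P"])
    show p': "p z = poly P z * g z" for z using P[of z] g(2)[of z] by (simp add: field_simps)
    show "q z = poly (S + smult e P) z * g z" for z
      using g(3)[of z] p'[of z] by (simp add: F_def algebra_simps)
  qed (use g in auto)
qed

section \<open>Areas of images of holomorphic maps\<close>

lemma lborel_vec2: "lborel = distr (lborel :: (real^2) measure) borel (\<lambda>v. Complex (v $ 1) (v $ 2))"
proof (rule lborel_eqI)
  have [measurable]: "(\<lambda>v::real^2. Complex (v $ 1) (v $ 2)) \<in> borel_measurable borel"
    by (intro borel_measurable_continuous_onI continuous_intros)
  fix l u :: complex assume le: "\<And>b. b \<in> Basis \<Longrightarrow> l \<bullet> b \<le> u \<bullet> b"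
  have le': "Re l \<le> Re u" "Im l \<le> Im u" using le[of 1] le[of \<i>] by auto
  let ?v = "\<lambda>z. vector [Re z, Im z] :: real^2"
  have "(\<lambda>v::real^2. Complex (v $ 1) (v $ 2)) -` box l u = box (?v l) (?v u)"
    by (auto simp: box_def Basis_complex_def mem_box_cart forall_2 Basis_vec_def inner_axis)
  moreover have "emeasure lborel (box (?v l) (?v u)) = ennreal ((Re u - Re l) * (Im u - Im l))"
  proof -
    have B: "(Basis :: (real^2) set) = {axis 1 1, axis 2 1}" by (auto simp: Basis_vec_def UNIV_2)
    have ne: "axis 1 1 \<noteq> (axis 2 1 :: real^2)" by (simp add: axis_eq_axis)
    have "emeasure lborel (box (?v l) (?v u)) = ennreal (\<Prod>b\<in>Basis. (?v u - ?v l) \<bullet> b)"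
      by (rule emeasure_lborel_box) (use le' in \<open>auto simp: B inner_axis\<close>)
    then show ?thesis unfolding B using ne by (simp add: inner_axis)
  qed
  ultimately show "emeasure (distr (lborel :: (real^2) measure) borel (\<lambda>v. Complex (v $ 1) (v $ 2))) (box l u)
      = (\<Prod>b\<in>Basis. (u - l) \<bullet> b)"
    by (simp add: emeasure_distr Basis_complex_def)
qed simp

text \<open>The image of a set under a holomorphic map has area at most the integral of \<open>\<bar>f'\<bar>\<^sup>2\<close>.\<close>

lemma infinite_omitted_values:
  fixes f d :: "complex \<Rightarrow> complex" and D :: "complex \<Rightarrow> real"
  assumes E [measurable]: "E \<in> sets borel" and D [measurable]: "D \<in> borel_measurable borel"
    and deriv: "\<And>z. z \<in> E \<Longrightarrow> (f has_field_derivative d z) (at z)"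
    and dD: "\<And>z. z \<in> E \<Longrightarrow> (cmod (d z))\<^sup>2 = D z"
    and area: "(\<integral>\<^sup>+ z. indicator E z * ennreal (D z) \<partial>lborel) < emeasure lborel (ball (0::complex) 1)"
  shows "infinite (ball 0 1 - f ` E)"
proof
  assume fin: "finite (ball 0 1 - f ` E)"
  define \<phi> where "\<phi> v = Complex (v $ 1) (v $ 2)" for v :: "real^2"
  define \<psi> where "\<psi> z = (vector [Re z, Im z] :: real^2)" for z
  have \<phi>\<psi> [simp]: "\<phi> (\<psi> z) = z" for z by (simp add: \<phi>_def \<psi>_def)
  have \<psi>\<phi> [simp]: "\<psi> (\<phi> v) = v" for v by (simp add: \<phi>_def \<psi>_def vec_eq_iff forall_2)
  have lin\<phi>: "bounded_linear \<phi>"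
  proof -
    have "linear \<phi>" by (rule linearI) (simp_all add: \<phi>_def complex_eq_iff)
    then show ?thesis by (simp add: linear_conv_bounded_linear)
  qed
  have lin\<psi>: "bounded_linear \<psi>"
  proof -
    have "linear \<psi>" by (rule linearI) (simp_all add: \<psi>_def vec_eq_iff forall_2)
    then show ?thesis by (simp add: linear_conv_bounded_linear)
  qed
  have [measurable]: "\<phi> \<in> borel_measurable borel"
    by (intro borel_measurable_continuous_onI linear_continuous_on lin\<phi>)
  have lb: "lborel = distr lborel borel \<phi>"
    using lborel_vec2 by (simp add: \<phi>_def[abs_def])
  define S where "S = \<phi> -` E"
  define g where "g = \<psi> \<circ> f \<circ> \<phi>"
  define g' where "g' v = (\<lambda>h. \<psi> (d (\<phi> v) * \<phi> h))" for v
  have S [measurable]: "S \<in> sets borel"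
    using measurable_sets[OF \<open>\<phi> \<in> borel_measurable borel\<close> E] by (simp add: S_def)
  have gd: "(g has_derivative g' v) (at v within S)" if "v \<in> S" for v
  proof -
    have "(f has_derivative (\<lambda>h. d (\<phi> v) * h)) (at (\<phi> v))"
      using deriv[of "\<phi> v"] that by (simp add: S_def has_field_derivative_def)
    then have "((\<lambda>v. f (\<phi> v)) has_derivative (\<lambda>h. d (\<phi> v) * \<phi> h)) (at v within S)"
      using has_derivative_compose[OF bounded_linear_imp_has_derivative[OF lin\<phi>]] by blast
    from bounded_linear.has_derivative[OF lin\<psi> this] show ?thesis
      by (simp add: g_def g'_def o_def)
  qed
  have D0: "D (\<phi> v) \<ge> 0" if "v \<in> S" for v
    using dD[of "\<phi> v"] that zero_le_power2[of "cmod (d (\<phi> v))"] by (simp add: S_def)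
  have det: "\<bar>det (matrix (g' v))\<bar> = D (\<phi> v)" if "v \<in> S" for v
  proof -
    \<comment> \<open>Multiplication by a complex number scales area by its squared modulus.\<close>
    have "det (matrix (g' v)) = (cmod (d (\<phi> v)))\<^sup>2"
      unfolding cmod_power2
      by (simp add: det_2 matrix_def g'_def \<psi>_def \<phi>_def axis_def power2_eq_square)
    then show ?thesis using dD[of "\<phi> v"] D0[OF that] that by (simp add: S_def)
  qed
  define M where "M = enn2real (\<integral>\<^sup>+ z. indicator E z * ennreal (D z) \<partial>lborel)"
  have bfin: "emeasure lborel (ball (0::complex) 1) < \<infinity>" by (rule emeasure_lborel_ball_finite)
  have M: "(\<integral>\<^sup>+ z. indicator E z * ennreal (D z) \<partial>lborel) = ennreal M" "M \<ge> 0"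
    using less_trans[OF area bfin] by (simp_all add: M_def)
  have "(\<integral>\<^sup>+ v. ennreal (indicator S v * D (\<phi> v)) \<partial>lborel)
      = (\<integral>\<^sup>+ v. indicator E (\<phi> v) * ennreal (D (\<phi> v)) \<partial>lborel)"
    by (intro nn_integral_cong) (auto simp: S_def indicator_def)
  also have "\<dots> = (\<integral>\<^sup>+ z. indicator E z * ennreal (D z) \<partial>distr lborel borel \<phi>)"
    by (subst nn_integral_distr) simp_all
  also have "\<dots> = ennreal M" unfolding lb[symmetric] by (rule M)
  finally have "(\<integral>\<^sup>+ v. ennreal (indicator S v * D (\<phi> v)) \<partial>lborel) = ennreal M" .
  then have "((\<lambda>v. indicator S v * D (\<phi> v)) has_integral M) UNIV"
    using D0 by (intro nn_integral_has_integral M(2)) (auto simp: indicator_def)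
  also have "(\<lambda>v. indicator S v * D (\<phi> v)) = (\<lambda>v. if v \<in> S then D (\<phi> v) else 0)"
    by (auto simp: indicator_def)
  finally have "((\<lambda>v. D (\<phi> v)) has_integral M) S"
    by (simp add: has_integral_restrict_UNIV)
  then have hi: "((\<lambda>v. \<bar>det (matrix (g' v))\<bar>) has_integral M) S"
    by (rule has_integral_eq[rotated]) (simp add: det)
  have Sl: "S \<in> sets lebesgue" using S by simp
  have im: "g ` S \<in> lmeasurable" "measure lebesgue (g ` S) \<le> M"
    using measurable_differentiable_image[OF Sl gd has_integral_integrable[OF hi]]
      measure_differentiable_image[OF Sl gd has_integral_integrable[OF hi]] integral_unique[OF hi] by auto
  \<comment> \<open>With finitely many omitted values the unit disc would be the image up to a null
    set, yet the image has smaller area.\<close>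
  define N where "N = \<psi> ` (ball 0 1 - f ` E)"
  have "finite N" using fin by (simp add: N_def)
  then have N: "N \<in> lmeasurable" "measure lebesgue N = 0"
    using negligible_finite negligible_iff_measure by blast+
  have sub: "\<phi> -` ball 0 1 \<subseteq> g ` S \<union> N"
  proof
    fix v assume v: "v \<in> \<phi> -` ball 0 1"
    show "v \<in> g ` S \<union> N"
    proof (cases "\<phi> v \<in> f ` E")
      case True
      then obtain z where z: "z \<in> E" "\<phi> v = f z" by blast
      then have "\<psi> z \<in> S" "g (\<psi> z) = v" by (simp_all add: S_def g_def flip: z(2))
      then show ?thesis by blast
    next
      case False
      then have "\<psi> (\<phi> v) \<in> N" using v unfolding N_def by blast
      then show ?thesis by simp
    qed
  qed
  have bm: "\<phi> -` ball 0 1 \<in> sets borel"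
    using measurable_sets[OF \<open>\<phi> \<in> borel_measurable borel\<close>, of "ball 0 1"] by simp
  have "emeasure lborel (ball (0::complex) 1) = emeasure lborel (\<phi> -` ball 0 1)"
    by (subst lb) (simp add: emeasure_distr)
  also have "\<dots> = emeasure lebesgue (\<phi> -` ball 0 1)" using bm by simp
  also have "\<dots> \<le> emeasure lebesgue (g ` S \<union> N)"
    by (rule emeasure_mono[OF sub]) (use im N in \<open>auto simp: fmeasurableD\<close>)
  also have "\<dots> = ennreal (measure lebesgue (g ` S \<union> N))"
    by (rule emeasure_eq_measure2) (use im N in \<open>auto intro: fmeasurable.Un\<close>)
  also have "\<dots> \<le> ennreal M"
    using measure_Un_le[of "g ` S" lebesgue N] im N by (intro ennreal_leI) (auto simp: fmeasurableD)
  also have "\<dots> < emeasure lborel (ball (0::complex) 1)" using area M(1) by simp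
  finally show False by simp
qed

subsection \<open>Finite energy harmonic maps are rational\<close>

definition jac :: "(complex \<Rightarrow> real^3) \<Rightarrow> complex \<Rightarrow> real"
  where "jac u z = dx u z \<bullet> cross3 (u z) (dy u z)"

lemma harmonic_wirt_dz:
  assumes u: "harmonic_map u"
  shows "\<exists>p. wirt (dz u i) p (- of_real (grad_sq u z / 4 * u z $ i)) z"
  using wirt_dz[OF harmonic_mapD(1)[OF u, of 2], of i z] by (simp add: harmonic_mapD(4)[OF u])

text \<open>The second instance is \<open>u\<close> after a half turn about the first axis. Its
  chart is the reciprocal of the first one and is regular at the north pole.\<close>

lemma harmonic_conformal_sphere:
  assumes u: "harmonic_map u" and fin: "energy u < \<infinity>"
  shows "conformal_sphere (\<lambda>z. u z $ 1) (\<lambda>z. u z $ 2) (\<lambda>z. u z $ 3) (\<lambda>z. grad_sq u z / 4)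
    (dz u 1) (dz u 2) (dz u 3)" (is ?N)
    and "conformal_sphere (\<lambda>z. u z $ 1) (\<lambda>z. - u z $ 2) (\<lambda>z. - u z $ 3) (\<lambda>z. grad_sq u z / 4)
    (dz u 1) (\<lambda>z. - dz u 2 z) (\<lambda>z. - dz u 3 z)" (is ?S)
proof -
  have c: "wirt (\<lambda>z. complex_of_real (u z $ i)) (dz u i z) (cnj (dz u i z)) z" for i z
    by (rule wirt_component[OF harmonic_mapD(2)[OF u]])
  have m: "wirt (\<lambda>z. complex_of_real (- u z $ i)) (- dz u i z) (cnj (- dz u i z)) z" for i z
    using wirt_minus[OF c[of i z]] by simp
  have dm: "\<exists>p. wirt (\<lambda>z. - dz u i z) p (- of_real (grad_sq u z / 4 * - u z $ i)) z" for i z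
    using harmonic_wirt_dz[OF u, of i z] wirt_minus by fastforce
  have s: "(u z $ 1)\<^sup>2 + (u z $ 2)\<^sup>2 + (u z $ 3)\<^sup>2 = 1" for z
    using harmonic_mapD(3)[OF u, of z] by (simp add: inner_vec_def sum_3 power2_eq_square)
  have h: "(dz u 1 z)\<^sup>2 + (dz u 2 z)\<^sup>2 + (dz u 3 z)\<^sup>2 = 0" for z
    using hopf_eq_0[OF u fin, of z] by (simp add: hopf_def sum_3 power2_eq_square)
  have k: "grad_sq u z / 4 = (cmod (dz u 1 z))\<^sup>2 + (cmod (dz u 2 z))\<^sup>2 + (cmod (dz u 3 z))\<^sup>2" for z
    by (simp add: grad_sq_dz sum_3)
  show ?N by (unfold_locales; (rule c harmonic_wirt_dz[OF u] s h k)?)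
  show ?S by (unfold_locales; (rule c m harmonic_wirt_dz[OF u] dm)?) (use s h k in auto)
qed

lemma jac_dz:
  "jac u z = 4 * (u z $ 1 * Im (cnj (dz u 2 z) * dz u 3 z) + u z $ 2 * Im (cnj (dz u 3 z) * dz u 1 z)
    + u z $ 3 * Im (cnj (dz u 1 z) * dz u 2 z))"
  by (simp add: jac_def dz_def cross3_def inner_vec_def sum_3 algebra_simps)

text \<open>The local hypothesis makes the interior closed as well as open, and the plane is
  connected.\<close>

lemma interior_empty_or_UNIV:
  fixes S :: "complex set"
  assumes loc: "\<And>z. \<exists>r>0. ball z r \<inter> interior S \<noteq> {} \<longrightarrow> ball z r \<subseteq> S"
  shows "interior S = {} \<or> S = UNIV"
proof -
  have "open (- interior S)"
  proof (subst open_subopen, intro ballI)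
    fix z assume z: "z \<in> - interior S"
    obtain r where r: "r > 0" "ball z r \<inter> interior S \<noteq> {} \<longrightarrow> ball z r \<subseteq> S" using loc by blast
    have "\<not> ball z r \<subseteq> S"
      using z r(1) interior_maximal[of "ball z r" S] centre_in_ball[of z r] by blast
    then show "\<exists>T. open T \<and> z \<in> T \<and> T \<subseteq> - interior S"
      using r by (intro exI[of _ "ball z r"]) auto
  qed
  then show ?thesis
    using connected_clopen[of "UNIV :: complex set"] interior_subset[of S]
    by (auto simp: closed_def connected_UNIV)
qed

text \<open>Near each point at least one polar chart is available, and both give the same Jacobian.
  If a ball of negative orientation meets the interior of the positive set, the energy density
  vanishes on the overlap, hence on the ball, where the two orientations then coincide.\<close>

lemma harmonic_orientation:
  assumes u: "harmonic_map u" and fin: "energy u < \<infinity>"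
  shows "(\<forall>z. jac u z = grad_sq u z / 2) \<or> (\<forall>z. jac u z = - grad_sq u z / 2)"
proof -
  interpret N: conformal_sphere "\<lambda>z. u z $ 1" "\<lambda>z. u z $ 2" "\<lambda>z. u z $ 3" "\<lambda>z. grad_sq u z / 4"
    "dz u 1" "dz u 2" "dz u 3" by (rule harmonic_conformal_sphere[OF u fin])
  interpret S: conformal_sphere "\<lambda>z. u z $ 1" "\<lambda>z. - u z $ 2" "\<lambda>z. - u z $ 3" "\<lambda>z. grad_sq u z / 4"
    "dz u 1" "\<lambda>z. - dz u 2 z" "\<lambda>z. - dz u 3 z" by (rule harmonic_conformal_sphere[OF u fin])
  have Nj: "N.j z = jac u z" and Sj: "S.j z = jac u z" for z
    by (simp_all add: N.j_def S.j_def jac_dz algebra_simps)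
  let ?P = "\<lambda>z0 r. (\<forall>z\<in>ball z0 r. jac u z = grad_sq u z / 2)"
  let ?M = "\<lambda>z0 r. (\<forall>z\<in>ball z0 r. jac u z = - grad_sq u z / 2)"
  have loc: "\<exists>r>0. (?P z0 r \<or> ?M z0 r) \<and>
    (\<forall>S. open S \<longrightarrow> S \<noteq> {} \<longrightarrow> S \<subseteq> ball z0 r \<longrightarrow> (\<forall>z\<in>S. grad_sq u z = 0) \<longrightarrow> (\<forall>z\<in>ball z0 r. grad_sq u z = 0))" for z0
  proof (cases "u z0 $ 3 = 1")
    case True
    then have "- u z0 $ 3 \<noteq> 1" by simp
    from S.local_dichotomy[OF this] show ?thesis unfolding Sj by simp
  next
    case False
    from N.local_dichotomy[OF this] show ?thesis unfolding Nj by simp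
  qed
  let ?S = "{z. jac u z = grad_sq u z / 2}"
  have "interior ?S = {} \<or> ?S = UNIV"
  proof (rule interior_empty_or_UNIV)
    fix z0
    obtain r where r: "r > 0" "?P z0 r \<or> ?M z0 r"
      "\<And>S. open S \<Longrightarrow> S \<noteq> {} \<Longrightarrow> S \<subseteq> ball z0 r \<Longrightarrow> (\<forall>z\<in>S. grad_sq u z = 0) \<Longrightarrow> (\<forall>z\<in>ball z0 r. grad_sq u z = 0)"
      using loc[of z0] by blast
    have "ball z0 r \<subseteq> ?S" if ne: "ball z0 r \<inter> interior ?S \<noteq> {}" and M: "?M z0 r"
    proof -
      have "grad_sq u z = 0" if z: "z \<in> ball z0 r \<inter> interior ?S" for z
      proof -
        have "jac u z = grad_sq u z / 2" using z interior_subset by blast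
        moreover have "jac u z = - grad_sq u z / 2" using z M by blast
        ultimately show ?thesis by simp
      qed
      then have g0: "\<forall>z\<in>ball z0 r. grad_sq u z = 0" using ne by (intro r(3)) auto
      show ?thesis
      proof
        fix z assume z: "z \<in> ball z0 r"
        then have "jac u z = - grad_sq u z / 2" "grad_sq u z = 0" using M g0 by blast+
        then show "z \<in> ?S" by simp
      qed
    qed
    then show "\<exists>r>0. ball z0 r \<inter> interior ?S \<noteq> {} \<longrightarrow> ball z0 r \<subseteq> ?S" using r(1,2) by blast
  qed
  then show ?thesis
  proof
    assume e: "interior ?S = {}"
    have "jac u z = - grad_sq u z / 2" for z
    proof -
      obtain r where r: "r > 0" "?P z r \<or> ?M z r" using loc[of z] by blast
      have "\<not> ?P z r"
        using interior_maximal[of "ball z r" ?S] e r(1) centre_in_ball[of z r] by blast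
      then show ?thesis using r centre_in_ball[of z r] by blast
    qed
    then show ?thesis by blast
  qed blast
qed

text \<open>Continuity from above of the energy measure along the complements of growing
  discs.\<close>

lemma energy_tail:
  assumes C: "Ck 2 u" and fin: "energy u < \<infinity>" and e: "(e::ennreal) > 0"
  obtains R where "(\<integral>\<^sup>+ z. indicator {z. norm z > R} z * ennreal (grad_sq u z) \<partial>lborel) < e"
proof -
  have [measurable]: "grad_sq u \<in> borel_measurable borel"
    by (rule borel_measurable_continuous_onI[OF grad_sq_continuous[OF C]])
  let ?M = "density lborel (\<lambda>z. ennreal (grad_sq u z))"
  define A where "A n = {z::complex. norm z > real n}" for n
  have Am [measurable]: "A n \<in> sets borel" for n unfolding A_def by (intro borel_open open_Collect_less continuous_intros)
  have em: "emeasure ?M (A n) = (\<integral>\<^sup>+ z. indicator {z. norm z > real n} z * ennreal (grad_sq u z) \<partial>lborel)" for n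
    by (subst emeasure_density) (auto simp: A_def mult.commute)
  have "emeasure ?M (A n) \<le> energy u" for n
    unfolding em energy_def by (intro nn_integral_mono) (auto simp: indicator_def)
  then have "emeasure ?M (A n) \<noteq> \<infinity>" for n using fin by (metis infinity_ennreal_def leD)
  moreover have "decseq A" by (auto simp: decseq_def A_def)
  moreover have "range A \<subseteq> sets ?M" by auto
  ultimately have "(\<lambda>n. emeasure ?M (A n)) \<longlonglongrightarrow> emeasure ?M (\<Inter>n. A n)"
    by (intro Lim_emeasure_decseq)
  moreover have "(\<Inter>n. A n) = {}"
    by (auto simp: A_def) (meson less_le_not_le less_imp_le reals_Archimedean2)
  ultimately have "(\<lambda>n. emeasure ?M (A n)) \<longlonglongrightarrow> 0" by simp
  then have "eventually (\<lambda>n. emeasure ?M (A n) < e) sequentially"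
    using e by (rule order_tendstoD)
  then obtain n where "emeasure ?M (A n) < e" by (auto simp: eventually_sequentially)
  then show ?thesis using that unfolding em by blast
qed

text \<open>A common divisor has no zeros, hence is constant by the fundamental theorem of
  algebra.\<close>

lemma coprime_polyI:
  fixes p q :: "complex poly"
  assumes "\<And>z. poly p z \<noteq> 0 \<or> poly q z \<noteq> 0"
  shows "coprime p q"
proof (rule coprimeI)
  fix c assume c: "c dvd p" "c dvd q"
  have "poly c z \<noteq> 0" for z
    using assms[of z] c by (auto elim!: dvdE)
  then have "constant (poly c)" using Fundamental_Theorem_Algebra.fundamental_theorem_of_algebra by blast
  then have "degree c = 0" by (simp add: constant_degree)
  moreover have "c \<noteq> 0" using \<open>\<And>z. poly c z \<noteq> 0\<close> by auto
  ultimately show "is_unit c" by (simp add: is_unit_iff_degree)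
qed

lemma stereo_chart:
  fixes v :: "real^3"
  assumes "norm v = 1" "v $ 3 \<noteq> 1"
  shows "stereo ((of_real (v $ 1) + \<i> * of_real (v $ 2)) / (1 - of_real (v $ 3))) = v"
    and "(cmod ((of_real (v $ 1) + \<i> * of_real (v $ 2)) / (1 - of_real (v $ 3))))\<^sup>2 * (1 - v $ 3) = 1 + v $ 3"
proof -
  define s where "s = 1 - v $ 3"
  have s: "s \<noteq> 0" using assms by (simp add: s_def)
  have n: "(v $ 1)\<^sup>2 + (v $ 2)\<^sup>2 + (v $ 3)\<^sup>2 = 1"
    using assms(1) by (simp add: norm_eq_1 inner_vec_def sum_3 power2_eq_square)
  define w where "w = (of_real (v $ 1) + \<i> * of_real (v $ 2)) / (1 - complex_of_real (v $ 3))"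
  have w: "w = Complex (v $ 1 / s) (v $ 2 / s)"
  proof -
    have "w = (of_real (v $ 1) + \<i> * of_real (v $ 2)) / of_real s" by (simp add: w_def s_def)
    then show ?thesis by (simp add: complex_eq_iff)
  qed
  have cw: "(cmod w)\<^sup>2 = (1 + v $ 3) / s"
  proof -
    have "(cmod w)\<^sup>2 = ((v $ 1)\<^sup>2 + (v $ 2)\<^sup>2) / s\<^sup>2"
      unfolding cmod_power2 w by (simp add: power_divide add_divide_distrib)
    also have "(v $ 1)\<^sup>2 + (v $ 2)\<^sup>2 = s * (1 + v $ 3)"
      using n by (simp add: s_def algebra_simps power2_eq_square)
    finally show ?thesis using s by (simp add: power2_eq_square)
  qed
  then show "(cmod ((of_real (v $ 1) + \<i> * of_real (v $ 2)) / (1 - of_real (v $ 3))))\<^sup>2 * (1 - v $ 3) = 1 + v $ 3"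
    using s unfolding w_def[symmetric] s_def[symmetric] by simp
  have "1 + (cmod w)\<^sup>2 = 2 / s" "(cmod w)\<^sup>2 - 1 = 2 * v $ 3 / s"
    unfolding cw using s by (simp_all add: field_simps) (simp_all add: s_def)
  then show "stereo ((of_real (v $ 1) + \<i> * of_real (v $ 2)) / (1 - of_real (v $ 3))) = v"
    unfolding w_def[symmetric] stereo_def using s by (simp add: vec_eq_iff forall_3 w)
qed

text \<open>The constant map to the north pole is split off because the chart \<open>N.w\<close> is
  nowhere defined on it. Otherwise \<open>N.w\<close> is meromorphic on the plane, and the
  Weierstrass factorisation writes it as a quotient of entire functions without common zeros, to
  which the omitted values apply.\<close>

lemma harmonic_rational:
  assumes u: "harmonic_map u" and fin: "energy u < \<infinity>"
    and pos: "\<And>z. jac u z = grad_sq u z / 2"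
  obtains p q where "coprime p q" "\<And>z. u z = stereo_quot (poly q z) (poly p z)"
proof (cases "\<forall>z. u z $ 3 = 1")
  case True
  have "u z = stereo_quot (poly 1 z) (poly 0 z)" for z
  proof -
    have "(u z $ 1)\<^sup>2 + (u z $ 2)\<^sup>2 = 0"
      using harmonic_mapD(3)[OF u, of z] True by (simp add: inner_vec_def sum_3 power2_eq_square)
    then have "u z $ 1 = 0" "u z $ 2 = 0" by (auto simp: sum_power2_eq_zero_iff)
    then show ?thesis using True by (simp add: stereo_quot_def vec_eq_iff forall_3)
  qed
  then show ?thesis using that[of 0 1] by simp
next
  case False
  interpret N: conformal_sphere "\<lambda>z. u z $ 1" "\<lambda>z. u z $ 2" "\<lambda>z. u z $ 3" "\<lambda>z. grad_sq u z / 4"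
    "dz u 1" "dz u 2" "dz u 3" by (rule harmonic_conformal_sphere[OF u fin])
  interpret S: conformal_sphere "\<lambda>z. u z $ 1" "\<lambda>z. - u z $ 2" "\<lambda>z. - u z $ 3" "\<lambda>z. grad_sq u z / 4"
    "dz u 1" "\<lambda>z. - dz u 2 z" "\<lambda>z. - dz u 3 z" by (rule harmonic_conformal_sphere[OF u fin])
  have Nj: "N.j z = 2 * (grad_sq u z / 4)" and Sj: "S.j z = 2 * (grad_sq u z / 4)" for z
    using pos[of z] by (simp_all add: N.j_def S.j_def jac_dz algebra_simps)
  have n1: "norm (u z) = 1" for z using harmonic_mapD(3)[OF u] by (simp add: norm_eq_1)
  have cu: "continuous_on UNIV (\<lambda>z. u z $ i)" for i
    using harmonic_mapD(2)[OF u]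
    by (intro continuous_at_imp_continuous_on ballI bounded_linear.continuous[OF bounded_linear_vec_nth]
        differentiable_imp_continuous_within)
  have op: "open {z. u z $ 3 \<noteq> c}" for c
    using cu by (intro open_Collect_neq) auto
  have cm [measurable]: "(\<lambda>z. u z $ i) \<in> borel_measurable borel" for i
    by (rule borel_measurable_continuous_onI[OF cu])
  have hN: "N.w holomorphic_on {z. u z $ 3 \<noteq> 1}"
    using N.holomorphic_w[OF _ Nj] op unfolding holomorphic_on_def field_differentiable_def
    by (blast intro: has_field_derivative_at_within)
  have hS: "S.w holomorphic_on {z. u z $ 3 \<noteq> -1}"
  proof -
    have "\<exists>d. (S.w has_field_derivative d) (at z)" if "u z $ 3 \<noteq> -1" for z
    proof -
      have "- u z $ 3 \<noteq> 1" using that by (metis minus_minus)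
      from S.holomorphic_w[OF this Sj] show ?thesis by blast
    qed
    then show ?thesis unfolding holomorphic_on_def field_differentiable_def
      by (blast intro: has_field_derivative_at_within)
  qed
  have sphere: "(u z $ 1)\<^sup>2 + (u z $ 2)\<^sup>2 + (u z $ 3)\<^sup>2 = 1" for z by (rule N.sphere)
  have S0: "S.w z = 0 \<longleftrightarrow> u z $ 3 = 1" if "u z $ 3 \<noteq> -1" for z
  proof -
    let ?c = "complex_of_real (u z $ 1) + \<i> * of_real (- u z $ 2)"
    have ne: "1 - complex_of_real (- u z $ 3) \<noteq> 0"
      using that by (metis add_eq_0_iff diff_minus_eq_add of_real_1 of_real_eq_iff of_real_minus)
    then have "S.w z = 0 \<longleftrightarrow> ?c = 0" by (simp add: S.w_def)
    also have "\<dots> \<longleftrightarrow> (u z $ 1)\<^sup>2 + (u z $ 2)\<^sup>2 = 0"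
      by (simp add: complex_eq_iff sum_power2_eq_zero_iff)
    also have "\<dots> \<longleftrightarrow> (u z $ 3)\<^sup>2 = 1" using sphere[of z] by linarith
    also have "\<dots> \<longleftrightarrow> u z $ 3 = 1" using that by (auto simp: power2_eq_1_iff)
    finally show ?thesis .
  qed
  have NS: "N.w z = inverse (S.w z)" if "u z $ 3 \<noteq> -1" for z
  proof (cases "u z $ 3 = 1")
    case True
    then have "N.w z = 0" by (simp add: N.w_def)
    then show ?thesis using S0[OF that] True by simp
  next
    case F: False
    let ?a = "complex_of_real (u z $ 1)" and ?b = "complex_of_real (u z $ 2)" and ?t = "complex_of_real (u z $ 3)"
    have ne: "1 - ?t \<noteq> 0" using F by (metis eq_iff_diff_eq_0 of_real_1 of_real_eq_iff)
    have ne': "1 + ?t \<noteq> 0"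
      using that by (metis add_eq_0_iff of_real_1 of_real_eq_iff of_real_minus)
    have "?a\<^sup>2 + ?b\<^sup>2 + ?t\<^sup>2 = 1" using arg_cong[OF sphere[of z], of complex_of_real] by simp
    then have "(?a + \<i> * ?b) * (?a - \<i> * ?b) = (1 - ?t) * (1 + ?t)"
      by (simp add: algebra_simps power2_eq_square)
    then have "N.w z * S.w z = 1" using ne ne' by (simp add: N.w_def S.w_def)
    then show ?thesis by (metis inverse_unique mult.commute)
  qed
  \<comment> \<open>Needed so that \<open>S.w\<close> does not vanish identically near a point
    mapped to the north pole; only then is its reciprocal meromorphic there.\<close>
  have int0: "interior {z. u z $ 3 = 1} = {}"
  proof -
    let ?S = "{z. u z $ 3 = 1}"
    have "interior ?S = {} \<or> ?S = UNIV"
    proof (rule interior_empty_or_UNIV)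
      fix z
      show "\<exists>r>0. ball z r \<inter> interior ?S \<noteq> {} \<longrightarrow> ball z r \<subseteq> ?S"
      proof (cases "u z $ 3 = 1")
        case False
        then have "z \<in> {z. u z $ 3 \<noteq> 1}" by simp
        then obtain r where "r > 0" "ball z r \<subseteq> {z. u z $ 3 \<noteq> 1}" using op[of 1] openE by blast
        then show ?thesis using interior_subset[of ?S] by blast
      next
        case True
        then have "z \<in> {z. u z $ 3 \<noteq> -1}" by simp
        then obtain r where r: "r > 0" "ball z r \<subseteq> {z. u z $ 3 \<noteq> -1}"
          using op[of "-1"] openE by blast
        have "ball z r \<subseteq> ?S" if ne: "ball z r \<inter> interior ?S \<noteq> {}"
        proof -
          have "S.w y = 0" if "y \<in> ball z r" for y
          proof (rule analytic_continuation_open[of "ball z r \<inter> interior ?S" "ball z r" S.w "\<lambda>_. 0"])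
            show "S.w holomorphic_on ball z r" using hS r(2) by (rule holomorphic_on_subset)
            fix x assume x: "x \<in> ball z r \<inter> interior ?S"
            then have "u x $ 3 = 1" using interior_subset by blast
            then show "S.w x = 0" using S0[of x] by simp
          qed (use ne that in auto)
          then show ?thesis using S0 r(2) by blast
        qed
        then show ?thesis using r(1) by blast
      qed
    qed
    then show ?thesis using False by blast
  qed
  have contN: "isCont N.w z" if "u z $ 3 \<noteq> 1" for z
    using N.holomorphic_w[OF that Nj] DERIV_isCont by blast
  \<comment> \<open>At such a point \<open>S.w\<close> has an isolated zero, and \<open>N.w\<close>
    is its reciprocal.\<close>
  have pole: "N.w meromorphic_on {z} \<and> is_pole N.w z" if z: "u z $ 3 = 1" for z
  proof -
    have "z \<in> {z. u z $ 3 \<noteq> -1}" using z by simp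
    then obtain r where r: "r > 0" "ball z r \<subseteq> {z. u z $ 3 \<noteq> -1}"
      using op[of "-1"] openE by blast
    have hSr: "S.w holomorphic_on ball z r" using hS r(2) by (rule holomorphic_on_subset)
    have evB: "eventually (\<lambda>y. y \<in> ball z r) (at z)"
      using r(1) by (intro eventually_at_in_open') auto
    then have ev: "eventually (\<lambda>y. N.w y = inverse (S.w y)) (at z)"
      by (rule eventually_mono) (use NS r(2) in blast)
    have "S.w analytic_on {z}"
      using hSr r(1) unfolding analytic_on_def by auto
    then have "(\<lambda>y. inverse (S.w y)) meromorphic_on {z}"
      by (intro meromorphic_on_inverse analytic_on_imp_meromorphic_on)
    then have mero: "N.w meromorphic_on {z}"
      using meromorphic_on_cong[of "{z}" N.w "\<lambda>y. inverse (S.w y)" "{z}"] ev by simp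
    have "\<not> ball z r \<subseteq> {z. u z $ 3 = 1}"
    proof
      assume "ball z r \<subseteq> {z. u z $ 3 = 1}"
      then have "ball z r \<subseteq> interior {z. u z $ 3 = 1}" by (intro interior_maximal) auto
      then show False using int0 r(1) by auto
    qed
    then obtain y where y: "y \<in> ball z r" "u y $ 3 \<noteq> 1" by blast
    then have "S.w y \<noteq> 0" using S0[of y] r(2) by blast
    then have "eventually (\<lambda>x. S.w x \<noteq> 0 \<and> x \<in> ball z r) (at z)"
      using non_zero_neighbour_alt[OF hSr open_ball _ _ y(1)] r(1) by auto
    then have nz: "eventually (\<lambda>x. S.w x \<noteq> 0) (at z)" by (rule eventually_mono) blast
    have "isCont S.w z"
      using holomorphic_on_imp_continuous_on[OF hSr] r(1)
      by (simp add: continuous_on_eq_continuous_at)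
    then have "(S.w \<longlongrightarrow> 0) (at z)" using S0[of z] z by (simp add: isCont_def)
    then have "filterlim S.w (at 0) (at z)" using nz by (simp add: filterlim_at)
    then have "filterlim (\<lambda>x. inverse (S.w x)) at_infinity (at z)"
      by (rule filterlim_compose[OF filterlim_inverse_at_infinity])
    then have "is_pole (\<lambda>x. inverse (S.w x)) z" by (simp add: is_pole_def)
    then have "is_pole N.w z" using is_pole_cong[OF ev refl] by simp
    then show ?thesis using mero by simp
  qed
  have pole_iff: "is_pole N.w z \<longleftrightarrow> u z $ 3 = 1" for z
  proof
    assume p: "is_pole N.w z"
    show "u z $ 3 = 1"
    proof (rule ccontr)
      assume "u z $ 3 \<noteq> 1"
      then have "(N.w \<longlongrightarrow> N.w z) (at z)" using contN by (simp add: isCont_def)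
      then show False using p not_tendsto_and_filterlim_at_infinity[of "at z" N.w] unfolding is_pole_def by auto
    qed
  qed (use pole in blast)
  \<comment> \<open>At a pole the division by zero in \<open>N.w\<close> returns 0, which is the
    value that this notion prescribes there.\<close>
  have "N.w nicely_meromorphic_on UNIV"
    unfolding nicely_meromorphic_on_def
  proof (intro conjI ballI)
    show "N.w meromorphic_on UNIV"
    proof (subst meromorphic_on_meromorphic_at, intro ballI)
      fix z
      show "N.w meromorphic_on {z}"
      proof (cases "u z $ 3 = 1")
        case False
        then have "N.w analytic_on {z}"
          using hN op[of 1] analytic_on_open analytic_on_subset[of N.w "{z. u z $ 3 \<noteq> 1}" "{z}"] by auto
        then show ?thesis by (rule analytic_on_imp_meromorphic_on)
      qed (use pole in blast)
    qed
    fix z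
    show "is_pole N.w z \<and> N.w z = 0 \<or> N.w \<midarrow>z\<rightarrow> N.w z"
    proof (cases "u z $ 3 = 1")
      case True
      then show ?thesis using pole by (simp add: N.w_def)
    next
      case False
      then show ?thesis using contN by (simp add: isCont_def)
    qed
  qed
  then obtain h f1 f2 where f: "h holomorphic_on UNIV" "f1 holomorphic_on UNIV" "f2 holomorphic_on UNIV"
    "\<forall>z. f1 z = 0 \<longleftrightarrow> \<not> is_pole N.w z \<and> N.w z = 0" "\<forall>z. f2 z = 0 \<longleftrightarrow> is_pole N.w z"
    "\<forall>z. \<not> is_pole N.w z \<longrightarrow> zorder f1 z = zorder N.w z"
    "\<forall>z. is_pole N.w z \<longrightarrow> zorder f2 z = - zorder N.w z"
    "\<forall>z. h z \<noteq> 0" "\<forall>z. N.w z = h z * f1 z / f2 z"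
    by (rule weierstrass_factorization_meromorphic_UNIV)
  define p where "p = f2"
  define q where "q z = h z * f1 z" for z
  have hp: "p holomorphic_on UNIV" and hq: "q holomorphic_on UNIV"
    unfolding p_def q_def[abs_def] by (intro holomorphic_intros f)+
  have p0: "p z = 0 \<longleftrightarrow> u z $ 3 = 1" for z using f(5) pole_iff by (simp add: p_def)
  have pq0: "\<not> (p z = 0 \<and> q z = 0)" for z using f(4,5,8) by (auto simp: p_def q_def)
  have Nw: "N.w z = q z / p z" for z using f(9) by (simp add: p_def q_def)
  have uN: "stereo (N.w z) = u z" "(cmod (N.w z))\<^sup>2 * (1 - u z $ 3) = 1 + u z $ 3" if "u z $ 3 \<noteq> 1" for z
    using stereo_chart[OF n1 that] by (simp_all add: N.w_def)
  have upq: "u z = stereo_quot (q z) (p z)" for z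
  proof (cases "u z $ 3 = 1")
    case True
    have "(u z $ 1)\<^sup>2 + (u z $ 2)\<^sup>2 = 0" using sphere[of z] True by simp
    then have "u z $ 1 = 0" "u z $ 2 = 0" by (auto simp: sum_power2_eq_zero_iff)
    then show ?thesis using True p0[of z] by (simp add: stereo_quot_def vec_eq_iff forall_3)
  next
    case False
    then show ?thesis using uN(1)[OF False] p0[of z] by (simp add: stereo_quot_def Nw)
  qed
  have "emeasure lborel (ball (0::complex) 1) > 0"
    using open_not_negligible[of "ball (0::complex) 1"] negligible_iff_emeasure0[of "ball (0::complex) 1"]
    by (auto simp: zero_less_iff_neq_zero)
  then obtain R where R: "(\<integral>\<^sup>+ z. indicator {z. norm z > R} z * ennreal (grad_sq u z) \<partial>lborel)
      < emeasure lborel (ball (0::complex) 1)"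
    using energy_tail[OF harmonic_mapD(1)[OF u] fin] by blast
  \<comment> \<open>The lower hemisphere corresponds to |w| at most 1. There
    \<open>1 - u z $ 3\<close> is at least 1, so the Euclidean area density of the chart is bounded
    by the energy density.\<close>
  define E where "E = {z. norm z > R} \<inter> {z. u z $ 3 \<le> 0}"
  have Em: "E \<in> sets borel"
  proof -
    have "{z. u z $ 3 \<le> 0} \<in> sets borel"
      using cu[of 3] by (intro borel_closed closed_Collect_le) auto
    moreover have "{z::complex. norm z > R} \<in> sets borel"
      by (intro borel_open open_Collect_less continuous_intros)
    ultimately show ?thesis unfolding E_def by blast
  qed
  have gm [measurable]: "grad_sq u \<in> borel_measurable borel"
    by (rule borel_measurable_continuous_onI[OF grad_sq_continuous[OF harmonic_mapD(1)[OF u]]])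
  define D where "D z = grad_sq u z / (2 * (1 - u z $ 3)\<^sup>2)" for z
  have Dm: "D \<in> borel_measurable borel" unfolding D_def[abs_def] by measurable
  have "\<forall>z. \<exists>d. u z $ 3 \<noteq> 1 \<longrightarrow> (N.w has_field_derivative d) (at z) \<and> (cmod d)\<^sup>2 * (1 - u z $ 3)\<^sup>2 = 2 * (grad_sq u z / 4)"
    using N.holomorphic_w[OF _ Nj] by blast
  then obtain d where "\<forall>z. u z $ 3 \<noteq> 1 \<longrightarrow> (N.w has_field_derivative d z) (at z) \<and> (cmod (d z))\<^sup>2 * (1 - u z $ 3)\<^sup>2 = 2 * (grad_sq u z / 4)"
    by (rule choice[THEN exE])
  then have d: "(N.w has_field_derivative d z) (at z)"
      "(cmod (d z))\<^sup>2 * (1 - u z $ 3)\<^sup>2 = 2 * (grad_sq u z / 4)" if "u z $ 3 \<noteq> 1" for z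
    using that by blast+
  have E1: "u z $ 3 \<noteq> 1" if "z \<in> E" for z using that by (auto simp: E_def)
  have "infinite (ball 0 1 - N.w ` E)"
  proof (rule infinite_omitted_values[OF Em Dm])
    show "(N.w has_field_derivative d z) (at z)" if "z \<in> E" for z using d(1) E1[OF that] by blast
    show "(cmod (d z))\<^sup>2 = D z" if "z \<in> E" for z
      using d(2)[OF E1[OF that]] E1[OF that] by (simp add: D_def field_simps)
    have "(\<integral>\<^sup>+ z. indicator E z * ennreal (D z) \<partial>lborel)
      \<le> (\<integral>\<^sup>+ z. indicator {z. norm z > R} z * ennreal (grad_sq u z) \<partial>lborel)"
    proof (rule nn_integral_mono)
      fix z
      have "D z \<le> grad_sq u z" if "z \<in> E"
      proof -
        have "1 - u z $ 3 \<ge> 1" using that by (simp add: E_def)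
        then have "(1 - u z $ 3)\<^sup>2 \<ge> 1" by (rule one_le_power)
        moreover have "grad_sq u z \<ge> 0" by (simp add: grad_sq_def)
        ultimately show ?thesis unfolding D_def by (simp add: divide_le_eq mult_left_le_one_le mult_le_cancel_left1)
      qed
      then show "indicator E z * ennreal (D z) \<le> indicator {z. norm z > R} z * ennreal (grad_sq u z)"
        by (auto simp: indicator_def E_def ennreal_leI)
    qed
    then show "(\<integral>\<^sup>+ z. indicator E z * ennreal (D z) \<partial>lborel) < emeasure lborel (ball (0::complex) 1)"
      using R by (rule le_less_trans)
  qed
  then obtain T where T: "finite T" "card T = 3" "T \<subseteq> ball 0 1 - N.w ` E"
    using infinite_arbitrarily_large by blast
  then obtain a b c where abc: "T = {a, b, c}" "a \<noteq> b" "b \<noteq> c" "a \<noteq> c"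
    unfolding card_3_iff by blast
  \<comment> \<open>A value in the unit disc can be taken only where \<open>u\<close> lies in the
    lower hemisphere, that is, outside the large disc only on \<open>E\<close>.\<close>
  have omit: "q z \<noteq> e * p z" if z: "norm z > R" and e: "e \<in> {a, b, c}" for z e
  proof
    assume eq: "q z = e * p z"
    then have pz: "p z \<noteq> 0" using pq0[of z] by auto
    then have u3: "u z $ 3 \<noteq> 1" using p0 by blast
    have we: "N.w z = e" using eq pz by (simp add: Nw)
    have "norm e < 1" using e T(3) abc(1) by auto
    then have "(norm e)\<^sup>2 < 1" by (simp add: power_less_one_iff abs_square_less_1)
    have "u z $ 3 \<le> 0"
    proof (rule ccontr)
      assume "\<not> u z $ 3 \<le> 0"
      moreover have "u z $ 3 \<le> 1" using component_le_norm_cart[of "u z" 3] n1[of z] by simp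
      ultimately have "0 < 1 - u z $ 3" using u3 by simp
      then have "(norm e)\<^sup>2 * (1 - u z $ 3) < 1 * (1 - u z $ 3)"
        using \<open>(norm e)\<^sup>2 < 1\<close> by (rule mult_strict_right_mono[rotated])
      then show False using uN(2)[OF u3] \<open>\<not> u z $ 3 \<le> 0\<close> unfolding we by simp
    qed
    then have "z \<in> E" using z by (simp add: E_def)
    then have "e \<in> N.w ` E" using we by blast
    then show False using e T(3) abc(1) by auto
  qed
  obtain P Q g where g: "g holomorphic_on UNIV" "\<And>z. g z \<noteq> 0"
    "\<And>z. p z = poly P z * g z" "\<And>z. q z = poly Q z * g z"
    by (rule entire_quotient_omitting_three_values[OF hp hq abc(2,3,4) omit]) blast+
  show ?thesis
  proof (rule that[of P Q])
    show "coprime P Q" using pq0 g(2-4) by (intro coprime_polyI) auto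
    show "u z = stereo_quot (poly Q z) (poly P z)" for z
      using upq[of z] g(2)[of z] by (simp add: stereo_quot_def g(3,4))
  qed
qed

subsection \<open>Quotients of polynomials in \<open>z\<close> and its conjugate\<close>

text \<open>Polynomial functions of \<open>z\<close> and its conjugate, with a bound on the total
  degree. The index is a bound and not the exact degree, so that constants and lower-order terms fit
  at every level and sums need no case distinction.\<close>

inductive bipoly :: "nat \<Rightarrow> (complex \<Rightarrow> complex) \<Rightarrow> bool" where
  const: "bipoly n (\<lambda>_. c)"
| ident: "bipoly (Suc n) (\<lambda>z. z)"
| conj: "bipoly (Suc n) (\<lambda>z. cnj z)"
| add: "bipoly n f \<Longrightarrow> bipoly n g \<Longrightarrow> bipoly n (\<lambda>z. f z + g z)"
| mult: "bipoly n f \<Longrightarrow> bipoly k g \<Longrightarrow> bipoly (n + k) (\<lambda>z. f z * g z)"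

lemma bipoly_cnj: "bipoly n f \<Longrightarrow> bipoly n (\<lambda>z. cnj (f z))"
  by (induction rule: bipoly.induct) (auto intro: bipoly.intros)

lemma bipoly_cmult: "bipoly n f \<Longrightarrow> bipoly n (\<lambda>z. c * f z)"
  using bipoly.mult[OF bipoly.const[of 0 c]] by simp

lemma bipoly_minus: "bipoly n f \<Longrightarrow> bipoly n (\<lambda>z. - f z)"
  using bipoly_cmult[of n f "-1"] by simp

lemma bipoly_diff: "bipoly n f \<Longrightarrow> bipoly n g \<Longrightarrow> bipoly n (\<lambda>z. f z - g z)"
  using bipoly.add[OF _ bipoly_minus, of n f g] by simp

lemma bipoly_power: "bipoly n f \<Longrightarrow> bipoly (n * k) (\<lambda>z. f z ^ k)"
  by (induction k) (auto intro: bipoly.intros)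

lemma bipoly_poly: "degree P \<le> n \<Longrightarrow> bipoly n (\<lambda>z. poly P z)"
proof (induction P arbitrary: n)
  case 0 then show ?case by (simp add: bipoly.const)
next
  case (pCons a P)
  show ?case
  proof (cases "P = 0")
    case True then show ?thesis by (simp add: bipoly.const)
  next
    case False
    then obtain k where k: "n = Suc k" "degree P \<le> k" using pCons.prems by (cases n) auto
    have "bipoly (Suc 0 + k) (\<lambda>z. z * poly P z)" by (intro bipoly.mult bipoly.ident pCons.IH k)
    then show ?thesis unfolding k by (simp add: bipoly.add bipoly.const)
  qed
qed

text \<open>Differentiation is not made to lower the index: closure at the same level suffices for
  boundedness of quotients.\<close>

lemma bipoly_wirt: "bipoly n f \<Longrightarrow> \<exists>a b. bipoly n a \<and> bipoly n b \<and> (\<forall>z. wirt f (a z) (b z) z)"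
proof (induction rule: bipoly.induct)
  case (const n c)
  show ?case by (intro exI[of _ "\<lambda>_. 0"] conjI bipoly.const allI wirt_const)
next
  case (ident n)
  show ?case by (rule exI[of _ "\<lambda>_. 1"], rule exI[of _ "\<lambda>_. 0"]) (intro conjI bipoly.const allI wirt_ident)
next
  case (conj n)
  show ?case
    by (rule exI[of _ "\<lambda>_. 0"], rule exI[of _ "\<lambda>_. 1"])
      (intro conjI bipoly.const allI, rule wirt_cong[OF wirt_cnj[OF wirt_ident]], simp_all)
next
  case (add n f g)
  then obtain a b c d where "bipoly n a" "bipoly n b" "\<And>z. wirt f (a z) (b z) z"
    "bipoly n c" "bipoly n d" "\<And>z. wirt g (c z) (d z) z" by blast
  then show ?case by (intro exI[of _ "\<lambda>z. a z + c z"] exI[of _ "\<lambda>z. b z + d z"] conjI bipoly.add allI wirt_add)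
next
  case (mult n f k g)
  then obtain a b c d where "bipoly n a" "bipoly n b" "\<And>z. wirt f (a z) (b z) z"
    "bipoly k c" "bipoly k d" "\<And>z. wirt g (c z) (d z) z" by blast
  with mult.hyps show ?case
    by (intro exI[of _ "\<lambda>z. a z * g z + f z * c z"] exI[of _ "\<lambda>z. b z * g z + f z * d z"] conjI
        bipoly.add bipoly.mult allI wirt_mult)
qed

lemma bipoly_bound: "bipoly n f \<Longrightarrow> \<exists>C\<ge>0. \<forall>z. norm (f z) \<le> C * (1 + norm z) ^ n"
proof (induction rule: bipoly.induct)
  case (const n c)
  have "norm c * 1 \<le> norm c * (1 + norm z) ^ n" for z :: complex
    by (intro mult_left_mono one_le_power) auto
  then show ?case by (intro exI[of _ "norm c"]) auto
next
  case (ident n)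
  have "norm z * 1 \<le> (1 + norm z) * (1 + norm z) ^ n" for z :: complex
    by (intro mult_mono one_le_power) auto
  then show ?case by (intro exI[of _ 1]) auto
next
  case (conj n)
  have "norm z * 1 \<le> (1 + norm z) * (1 + norm z) ^ n" for z :: complex
    by (intro mult_mono one_le_power) auto
  then show ?case by (intro exI[of _ 1]) auto
next
  case (add n f g)
  then obtain B C where "B \<ge> 0" "\<And>z. norm (f z) \<le> B * (1 + norm z) ^ n"
    "C \<ge> 0" "\<And>z. norm (g z) \<le> C * (1 + norm z) ^ n" by blast
  then show ?case
    by (intro exI[of _ "B + C"]) (auto simp: distrib_right intro!: norm_triangle_le add_mono)
next
  case (mult n f k g)
  then obtain B C where BC: "B \<ge> 0" "\<And>z. norm (f z) \<le> B * (1 + norm z) ^ n"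
    "C \<ge> 0" "\<And>z. norm (g z) \<le> C * (1 + norm z) ^ k" by blast
  have "norm (f z * g z) \<le> B * C * (1 + norm z) ^ (n + k)" for z
  proof -
    have "norm (f z * g z) \<le> (B * (1 + norm z) ^ n) * (C * (1 + norm z) ^ k)"
      unfolding norm_mult using BC by (intro mult_mono) auto
    then show ?thesis by (simp add: power_add mult_ac)
  qed
  then show ?case using BC by (intro exI[of _ "B * C"]) auto
qed

locale rational_pair =
  fixes p q :: "complex poly" and m :: nat
  assumes no_common_zero: "\<And>z. poly p z \<noteq> 0 \<or> poly q z \<noteq> 0"
    and degree_eq: "max (degree p) (degree q) = m"
begin

definition D :: "complex \<Rightarrow> real"
  where "D z = (cmod (poly p z))\<^sup>2 + (cmod (poly q z))\<^sup>2"

lemma D_pos: "D z > 0"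
  using no_common_zero[of z] by (auto simp: D_def add_pos_nonneg add_nonneg_pos)

lemma D_complex: "complex_of_real (D z) = poly p z * cnj (poly p z) + poly q z * cnj (poly q z)"
  by (simp add: D_def complex_norm_square del: of_real_power)

lemma degrees: "degree p \<le> m" "degree q \<le> m"
  using degree_eq by auto

text \<open>The point at infinity is treated like the others, using the reversed polynomials.\<close>

lemma D_lower: "\<exists>c>0. \<forall>z. c * (1 + norm z) ^ (2 * m) \<le> D z"
proof -
  \<comment> \<open>The reversed polynomial, with reversal taken at degree \<open>m\<close> for both
    \<open>p\<close> and \<open>q\<close>.\<close>
  define h where "h P w = (\<Sum>i\<le>m. coeff P i * w ^ (m - i))" for P and w :: complex
  define H where "H w = (cmod (h p w))\<^sup>2 + (cmod (h q w))\<^sup>2" for w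
  have hP: "poly P z = z ^ m * h P (inverse z)" if "degree P \<le> m" "z \<noteq> 0" for P z
  proof -
    have "poly P z = (\<Sum>i\<le>m. coeff P i * z ^ i)"
      by (rule poly_altdef[THEN trans], rule sum.mono_neutral_left) (use that in \<open>auto simp: coeff_eq_0\<close>)
    also have "\<dots> = (\<Sum>i\<le>m. z ^ m * (coeff P i * inverse z ^ (m - i)))"
    proof (rule sum.cong[OF refl])
      fix i assume "i \<in> {..m}"
      then have "z ^ m = z ^ i * z ^ (m - i)" by (simp flip: power_add)
      then show "coeff P i * z ^ i = z ^ m * (coeff P i * inverse z ^ (m - i))"
        using that(2) by (simp add: power_inverse)
    qed
    finally show ?thesis by (simp add: h_def sum_distrib_left)
  qed
  have DH: "D z = norm z ^ (2 * m) * H (inverse z)" if "z \<noteq> 0" for z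
    using hP[OF degrees(1) that] hP[OF degrees(2) that]
    by (simp add: D_def H_def norm_mult norm_power power_mult_distrib distrib_left power_mult[symmetric] mult.commute)
  have h0: "h P 0 = coeff P m" for P
  proof -
    have "h P 0 = (\<Sum>i\<le>m. if i = m then coeff P m else 0)"
      unfolding h_def by (intro sum.cong refl) (auto simp: power_0_left)
    then show ?thesis by simp
  qed
  \<comment> \<open>Away from 0 this is the absence of common zeros; at 0 it says that one of the
    polynomials really attains degree \<open>m\<close>.\<close>
  have Hpos: "H w > 0" for w
  proof (cases "w = 0")
    case True
    have "coeff p m \<noteq> 0 \<or> coeff q m \<noteq> 0"
    proof (cases "degree p = m")
      case True
      show ?thesis
      proof (cases "p = 0")
        case True
        then have "q \<noteq> 0" using no_common_zero[of 0] by auto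
        moreover have "degree q = m" using True degree_eq by simp
        ultimately show ?thesis by auto
      qed (use True in auto)
    next
      case False
      then have "degree q = m" "degree q \<noteq> 0" using degree_eq by (auto simp: max_def split: if_splits)
      then show ?thesis by (metis degree_0 leading_coeff_0_iff)
    qed
    then show ?thesis using True by (auto simp: H_def h0 add_pos_nonneg add_nonneg_pos)
  next
    case False
    then have "D (inverse w) = norm (inverse w) ^ (2 * m) * H w" using DH[of "inverse w"] by simp
    then show ?thesis using D_pos[of "inverse w"] False by (simp add: zero_less_mult_iff)
  qed
  have cH: "continuous_on (cball 0 1) H" unfolding H_def h_def by (intro continuous_intros)
  have cD: "continuous_on (cball 0 1) D" unfolding D_def by (intro continuous_intros)
  have ne: "cball (0::complex) 1 \<noteq> {}" by simp
  from continuous_attains_inf[OF compact_cball ne cH]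
  obtain w1 where w1: "\<And>w. w \<in> cball 0 1 \<Longrightarrow> H w1 \<le> H w" by blast
  from continuous_attains_inf[OF compact_cball ne cD]
  obtain w2 where w2: "\<And>w. w \<in> cball 0 1 \<Longrightarrow> D w2 \<le> D w" by blast
  \<comment> \<open>The power of two absorbs the estimate of 1 + |z| by twice the larger of 1 and
    |z|.\<close>
  define c where "c = min (H w1) (D w2) / 2 ^ (2 * m)"
  have c: "c > 0" using Hpos[of w1] D_pos[of w2] by (simp add: c_def)
  have "c * (1 + norm z) ^ (2 * m) \<le> D z" for z
  proof (cases "norm z \<le> 1")
    case True
    have "(1 + norm z) ^ (2 * m) \<le> 2 ^ (2 * m)" using True by (intro power_mono) auto
    then have "c * (1 + norm z) ^ (2 * m) \<le> c * 2 ^ (2 * m)" using c by simp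
    also have "\<dots> \<le> D z" using w2[of z] True by (simp add: c_def)
    finally show ?thesis .
  next
    case False
    then have z: "norm z \<ge> 1" "z \<noteq> 0" by auto
    have "(1 + norm z) ^ (2 * m) \<le> (2 * norm z) ^ (2 * m)" using z by (intro power_mono) auto
    then have "c * (1 + norm z) ^ (2 * m) \<le> c * (2 * norm z) ^ (2 * m)" using c by simp
    also have "\<dots> = min (H w1) (D w2) * norm z ^ (2 * m)" by (simp add: c_def power_mult_distrib)
    also have "\<dots> \<le> H (inverse z) * norm z ^ (2 * m)"
      using w1[of "inverse z"] z by (intro mult_right_mono) (auto simp: norm_inverse inverse_le_1_iff)
    finally show ?thesis using DH[OF z(2)] by (simp add: mult.commute)
  qed
  then show ?thesis using c by blast
qed

text \<open>One missing degree gives decay like 1/|z|. For \<open>m = 0\<close> the truncated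
  difference \<open>2 * m - 1\<close> would be 0 and no degree would be missing.\<close>

lemma bipoly_over_D_decay:
  assumes N: "bipoly (2 * m - 1) N" and m: "m > 0"
  shows "\<exists>C\<ge>0. \<forall>z. norm (N z) / D z \<le> C / (1 + norm z)"
proof -
  obtain C where C: "C \<ge> 0" "\<And>z. norm (N z) \<le> C * (1 + norm z) ^ (2 * m - 1)"
    using bipoly_bound[OF N] by blast
  obtain c where c: "c > 0" "\<And>z. c * (1 + norm z) ^ (2 * m) \<le> D z" using D_lower by blast
  have "norm (N z) / D z \<le> (C / c) / (1 + norm z)" for z
  proof -
    let ?t = "1 + norm z"
    have t: "?t > 0" by (simp add: add_pos_nonneg)
    have "norm (N z) / D z \<le> (C * ?t ^ (2 * m - 1)) / (c * ?t ^ (2 * m))"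
      using C c t by (intro frac_le) auto
    also have "?t ^ (2 * m) = ?t ^ (2 * m - 1) * ?t"
      using m by (metis Suc_diff_1 mult.commute nat_0_less_mult_iff power_Suc zero_less_numeral)
    also have "(C * ?t ^ (2 * m - 1)) / (c * (?t ^ (2 * m - 1) * ?t)) = (C / c) / ?t"
    proof -
      have "?t ^ (2 * m - 1) \<noteq> 0" using t by (metis less_irrefl zero_less_power)
      then show ?thesis using t c by (simp add: divide_simps)
    qed
    finally show ?thesis .
  qed
  then show ?thesis using C c by (intro exI[of _ "C / c"]) auto
qed

lemma bipoly_D: "bipoly (2 * m) (\<lambda>z. complex_of_real (D z))"
  unfolding D_complex mult_2
  by (intro bipoly.add bipoly.mult bipoly_cnj bipoly_poly degrees)

lemma D_ne: "complex_of_real (D z) \<noteq> 0"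
  using D_pos[of z] by simp

text \<open>
  Numerators of this class grow no faster than their denominators, so its members are bounded; it is
  closed under derivatives, so all their derivatives are bounded too.
\<close>

definition tame :: "(complex \<Rightarrow> complex) \<Rightarrow> bool"
  where "tame f \<longleftrightarrow> (\<exists>k N. bipoly (2 * m * k) N \<and> f = (\<lambda>z. N z / of_real (D z) ^ k))"

lemma tame_add:
  assumes "tame f" "tame g" shows "tame (\<lambda>z. f z + g z)"
proof -
  obtain k N l M where N: "bipoly (2 * m * k) N" "f = (\<lambda>z. N z / of_real (D z) ^ k)"
    and M: "bipoly (2 * m * l) M" "g = (\<lambda>z. M z / of_real (D z) ^ l)"
    using assms unfolding tame_def by blast
  have "bipoly (2 * m * k + 2 * m * l) (\<lambda>z. N z * of_real (D z) ^ l + of_real (D z) ^ k * M z)"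
    by (intro bipoly.add bipoly.mult N M bipoly_power bipoly_D)
  then have "bipoly (2 * m * (k + l)) (\<lambda>z. N z * of_real (D z) ^ l + of_real (D z) ^ k * M z)"
    by (simp only: distrib_left)
  moreover have "(\<lambda>z. f z + g z)
      = (\<lambda>z. (N z * of_real (D z) ^ l + of_real (D z) ^ k * M z) / of_real (D z) ^ (k + l))"
    unfolding N M using D_ne by (auto simp: fun_eq_iff power_add add_frac_eq mult_ac)
  ultimately show ?thesis unfolding tame_def by blast
qed

lemma tame_cmult:
  assumes "tame f" shows "tame (\<lambda>z. c * f z)"
  using assms bipoly_cmult unfolding tame_def by fastforce

lemma tame_wirt:
  assumes "tame f"
  shows "\<exists>a b. tame a \<and> tame b \<and> (\<forall>z. wirt f (a z) (b z) z)"
proof -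
  obtain k N where N: "bipoly (2 * m * k) N" "f = (\<lambda>z. N z / of_real (D z) ^ k)"
    using assms unfolding tame_def by blast
  obtain a b where ab: "bipoly (2 * m * k) a" "bipoly (2 * m * k) b" "\<And>z. wirt N (a z) (b z) z"
    using bipoly_wirt[OF N(1)] by blast
  obtain c d where cd: "bipoly (2 * m) c" "bipoly (2 * m) d"
    "\<And>z. wirt (\<lambda>z. of_real (D z)) (c z) (d z) z"
    using bipoly_wirt[OF bipoly_D] by blast
  have pw: "wirt (\<lambda>z. of_real (D z) ^ j) (of_nat j * of_real (D z) ^ (j - 1) * c z)
      (of_nat j * of_real (D z) ^ (j - 1) * d z) z" for j z
  proof (induction j)
    case (Suc j)
    show ?case
      unfolding power_Suc
      by (rule wirt_cong[OF wirt_mult[OF cd(3) Suc]]; cases j) (simp_all add: algebra_simps)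
  qed (simp add: wirt_const)
  \<comment> \<open>Cancelling in the quotient rule raises the exponent of the denominator by only
    one. For \<open>k = 0\<close> the truncated exponent \<open>k - 1\<close> is harmless because of
    the factor \<open>of_nat k\<close>.\<close>
  have q: "(x * D' ^ k - n * (of_nat k * D' ^ (k - 1) * y)) / (D' ^ k)\<^sup>2
      = (x * D' - of_nat k * (n * y)) / D' ^ (k + 1)" if "D' \<noteq> 0" for x n y D' :: complex
    using that by (cases k) (simp_all add: field_simps power2_eq_square)
  have bp: "bipoly (2 * m * (k + 1)) (\<lambda>z. x z * of_real (D z) - of_nat k * (N z * y z))"
    if "bipoly (2 * m * k) x" "bipoly (2 * m) y" for x y
  proof -
    have "bipoly (2 * m * k + 2 * m) (\<lambda>z. x z * of_real (D z) - of_nat k * (N z * y z))"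
      by (intro bipoly_diff bipoly_cmult bipoly.mult that N bipoly_D)
    then show ?thesis by (simp add: algebra_simps)
  qed
  have "wirt f ((a z * of_real (D z) - of_nat k * (N z * c z)) / of_real (D z) ^ (k + 1))
      ((b z * of_real (D z) - of_nat k * (N z * d z)) / of_real (D z) ^ (k + 1)) z" for z
    unfolding N(2)
    by (rule wirt_cong[OF wirt_divide[OF ab(3) pw]]) (use D_ne in \<open>simp_all only: q power_not_zero not_False_eq_True\<close>)
  moreover have "tame (\<lambda>z. (a z * of_real (D z) - of_nat k * (N z * c z)) / of_real (D z) ^ (k + 1))"
    "tame (\<lambda>z. (b z * of_real (D z) - of_nat k * (N z * d z)) / of_real (D z) ^ (k + 1))"
    unfolding tame_def using bp[OF ab(1) cd(1)] bp[OF ab(2) cd(2)] by blast+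
  ultimately show ?thesis by blast
qed

lemma tame_bounded:
  assumes "tame f" shows "\<exists>B. \<forall>z. norm (f z) \<le> B"
proof -
  obtain k N where N: "bipoly (2 * m * k) N" "f = (\<lambda>z. N z / of_real (D z) ^ k)"
    using assms unfolding tame_def by blast
  obtain C where C: "C \<ge> 0" "\<And>z. norm (N z) \<le> C * (1 + norm z) ^ (2 * m * k)"
    using bipoly_bound[OF N(1)] by blast
  obtain c where c: "c > 0" "\<And>z. c * (1 + norm z) ^ (2 * m) \<le> D z" using D_lower by blast
  have "norm (f z) \<le> C / c ^ k" for z
  proof -
    let ?t = "(1 + norm z) ^ (2 * m * k)"
    have t: "?t > 0" by (intro zero_less_power) (simp add: add_pos_nonneg)
    have "c ^ k * ?t = (c * (1 + norm z) ^ (2 * m)) ^ k" by (simp add: power_mult_distrib power_mult)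
    also have "\<dots> \<le> D z ^ k" using c by (intro power_mono) auto
    finally have 1: "c ^ k * ?t \<le> D z ^ k" .
    have "norm (f z) = norm (N z) / D z ^ k"
      using D_pos[of z] by (simp add: N norm_divide norm_power)
    also have "\<dots> \<le> (C * ?t) / (c ^ k * ?t)"
      using C c 1 t by (intro frac_le) auto
    also have "\<dots> = C / c ^ k" by (rule mult_divide_mult_cancel_right) (use t in linarith)
    finally show ?thesis .
  qed
  then show ?thesis by blast
qed

end

subsection \<open>Geometry of a rational map\<close>

lemma has_derivative_vec_components:
  fixes f :: "'a::real_normed_vector \<Rightarrow> real^'n"
  assumes "\<And>i. ((\<lambda>x. f x $ i) has_derivative (\<lambda>h. f' h $ i)) (at z)"
  shows "(f has_derivative f') (at z)"
proof (subst has_derivative_componentwise_within, rule ballI)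
  fix b :: "real^'n" assume "b \<in> Basis"
  then obtain i where "b = axis i 1" by (auto simp: Basis_vec_def)
  then show "((\<lambda>x. f x \<bullet> b) has_derivative (\<lambda>x. f' x \<bullet> b)) (at z)"
    using assms[of i] by (simp add: inner_axis)
qed

lemma wirt_Re_components:
  fixes f :: "complex \<Rightarrow> real^3"
  assumes w: "\<And>i. wirt (g i) (a i) (b i) z" and f: "\<And>z i. f z $ i = Re (g i z)"
  shows "f differentiable (at z)" "dx f z $ i = Re (a i + b i)" "dy f z $ i = Re (\<i> * a i - \<i> * b i)"
proof -
  have "(f has_derivative (\<lambda>h. \<chi> i. Re (a i * h + b i * cnj h))) (at z)"
  proof (rule has_derivative_vec_components)
    fix i
    show "((\<lambda>x. f x $ i) has_derivative (\<lambda>h. (\<chi> i. Re (a i * h + b i * cnj h)) $ i)) (at z)"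
      unfolding f vec_lambda_beta
      by (rule bounded_linear.has_derivative[OF bounded_linear_Re w[unfolded wirt_def]])
  qed
  from this partial_eqI[OF this] show "f differentiable (at z)" "dx f z $ i = Re (a i + b i)"
    "dy f z $ i = Re (\<i> * a i - \<i> * b i)"
    by (auto simp: differentiable_def)
qed

lemma wirt_real_components:
  fixes f :: "complex \<Rightarrow> real^3"
  assumes w: "\<And>i. wirt (\<lambda>z. complex_of_real (f z $ i)) (a i) (b i) z"
  shows "f differentiable (at z)" "dz f i z = a i"
proof -
  show d: "f differentiable (at z)"
    by (rule wirt_Re_components(1)[OF w]) simp
  show "dz f i z = a i" by (rule wirt_unique(1)[OF wirt_component[OF d] w])
qed

lemma norm_vec3_le: "norm (v :: real^3) \<le> \<bar>v $ 1\<bar> + \<bar>v $ 2\<bar> + \<bar>v $ 3\<bar>"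
  using norm_le_l1_cart[of v] by (simp add: sum_3)

text \<open>
  The Laplacian of a tangential field is determined up to its normal component, which the
  constraint \<open>v \<bullet> u = 0\<close> fixes.
\<close>

lemma lin_op_eq_0I:
  assumes u: "harmonic_map u" and v: "Ck 2 v" and t: "\<And>z. v z \<bullet> u z = 0"
    and lap: "laplacian v z = - (grad_sq u z *\<^sub>R v z) + c *\<^sub>R u z"
  shows "lin_op u v z = 0"
proof -
  note ud = harmonic_mapD[OF u]
  have w0: "wirt (\<lambda>z. \<Sum>i\<in>UNIV. dz v i z * of_real (u z $ i) + of_real (v z $ i) * dz u i z) 0 0 z"
    using dz_inner_const[OF Ck_2D(1)[OF v] ud(2) t] by (simp add: wirt_const)
  have "\<forall>i. \<exists>a. wirt (dz v i) a (of_real (laplacian v z $ i / 4)) z"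
    using wirt_dz[OF v] by blast
  then obtain a where a: "\<forall>i. wirt (dz v i) (a i) (of_real (laplacian v z $ i / 4)) z"
    by (rule choice[THEN exE])
  have "\<forall>i. \<exists>a. wirt (dz u i) a (of_real (laplacian u z $ i / 4)) z"
    using wirt_dz[OF ud(1)] by blast
  then obtain b where b: "\<forall>i. wirt (dz u i) (b i) (of_real (laplacian u z $ i / 4)) z"
    by (rule choice[THEN exE])
  have w1: "wirt (\<lambda>z. \<Sum>i\<in>UNIV. dz v i z * of_real (u z $ i) + of_real (v z $ i) * dz u i z)
    (\<Sum>i\<in>UNIV. a i * of_real (u z $ i) + dz v i z * dz u i z + (dz v i z * dz u i z + of_real (v z $ i) * b i))
    (\<Sum>i\<in>UNIV. of_real (laplacian v z $ i / 4) * of_real (u z $ i) + dz v i z * cnj (dz u i z)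
      + (cnj (dz v i z) * dz u i z + of_real (v z $ i) * of_real (laplacian u z $ i / 4))) z"
    by (intro wirt_sum wirt_add wirt_mult a[rule_format] b[rule_format] wirt_component Ck_2D(1)[OF v] ud(2))
  have "(\<Sum>i\<in>UNIV. of_real (laplacian v z $ i / 4) * of_real (u z $ i) + dz v i z * cnj (dz u i z)
      + (cnj (dz v i z) * dz u i z + of_real (v z $ i) * of_real (laplacian u z $ i / 4))) = 0"
    by (rule wirt_unique(2)[OF w1 w0])
  then have "Re (\<Sum>i\<in>UNIV. of_real (laplacian v z $ i / 4) * of_real (u z $ i) + dz v i z * cnj (dz u i z)
      + (cnj (dz v i z) * dz u i z + of_real (v z $ i) * of_real (laplacian u z $ i / 4))) = 0" by simp
  \<comment> \<open>This is the Laplacian of the vanishing function v . u; it expresses the normal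
    component of the Laplacian of \<open>v\<close> by \<open>grad_inner u v\<close>.\<close>
  then have "laplacian v z \<bullet> u z + v z \<bullet> laplacian u z + 2 * grad_inner u v z = 0"
    by (simp add: sum_3 dz_def grad_inner_def inner_vec_def algebra_simps)
  moreover have "laplacian v z \<bullet> u z = c" "v z \<bullet> laplacian u z = 0"
    using t[of z] ud(3)[of z] by (simp_all add: lap ud(4) inner_add_left inner_diff_left)
  ultimately have "c = - 2 * grad_inner u v z" by simp
  then show ?thesis by (simp add: lin_op_def lap)
qed

context rational_pair
begin

definition tame_vec :: "(complex \<Rightarrow> real^3) \<Rightarrow> bool"
  where "tame_vec v \<longleftrightarrow> (\<exists>g. (\<forall>i. tame (g i)) \<and> (\<forall>z i. v z $ i = Re (g i z)))"

text \<open>The real partial derivatives of Re g are the real parts of the sum of the Wirtinger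
  derivatives and of \<i> times their difference, so closure passes from \<open>tame\<close> to its
  real parts.\<close>

lemma tame_vec_partial:
  assumes "tame_vec v"
  shows "v differentiable (at z)" "tame_vec (dx v)" "tame_vec (dy v)"
proof -
  obtain g where g: "\<And>i. tame (g i)" "\<And>z i. v z $ i = Re (g i z)"
    using assms unfolding tame_vec_def by blast
  have "\<forall>i. \<exists>a b. tame a \<and> tame b \<and> (\<forall>z. wirt (g i) (a z) (b z) z)" using tame_wirt[OF g(1)] by blast
  then obtain a where "\<forall>i. \<exists>b. tame (a i) \<and> tame b \<and> (\<forall>z. wirt (g i) (a i z) (b z) z)"
    by (rule choice[THEN exE])
  then obtain b where "\<forall>i. tame (a i) \<and> tame (b i) \<and> (\<forall>z. wirt (g i) (a i z) (b i z) z)"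
    by (rule choice[THEN exE])
  then have ab: "tame (a i)" "tame (b i)" "wirt (g i) (a i z) (b i z) z" for i z by blast+
  show "v differentiable (at z)" using wirt_Re_components(1)[OF ab(3) g(2)] .
  show "tame_vec (dx v)"
    unfolding tame_vec_def
    by (rule exI[of _ "\<lambda>i z. a i z + b i z"])
      (use wirt_Re_components(2)[OF ab(3) g(2)] tame_add ab in auto)
  show "tame_vec (dy v)"
    unfolding tame_vec_def
    by (rule exI[of _ "\<lambda>i z. \<i> * a i z + (- \<i>) * b i z"], intro conjI allI tame_add tame_cmult ab)
      (simp add: wirt_Re_components(3)[OF ab(3) g(2)])
qed

lemma tame_vec_bounded:
  assumes "tame_vec v" shows "\<exists>B. \<forall>z. norm (v z) \<le> B"
proof -
  obtain g where g: "\<And>i. tame (g i)" "\<And>z i. v z $ i = Re (g i z)"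
    using assms unfolding tame_vec_def by blast
  have "\<forall>i. \<exists>B. \<forall>z. norm (g i z) \<le> B" using tame_bounded[OF g(1)] by blast
  then obtain B where B: "\<forall>i. \<forall>z. norm (g i z) \<le> B i" by (rule choice[THEN exE])
  have c: "\<bar>v z $ i\<bar> \<le> B i" for z i
    using B abs_Re_le_cmod[of "g i z"] unfolding g(2) by (meson order_trans)
  have "norm (v z) \<le> B 1 + B 2 + B 3" for z
    using norm_vec3_le[of "v z"] c[of z 1] c[of z 2] c[of z 3] by linarith
  then show ?thesis by blast
qed

lemma tame_vec_Ck: "tame_vec v \<Longrightarrow> Ck k v"
proof (induction k arbitrary: v)
  case 0
  then show ?case
    using differentiable_imp_continuous_within[OF tame_vec_partial(1)]
    by (simp add: continuous_at_imp_continuous_on)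
qed (use tame_vec_partial in simp)

lemma tame_vec_bounded_C2:
  assumes "tame_vec v" shows "bounded_C2 v"
proof -
  note t = tame_vec_partial[OF assms]
  note tx = tame_vec_partial[OF t(2)] and ty = tame_vec_partial[OF t(3)]
  obtain B0 B1 B2 B11 B12 B21 B22 where B: "\<And>z. norm (v z) \<le> B0" "\<And>z. norm (dx v z) \<le> B1"
    "\<And>z. norm (dy v z) \<le> B2" "\<And>z. norm (dx (dx v) z) \<le> B11" "\<And>z. norm (dx (dy v) z) \<le> B12"
    "\<And>z. norm (dy (dx v) z) \<le> B21" "\<And>z. norm (dy (dy v) z) \<le> B22"
    using tame_vec_bounded[OF assms] tame_vec_bounded[OF t(2)] tame_vec_bounded[OF t(3)]
      tame_vec_bounded[OF tx(2)] tame_vec_bounded[OF tx(3)] tame_vec_bounded[OF ty(2)]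
      tame_vec_bounded[OF ty(3)] by blast
  show ?thesis
    unfolding bounded_C2_def
  proof (rule bdd_aboveI2)
    fix z
    show "norm (v z) + norm (dx v z, dy v z)
      + norm ((dx (dx v) z, dx (dy v) z), (dy (dx v) z, dy (dy v) z))
      \<le> B0 + (B1 + B2) + ((B11 + B12) + (B21 + B22))"
      by (intro add_mono B order_trans[OF norm_Pair_le])
  qed
qed

section \<open>An isotropic tangent frame along a rational map\<close>

definition umap :: "complex \<Rightarrow> real^3"
  where "umap z = stereo_quot (poly q z) (poly p z)"

text \<open>The Wronskian: the derivative of q/p is \<open>W\<close> divided by the square of
  \<open>p\<close>.\<close>

definition W :: "complex \<Rightarrow> complex"
  where "W z = poly (pderiv q) z * poly p z - poly q z * poly (pderiv p) z"

definition Dz :: "complex \<Rightarrow> complex"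
  where "Dz z = poly (pderiv p) z * cnj (poly p z) + poly (pderiv q) z * cnj (poly q z)"

text \<open>The quadratic parametrisation of isotropic vectors by \<open>(p, q)\<close>. After
  division by \<open>D\<close>, its real and imaginary parts form an orthonormal frame of the
  tangent plane at \<open>umap z\<close>.\<close>

definition null_vec :: "complex \<Rightarrow> complex^3"
  where "null_vec z = vector [(poly p z)\<^sup>2 - (poly q z)\<^sup>2, \<i> * ((poly p z)\<^sup>2 + (poly q z)\<^sup>2),
    2 * poly p z * poly q z]"

definition null_vec' :: "complex \<Rightarrow> complex^3"
  where "null_vec' z = vector [2 * poly p z * poly (pderiv p) z - 2 * poly q z * poly (pderiv q) z,
    \<i> * (2 * poly p z * poly (pderiv p) z + 2 * poly q z * poly (pderiv q) z),
    2 * (poly (pderiv p) z * poly q z + poly p z * poly (pderiv q) z)]"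

lemma wirt_poly: "wirt (\<lambda>z. poly P z) (poly (pderiv P) z) 0 z"
  by (intro wirt_field_derivative poly_DERIV)

lemma wirt_cnj_poly: "wirt (\<lambda>z. cnj (poly P z)) 0 (cnj (poly (pderiv P) z)) z"
  using wirt_cnj[OF wirt_poly] by simp

lemma wirt_D: "wirt (\<lambda>z. complex_of_real (D z)) (Dz z) (cnj (Dz z)) z"
  unfolding D_complex
  by (rule wirt_cong[OF wirt_add[OF wirt_mult[OF wirt_poly wirt_cnj_poly] wirt_mult[OF wirt_poly wirt_cnj_poly]]])
    (simp_all add: Dz_def)

lemma umap_components:
  "complex_of_real (umap z $ 1) = (poly q z * cnj (poly p z) + cnj (poly q z) * poly p z) / D z"
  "complex_of_real (umap z $ 2) = - \<i> * (poly q z * cnj (poly p z) - cnj (poly q z) * poly p z) / D z"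
  "complex_of_real (umap z $ 3) = (poly q z * cnj (poly q z) - poly p z * cnj (poly p z)) / D z"
proof -
  define x where "x = poly q z * cnj (poly p z)"
  have u: "umap z = (1 / D z) *\<^sub>R vector [2 * Re x, 2 * Im x, (cmod (poly q z))\<^sup>2 - (cmod (poly p z))\<^sup>2]"
    unfolding umap_def x_def using no_common_zero[of z]
    by (subst stereo_quot_homogeneous) (auto simp: D_def add.commute)
  have r: "umap z $ 1 = 2 * Re x / D z" "umap z $ 2 = 2 * Im x / D z"
    "umap z $ 3 = ((cmod (poly q z))\<^sup>2 - (cmod (poly p z))\<^sup>2) / D z"
    by (simp_all add: u)
  have c: "complex_of_real (2 * Re x) = x + cnj x" "complex_of_real (2 * Im x) = - \<i> * (x - cnj x)"
    by (simp_all add: complex_eq_iff)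
  have cx: "cnj x = cnj (poly q z) * poly p z" by (simp add: x_def)
  show "complex_of_real (umap z $ 1) = (poly q z * cnj (poly p z) + cnj (poly q z) * poly p z) / D z"
    unfolding r of_real_divide c cx unfolding x_def ..
  show "complex_of_real (umap z $ 2) = - \<i> * (poly q z * cnj (poly p z) - cnj (poly q z) * poly p z) / D z"
    unfolding r of_real_divide c cx unfolding x_def ..
  show "complex_of_real (umap z $ 3) = (poly q z * cnj (poly q z) - poly p z * cnj (poly p z)) / D z"
    unfolding r of_real_divide by (simp add: complex_norm_square del: of_real_power)
qed

lemma umap_D:
  "of_real (D z) * complex_of_real (umap z $ 1) = poly q z * cnj (poly p z) + cnj (poly q z) * poly p z"
  "of_real (D z) * complex_of_real (umap z $ 2) = - \<i> * (poly q z * cnj (poly p z) - cnj (poly q z) * poly p z)"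
  "of_real (D z) * complex_of_real (umap z $ 3) = poly q z * cnj (poly q z) - poly p z * cnj (poly p z)"
  using D_ne[of z] unfolding umap_components by simp_all

text \<open>One scalar factor times the conjugate isotropic vector: the zeros of the derivative are
  those of the Wronskian, while the direction is defined everywhere.\<close>

lemma wirt_umap:
  "wirt (\<lambda>z. complex_of_real (umap z $ i)) (W z * cnj (null_vec z $ i) / (of_real (D z))\<^sup>2)
    (cnj (W z * cnj (null_vec z $ i) / (of_real (D z))\<^sup>2)) z"
proof -
  have "\<forall>i. wirt (\<lambda>z. complex_of_real (umap z $ i)) (W z * cnj (null_vec z $ i) / (of_real (D z))\<^sup>2)
    (cnj (W z * cnj (null_vec z $ i) / (of_real (D z))\<^sup>2)) z"
    unfolding forall_3 umap_components
  proof (intro conjI)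
    show "wirt (\<lambda>z. (poly q z * cnj (poly p z) + cnj (poly q z) * poly p z) / complex_of_real (D z))
      (W z * cnj (null_vec z $ 1) / (of_real (D z))\<^sup>2) (cnj (W z * cnj (null_vec z $ 1) / (of_real (D z))\<^sup>2)) z"
      by (rule wirt_cong[OF wirt_divide[OF wirt_add[OF wirt_mult[OF wirt_poly wirt_cnj_poly]
              wirt_mult[OF wirt_cnj_poly wirt_poly]] wirt_D D_ne]])
        (simp_all add: D_complex Dz_def W_def null_vec_def minus_divide_left del: divide_minus_left,
          simp_all add: algebra_simps power2_eq_square minus_divide_left del: divide_minus_left)
    show "wirt (\<lambda>z. - \<i> * (poly q z * cnj (poly p z) - cnj (poly q z) * poly p z) / complex_of_real (D z))
      (W z * cnj (null_vec z $ 2) / (of_real (D z))\<^sup>2) (cnj (W z * cnj (null_vec z $ 2) / (of_real (D z))\<^sup>2)) z"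
      by (rule wirt_cong[OF wirt_divide[OF wirt_mult[OF wirt_const wirt_diff[OF wirt_mult[OF wirt_poly wirt_cnj_poly]
              wirt_mult[OF wirt_cnj_poly wirt_poly]]] wirt_D D_ne]])
        (simp_all add: D_complex Dz_def W_def null_vec_def minus_divide_left del: divide_minus_left,
          simp_all add: algebra_simps power2_eq_square minus_divide_left del: divide_minus_left)
    show "wirt (\<lambda>z. (poly q z * cnj (poly q z) - poly p z * cnj (poly p z)) / complex_of_real (D z))
      (W z * cnj (null_vec z $ 3) / (of_real (D z))\<^sup>2) (cnj (W z * cnj (null_vec z $ 3) / (of_real (D z))\<^sup>2)) z"
      by (rule wirt_cong[OF wirt_divide[OF wirt_diff[OF wirt_mult[OF wirt_poly wirt_cnj_poly]
              wirt_mult[OF wirt_poly wirt_cnj_poly]] wirt_D D_ne]])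
        (simp_all add: D_complex Dz_def W_def null_vec_def minus_divide_left del: divide_minus_left,
          simp_all add: algebra_simps power2_eq_square minus_divide_left del: divide_minus_left)
  qed
  then show ?thesis by blast
qed

lemma umap_dz:
  "umap differentiable (at z)" "dz umap i z = W z * cnj (null_vec z $ i) / (of_real (D z))\<^sup>2"
  using wirt_real_components[OF wirt_umap] by blast+

text \<open>The matrix of the orthogonal projection onto the tangent plane, scaled by
  \<open>2 * (D z)\<^sup>2\<close>. Each component of \<open>umap\<close> is kept together with a
  factor \<open>D\<close> so that both sides are polynomial.\<close>

lemma null_vec_product:
  "null_vec z $ j * cnj (null_vec z $ i) + cnj (null_vec z $ j) * null_vec z $ i
    = (if i = j then 2 * (of_real (D z))\<^sup>2 else 0)
      - 2 * (of_real (D z) * of_real (umap z $ i)) * (of_real (D z) * of_real (umap z $ j))"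
proof -
  have "\<forall>i j. null_vec z $ j * cnj (null_vec z $ i) + cnj (null_vec z $ j) * null_vec z $ i
    = (if i = j then 2 * (of_real (D z))\<^sup>2 else 0)
      - 2 * (of_real (D z) * of_real (umap z $ i)) * (of_real (D z) * of_real (umap z $ j))"
    unfolding forall_3 umap_D
    unfolding D_complex
    by (intro conjI; simp add: null_vec_def; simp add: algebra_simps power2_eq_square)
  then show ?thesis by blast
qed

lemma null_vec_norm: "(\<Sum>i\<in>UNIV. (cmod (null_vec z $ i))\<^sup>2) = 2 * (D z)\<^sup>2"
proof -
  have cn: "(complex_of_real (cmod x))\<^sup>2 = x * cnj x" for x
    using complex_norm_square[of x] by simp
  have "complex_of_real (\<Sum>i\<in>UNIV. (cmod (null_vec z $ i))\<^sup>2) = of_real (2 * (D z)\<^sup>2)"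
    by (simp add: sum_3 cn D_complex, simp add: null_vec_def, simp add: algebra_simps power2_eq_square)
  then show ?thesis by (simp only: of_real_eq_iff)
qed

lemma grad_sq_umap: "grad_sq umap z = 8 * (cmod (W z))\<^sup>2 / (D z)\<^sup>2"
proof -
  have "grad_sq umap z = 4 * ((cmod (W z))\<^sup>2 / ((D z)\<^sup>2)\<^sup>2 * (\<Sum>i\<in>UNIV. (cmod (null_vec z $ i))\<^sup>2))"
    by (simp add: grad_sq_dz umap_dz norm_mult norm_divide norm_power power_mult_distrib power_divide
        sum_distrib_left)
  then show ?thesis unfolding null_vec_norm using D_pos[of z] by (simp add: power2_eq_square)
qed

lemma null_vec_orthogonal: "(\<Sum>i\<in>UNIV. of_real (umap z $ i) * null_vec z $ i) = 0"
proof -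
  have "of_real (D z) * (\<Sum>i\<in>UNIV. of_real (umap z $ i) * null_vec z $ i) = 0"
    unfolding sum_3 distrib_left mult.assoc[symmetric] umap_D
    by (simp add: null_vec_def, simp add: algebra_simps power2_eq_square)
  then show ?thesis using D_ne by simp
qed

text \<open>Contracting \<open>null_vec_product\<close> with a tangent vector removes the normal
  term and recovers the vector from its complex coordinate.\<close>

lemma tangent_projection:
  assumes "v \<bullet> umap z = 0"
  shows "v $ i = 2 * Re ((1/2) * (\<Sum>j\<in>UNIV. of_real (v $ j) * null_vec z $ j) * cnj (null_vec z $ i) / (of_real (D z))\<^sup>2)"
proof -
  let ?n = "\<lambda>j. complex_of_real (D z) * of_real (umap z $ j)"
  let ?S = "\<Sum>j\<in>UNIV. of_real (v $ j) * null_vec z $ j"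
  have orth: "(\<Sum>j\<in>UNIV. of_real (v $ j) * ?n j) = 0"
  proof -
    have "(\<Sum>j\<in>UNIV. of_real (v $ j) * ?n j) = of_real (D z * (v \<bullet> umap z))"
      by (simp add: inner_vec_def sum_distrib_left mult.left_commute)
    then show ?thesis using assms by simp
  qed
  have "?S * cnj (null_vec z $ i) + cnj (?S * cnj (null_vec z $ i))
      = (\<Sum>j\<in>UNIV. of_real (v $ j) *
          (null_vec z $ j * cnj (null_vec z $ i) + cnj (null_vec z $ j) * null_vec z $ i))"
    by (simp add: sum_distrib_right distrib_left sum.distrib mult.assoc)
  also have "\<dots> = (\<Sum>j\<in>UNIV. (if i = j then 2 * of_real (v $ j) * (of_real (D z))\<^sup>2 else 0))
      - 2 * ?n i * (\<Sum>j\<in>UNIV. of_real (v $ j) * ?n j)"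
    unfolding null_vec_product sum_distrib_left sum_subtractf[symmetric]
    by (intro sum.cong refl) (simp add: algebra_simps)
  also have "\<dots> = of_real (2 * v $ i * (D z)\<^sup>2)" unfolding orth by simp
  finally have "?S * cnj (null_vec z $ i) + cnj (?S * cnj (null_vec z $ i)) = of_real (2 * v $ i * (D z)\<^sup>2)" .
  then have a: "2 * Re (?S * cnj (null_vec z $ i)) = 2 * v $ i * (D z)\<^sup>2"
    unfolding complex_add_cnj of_real_eq_iff .
  have eq: "(1/2) * ?S * cnj (null_vec z $ i) / (of_real (D z))\<^sup>2 = (?S * cnj (null_vec z $ i)) / of_real (2 * (D z)\<^sup>2)"
    by simp
  have D2: "(D z)\<^sup>2 > 0" using D_pos[of z] by simp
  have fin: "y = 2 * (x / (2 * d))" if "2 * x = 2 * y * d" "d > 0" for x y d :: real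
    using that by simp
  show ?thesis unfolding eq Re_divide_of_real by (rule fin[OF a D2])
qed

end

subsection \<open>Variations of a rational map\<close>

text \<open>Bezout coefficients multiplied by \<open>r\<close> may be too large; the coefficient of
  one polynomial is reduced modulo the other, chosen to be nonzero of degree exactly
  \<open>m\<close>. The degree of the remaining coefficient is then forced by the equation.\<close>

lemma coprime_bezout_degree:
  fixes p q r :: "complex poly"
  assumes cop: "coprime p q" and m: "max (degree p) (degree q) = m" and r: "degree r \<le> 2 * m"
  shows "\<exists>a b. degree a \<le> m \<and> degree b \<le> m \<and> r = b * p - a * q"
proof -
  have *: "\<exists>a b. degree a \<le> m \<and> degree b \<le> m \<and> r = b * p + a * q"
    if cop: "coprime p q" and dp: "degree p = m" and dq: "degree q \<le> m" and p0: "p \<noteq> 0"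
    for p q :: "complex poly"
  proof -
    obtain x y where xy: "x * p + y * q = 1"
      using bezout_coefficients_fst_snd[of p q] cop by (metis coprime_iff_gcd_eq_1)
    \<comment> \<open>Passing to the remainder moves a multiple of \<open>p * q\<close> into the
      term with \<open>b\<close>.\<close>
    define a where "a = (r * y) mod p"
    define b where "b = r * x + (r * y) div p * q"
    have a: "degree a \<le> m"
      using degree_mod_less[OF p0, of "r * y"] dp by (auto simp: a_def)
    have eq: "r = b * p + a * q"
    proof -
      have d: "p * ((r * y) div p) + a = r * y" by (simp add: a_def)
      have "b * p + a * q = r * x * p + (p * ((r * y) div p) + a) * q"
        by (simp add: b_def algebra_simps)
      also have "\<dots> = r * (x * p + y * q)" unfolding d by (simp add: algebra_simps)
      finally show ?thesis using xy by simp
    qed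
    have "degree b \<le> m"
    proof (cases "b = 0")
      case False
      have "degree (a * q) \<le> m + m" using degree_mult_le[of a q] a dq by linarith
      then have "degree (r - a * q) \<le> 2 * m" using r by (intro degree_diff_le) auto
      moreover have "degree (r - a * q) = degree b + m"
        using False p0 by (simp add: eq degree_mult_eq dp)
      ultimately show ?thesis by simp
    qed simp
    then show ?thesis using a eq by blast
  qed
  have m': "degree p \<le> m" "degree q \<le> m" using m by auto
  show ?thesis
  proof (cases "degree p = m \<and> p \<noteq> 0")
    case True
    then obtain a b where "degree a \<le> m" "degree b \<le> m" "r = b * p + a * q"
      using *[OF cop] m' by blast
    then show ?thesis by (intro exI[of _ "- a"] exI[of _ b]) simp
  next
    case False
    have "q \<noteq> 0 \<and> degree q = m"
    proof (cases "p = 0")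
      case True
      then show ?thesis using cop m by auto
    next
      case F: False
      then have "degree q = m" "degree q \<noteq> 0" using False m by (auto simp: max_def split: if_splits)
      then show ?thesis by auto
    qed
    then obtain a b where "degree a \<le> m" "degree b \<le> m" "r = b * q + a * p"
      using *[of q p] cop m' coprime_commute by blast
    then show ?thesis by (intro exI[of _ "- b"] exI[of _ a]) simp
  qed
qed

lemma continuous_zero_off_finite:
  fixes f :: "complex \<Rightarrow> complex"
  assumes "continuous_on UNIV f" "finite A" "\<And>z. z \<notin> A \<Longrightarrow> f z = 0"
  shows "f z = 0"
proof -
  have "open (f -` (- {0}))"
    using continuous_open_preimage[OF assms(1) open_UNIV, of "- {0}"] by (simp add: open_Compl)
  moreover have "finite (f -` (- {0}))"
    by (rule finite_subset[OF _ assms(2)]) (use assms(3) in auto)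
  ultimately have "f -` (- {0}) = {}" using finite_imp_not_open by blast
  then show ?thesis by auto
qed

context rational_pair
begin

text \<open>
  \<open>var r\<close> turns out to be the variation of \<open>q/p\<close> towards \<open>(q + t b)/(p + t a)\<close> for
  \<open>r = b p - a q\<close>.
\<close>

definition X :: "complex poly \<Rightarrow> 3 \<Rightarrow> complex \<Rightarrow> complex"
  where "X r i z = poly r z * cnj (null_vec z $ i) / (of_real (D z))\<^sup>2"

definition var :: "complex poly \<Rightarrow> complex \<Rightarrow> real^3"
  where "var r z = (\<chi> i. 2 * Re (X r i z))"

lemma bipoly_null_vec: "bipoly (2 * m) (\<lambda>z. null_vec z $ i)"
proof -
  have pw: "bipoly (2 * m) (\<lambda>z. (poly P z)\<^sup>2)" if "degree P \<le> m" for P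
    using bipoly_power[OF bipoly_poly[OF that], of 2] by (simp add: mult.commute)
  have "\<forall>i. bipoly (2 * m) (\<lambda>z. null_vec z $ i)"
    unfolding forall_3 null_vec_def
  proof (intro conjI; simp)
    show "bipoly (2 * m) (\<lambda>z. (poly p z)\<^sup>2 - (poly q z)\<^sup>2)" by (intro bipoly_diff pw degrees)
    show "bipoly (2 * m) (\<lambda>z. \<i> * ((poly p z)\<^sup>2 + (poly q z)\<^sup>2))"
      by (intro bipoly_cmult bipoly.add pw degrees)
    have "bipoly (m + m) (\<lambda>z. 2 * (poly p z * poly q z))"
      by (intro bipoly_cmult bipoly.mult bipoly_poly degrees)
    then show "bipoly (2 * m) (\<lambda>z. 2 * poly p z * poly q z)"
      by (simp only: mult.assoc mult_2[of m])
  qed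
  then show ?thesis by blast
qed

lemma tame_X:
  assumes "degree r \<le> 2 * m" shows "tame (X r i)"
proof -
  have "bipoly (2 * m + 2 * m) (\<lambda>z. poly r z * cnj (null_vec z $ i))"
    by (intro bipoly.mult bipoly_poly bipoly_cnj bipoly_null_vec assms)
  then show ?thesis
    unfolding tame_def X_def[abs_def]
    by (intro exI[of _ "2::nat"] exI[of _ "\<lambda>z. poly r z * cnj (null_vec z $ i)"] conjI refl)
      (simp only: mult_2_right[of "2 * m"])
qed

lemma tame_vec_var:
  assumes "degree r \<le> 2 * m" shows "tame_vec (var r)"
  unfolding tame_vec_def
  by (rule exI[of _ "\<lambda>i z. 2 * X r i z"]) (simp add: var_def tame_cmult[OF tame_X[OF assms]])

lemma var_tangent: "var r z \<bullet> umap z = 0"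
proof -
  have "complex_of_real (var r z \<bullet> umap z)
      = (\<Sum>i\<in>UNIV. (X r i z + cnj (X r i z)) * of_real (umap z $ i))"
    by (simp add: inner_vec_def var_def complex_add_cnj)
  also have "\<dots> = poly r z / (of_real (D z))\<^sup>2 * cnj (\<Sum>i\<in>UNIV. of_real (umap z $ i) * null_vec z $ i)
      + cnj (poly r z / (of_real (D z))\<^sup>2) * (\<Sum>i\<in>UNIV. of_real (umap z $ i) * null_vec z $ i)"
    by (simp add: X_def sum_distrib_left sum.distrib[symmetric] distrib_left distrib_right mult_ac)
  finally show ?thesis by (simp add: null_vec_orthogonal)
qed

lemma wirt_cnj_null_vec: "wirt (\<lambda>z. cnj (null_vec z $ i)) 0 (cnj (null_vec' z $ i)) z"
proof -
  have "\<forall>i. wirt (\<lambda>z. null_vec z $ i) (null_vec' z $ i) 0 z"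
  proof -
    have w1: "wirt (\<lambda>z. poly p z * poly p z - poly q z * poly q z)
        (2 * poly p z * poly (pderiv p) z - 2 * poly q z * poly (pderiv q) z) 0 z"
      by (rule wirt_cong[OF wirt_diff[OF wirt_mult[OF wirt_poly wirt_poly] wirt_mult[OF wirt_poly wirt_poly]]]) simp_all
    have w2: "wirt (\<lambda>z. \<i> * (poly p z * poly p z + poly q z * poly q z))
        (\<i> * (2 * poly p z * poly (pderiv p) z + 2 * poly q z * poly (pderiv q) z)) 0 z"
      by (rule wirt_cong[OF wirt_mult[OF wirt_const wirt_add[OF wirt_mult[OF wirt_poly wirt_poly] wirt_mult[OF wirt_poly wirt_poly]]]]) simp_all
    have w3: "wirt (\<lambda>z. 2 * poly p z * poly q z)
        (2 * (poly (pderiv p) z * poly q z + poly p z * poly (pderiv q) z)) 0 z"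
      by (rule wirt_cong[OF wirt_mult[OF wirt_mult[OF wirt_const wirt_poly] wirt_poly]]) (simp_all add: algebra_simps)
    show ?thesis
      unfolding forall_3 null_vec_def null_vec'_def using w1 w2 w3 by (simp add: power2_eq_square)
  qed
  then have "wirt (\<lambda>z. null_vec z $ i) (null_vec' z $ i) 0 z" by blast
  from wirt_cnj[OF this] show ?thesis by simp
qed

text \<open>Divided by the cube of \<open>D\<close> and conjugated, this says that
  \<open>null_vec\<close> over the square of \<open>D\<close> has a purely normal derivative in
  \<open>z\<close>, namely -2 \<open>W\<close> times \<open>umap\<close> over the square of
  \<open>D\<close>.\<close>

lemma null_vec_identity:
  "cnj (null_vec' z $ i) * of_real (D z) - 2 * cnj (null_vec z $ i) * cnj (Dz z)
    = - 2 * cnj (W z) * (of_real (D z) * of_real (umap z $ i))"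
proof -
  have "\<forall>i. cnj (null_vec' z $ i) * of_real (D z) - 2 * cnj (null_vec z $ i) * cnj (Dz z)
    = - 2 * cnj (W z) * (of_real (D z) * of_real (umap z $ i))"
    unfolding forall_3 umap_D
    unfolding D_complex
    by (intro conjI; simp add: null_vec_def null_vec'_def W_def Dz_def; simp add: algebra_simps power2_eq_square)
  then show ?thesis by blast
qed

text \<open>The mixed derivative of \<open>D\<close>, once in \<open>z\<close> and once in the
  conjugate variable.\<close>

definition Dzz :: "complex \<Rightarrow> complex"
  where "Dzz z = poly (pderiv p) z * cnj (poly (pderiv p) z) + poly (pderiv q) z * cnj (poly (pderiv q) z)"

text \<open>Lagrange's identity for the vectors (p, q) and (p', q'). It also says that
  \<open>log D\<close> has mixed derivative |W|^2 over the square of \<open>D\<close>, which later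
  yields the degree.\<close>

lemma lagrange_identity: "Dzz z * of_real (D z) - Dz z * cnj (Dz z) = W z * cnj (W z)"
  unfolding D_complex by (simp add: Dzz_def Dz_def W_def algebra_simps)

lemma wirt_Dz: "\<exists>a. wirt Dz a (Dzz z) z"
  unfolding Dz_def[abs_def]
  by (rule exI, rule wirt_cong[OF wirt_add[OF wirt_mult[OF wirt_poly wirt_cnj_poly]
          wirt_mult[OF wirt_poly wirt_cnj_poly]] refl]) (simp add: Dzz_def)

text \<open>
  \<open>S r * cnj null_vec / D\<^sup>3\<close> is the \<open>z\<close>-derivative of \<open>X r\<close>, and \<open>T r\<close> is its mixed second derivative.
\<close>

definition S :: "complex poly \<Rightarrow> complex \<Rightarrow> complex"
  where "S r z = poly (pderiv r) z * of_real (D z) - 2 * poly r z * Dz z"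

definition T :: "complex poly \<Rightarrow> 3 \<Rightarrow> complex \<Rightarrow> complex"
  where "T r i z = - 2 * cnj (W z) * (S r z / of_real (D z) ^ 3) * of_real (umap z $ i)
    - 2 * W z * cnj (W z) * X r i z / (of_real (D z))\<^sup>2"

lemma wirt_X:
  "wirt (X r i) (S r z * cnj (null_vec z $ i) / of_real (D z) ^ 3)
    (- 2 * poly r z * cnj (W z) * of_real (umap z $ i) / (of_real (D z))\<^sup>2) z"
proof -
  have w: "wirt (\<lambda>z. poly r z * cnj (null_vec z $ i) / (of_real (D z) * of_real (D z)))
    (((poly (pderiv r) z * cnj (null_vec z $ i) + poly r z * 0) * (of_real (D z) * of_real (D z))
       - (poly r z * cnj (null_vec z $ i)) * (Dz z * of_real (D z) + of_real (D z) * Dz z))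
    / (of_real (D z) * of_real (D z))\<^sup>2) (((0 * cnj (null_vec z $ i) + poly r z * cnj (null_vec' z $ i)) * (of_real (D z) * of_real (D z))
       - (poly r z * cnj (null_vec z $ i)) * (cnj (Dz z) * of_real (D z) + of_real (D z) * cnj (Dz z)))
    / (of_real (D z) * of_real (D z))\<^sup>2) z"
    by (intro wirt_divide wirt_mult wirt_poly wirt_cnj_null_vec wirt_D) (use D_ne in simp)
  have 1: "((r' * G + r * 0) * (d * d) - (r * G) * (y * d + d * y)) / (d * d)\<^sup>2 = (r' * d - 2 * r * y) * G / d ^ 3"
    if "d \<noteq> 0" for r' G r d y :: complex
    using that by (simp add: field_simps power2_eq_square power3_eq_cube)
  have 2: "((0 * G + r * G') * (d * d) - (r * G) * (y * d + d * y)) / (d * d)\<^sup>2 = - 2 * r * w * u / d\<^sup>2"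
    if "d \<noteq> 0" "G' * d - 2 * G * y = - 2 * w * (d * u)" for G' G r d y w u :: complex
  proof -
    have e: "((0 * G + r * G') * (d * d) - (r * G) * (y * d + d * y)) = r * d * (G' * d - 2 * G * y)"
      by (simp add: algebra_simps)
    show ?thesis unfolding e that(2) using that(1) by (simp add: field_simps power2_eq_square)
  qed
  show ?thesis
    unfolding X_def[abs_def] power2_eq_square[of "complex_of_real (D _)"]
    by (rule wirt_cong[OF w])
      (simp_all only: 1[OF D_ne] 2[OF D_ne null_vec_identity] S_def power2_eq_square[of "complex_of_real (D _)"])
qed

lemma wirt_Xz: "\<exists>a. wirt (\<lambda>z. S r z * cnj (null_vec z $ i) / of_real (D z) ^ 3) a (T r i z) z"
proof -
  obtain a where a: "wirt Dz a (Dzz z) z" using wirt_Dz by blast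
  let ?d = "complex_of_real (D z)"
  let ?G = "cnj (null_vec z $ i)" and ?G' = "cnj (null_vec' z $ i)"
  let ?S' = "poly (pderiv r) z * cnj (Dz z) - 2 * poly r z * Dzz z"
  have wS: "\<exists>b. wirt (S r) b ?S' z"
    unfolding S_def[abs_def]
    by (rule exI, rule wirt_cong[OF wirt_diff[OF wirt_mult[OF wirt_poly wirt_D]
            wirt_mult[OF wirt_mult[OF wirt_const wirt_poly] a]] refl]) simp
  then obtain b where b: "wirt (S r) b ?S' z" ..
  have alg: "((S' * G + s * G') * (d * (d * d)) - s * G * (y * (d * d) + d * (y * d + d * y))) / (d * (d * d))\<^sup>2
      = - 2 * wc * (s / d ^ 3) * u - 2 * w * wc * (r * G / d\<^sup>2) / d\<^sup>2"
    if d: "d \<noteq> 0" and s: "s = r' * d - 2 * r * x" and S': "S' = r' * y - 2 * r * l"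
      and 1: "G' * d - 2 * G * y = - 2 * wc * (d * u)" and 2: "l * d - x * y = w * wc"
    for S' G s G' d y wc u w r r' x l :: complex
  proof -
    have e: "(S' * G + s * G') * d - 3 * s * G * y = s * (- 2 * wc * (d * u)) - 2 * (w * wc) * r * G"
      unfolding 1[symmetric] 2[symmetric] s S' by (simp add: algebra_simps)
    have "((S' * G + s * G') * (d * (d * d)) - s * G * (y * (d * d) + d * (y * d + d * y))) / (d * (d * d))\<^sup>2
      = ((S' * G + s * G') * d - 3 * s * G * y) / d ^ 4"
      using d by (simp add: field_simps power2_eq_square eval_nat_numeral)
    also have "\<dots> = - 2 * wc * (s / d ^ 3) * u - 2 * w * wc * (r * G / d\<^sup>2) / d\<^sup>2"
      unfolding e using d by (simp add: field_simps power2_eq_square eval_nat_numeral)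
    finally show ?thesis .
  qed
  have "\<exists>c. wirt (\<lambda>z. S r z * cnj (null_vec z $ i) / (of_real (D z) * (of_real (D z) * of_real (D z)))) c
    (((?S' * ?G + S r z * ?G') * (?d * (?d * ?d)) - S r z * ?G * (cnj (Dz z) * (?d * ?d) + ?d * (cnj (Dz z) * ?d + ?d * cnj (Dz z))))
      / (?d * (?d * ?d))\<^sup>2) z"
    by (rule exI, rule wirt_divide[OF wirt_mult[OF b wirt_cnj_null_vec]
          wirt_mult[OF wirt_D wirt_mult[OF wirt_D wirt_D]]]) (use D_ne in simp)
  then show ?thesis
    unfolding alg[OF D_ne S_def refl null_vec_identity lagrange_identity] T_def X_def
    by (simp add: power3_eq_cube mult.assoc)
qed

text \<open>The derivative \<open>dz\<close> of a real part involves \<open>X_z\<close> and the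
  conjugate of the other first derivative, so its own derivative involves both mixed derivatives of
  \<open>X r i\<close>. Each is computed directly, with common value \<open>T r i\<close>.\<close>

lemma wirt_Xzb:
  "\<exists>b. wirt (\<lambda>z. - 2 * poly r z * cnj (W z) * of_real (umap z $ i) / (of_real (D z))\<^sup>2) (T r i z) b z"
proof -
  let ?d = "complex_of_real (D z)"
  have W: "\<exists>b. wirt (\<lambda>z. cnj (W z)) 0 b z"
  proof -
    have "\<exists>b. wirt W b 0 z"
      unfolding W_def[abs_def]
      by (rule exI, rule wirt_cong[OF wirt_diff[OF wirt_mult[OF wirt_poly wirt_poly]
              wirt_mult[OF wirt_poly wirt_poly]] refl]) simp
    then show ?thesis using wirt_cnj by fastforce
  qed
  then obtain b where b: "wirt (\<lambda>z. cnj (W z)) 0 b z" ..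
  have alg: "((((0 * r + (-2) * r') * wc + (- 2) * r * 0) * u + ((-2) * r * wc) * (w * G / d\<^sup>2)) * (d * d)
      - ((-2) * r * wc) * u * (x * d + d * x)) / (d * d)\<^sup>2
      = - 2 * wc * ((r' * d - 2 * r * x) / d ^ 3) * u - 2 * w * wc * (r * G / d\<^sup>2) / d\<^sup>2"
    if "d \<noteq> 0" for r r' wc w u G d x :: complex
    using that by (simp add: field_simps power2_eq_square eval_nat_numeral)
  have "\<exists>c. wirt (\<lambda>z. (- 2) * poly r z * cnj (W z) * of_real (umap z $ i) / (of_real (D z) * of_real (D z)))
    (((((0 * poly r z + (-2) * poly (pderiv r) z) * cnj (W z) + (- 2) * poly r z * 0) * of_real (umap z $ i)
      + ((-2) * poly r z * cnj (W z)) * (W z * cnj (null_vec z $ i) / ?d\<^sup>2)) * (?d * ?d)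
      - ((-2) * poly r z * cnj (W z)) * of_real (umap z $ i) * (Dz z * ?d + ?d * Dz z)) / (?d * ?d)\<^sup>2) c z"
    by (rule exI, rule wirt_divide[OF wirt_mult[OF wirt_mult[OF wirt_mult[OF wirt_const wirt_poly] b] wirt_umap]
          wirt_mult[OF wirt_D wirt_D]]) (use D_ne in simp)
  then show ?thesis
    unfolding alg[OF D_ne] T_def X_def S_def
    by (simp add: power2_eq_square)
qed

lemma dz_var:
  "dz (var r) i z = S r z * cnj (null_vec z $ i) / of_real (D z) ^ 3
    + cnj (- 2 * poly r z * cnj (W z) * of_real (umap z $ i) / (of_real (D z))\<^sup>2)"
proof (rule wirt_real_components(2))
  fix i
  have "(\<lambda>z. complex_of_real (var r z $ i)) = (\<lambda>z. X r i z + cnj (X r i z))"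
    by (simp add: var_def complex_add_cnj)
  then show "wirt (\<lambda>z. complex_of_real (var r z $ i)) (S r z * cnj (null_vec z $ i) / of_real (D z) ^ 3
    + cnj (- 2 * poly r z * cnj (W z) * of_real (umap z $ i) / (of_real (D z))\<^sup>2))
    (- 2 * poly r z * cnj (W z) * of_real (umap z $ i) / (of_real (D z))\<^sup>2
      + cnj (S r z * cnj (null_vec z $ i) / of_real (D z) ^ 3)) z"
    using wirt_add[OF wirt_X wirt_cnj[OF wirt_X]] by simp
qed

text \<open>In \<open>T\<close> the first term is normal and the second is \<open>X r i\<close>
  times \<open>- grad_sq umap / 4\<close>. The Laplacian is 8 times the real part of
  \<open>T\<close>, which turns the second term into \<open>- grad_sq umap\<close> times
  \<open>var r\<close>.\<close>

lemma var_laplacian: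
  assumes "degree r \<le> 2 * m"
  shows "\<exists>c. laplacian (var r) z = - (grad_sq umap z *\<^sub>R var r z) + c *\<^sub>R umap z"
proof -
  have C: "Ck 2 (var r)" by (rule tame_vec_Ck[OF tame_vec_var[OF assms]])
  define c where "c = Re (- 16 * cnj (W z) * (S r z / of_real (D z) ^ 3))"
  have "laplacian (var r) z $ i = - (grad_sq umap z * var r z $ i) + c * umap z $ i" for i
  proof -
    obtain a where a: "wirt (dz (var r) i) a (of_real (laplacian (var r) z $ i / 4)) z"
      using wirt_dz[OF C] by blast
    obtain b where b: "wirt (\<lambda>z. S r z * cnj (null_vec z $ i) / of_real (D z) ^ 3) b (T r i z) z"
      using wirt_Xz by blast
    obtain d where d: "wirt (\<lambda>z. - 2 * poly r z * cnj (W z) * of_real (umap z $ i) / (of_real (D z))\<^sup>2) (T r i z) d z"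
      using wirt_Xzb by blast
    have e: "dz (var r) i = (\<lambda>z. S r z * cnj (null_vec z $ i) / of_real (D z) ^ 3
        + cnj (- 2 * poly r z * cnj (W z) * of_real (umap z $ i) / (of_real (D z))\<^sup>2))"
      by (rule ext) (rule dz_var)
    have "complex_of_real (laplacian (var r) z $ i / 4) = T r i z + cnj (T r i z)"
      by (rule wirt_unique(2)[OF a]) (unfold e, rule wirt_add[OF b wirt_cnj[OF d]])
    then have l: "laplacian (var r) z $ i = 8 * Re (T r i z)"
      unfolding complex_add_cnj of_real_eq_iff by simp
    have "T r i z = of_real (umap z $ i / 8) * (- 16 * cnj (W z) * (S r z / of_real (D z) ^ 3))
        + of_real (- 2 * (cmod (W z))\<^sup>2 / (D z)\<^sup>2) * X r i z"
    proof -
      have c: "complex_of_real (- 2 * (cmod (W z))\<^sup>2 / (D z)\<^sup>2) = - 2 * (W z * cnj (W z)) / (of_real (D z))\<^sup>2"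
        using complex_norm_square[of "W z"] by simp
      show ?thesis unfolding T_def c by (simp add: mult.assoc)
    qed
    moreover have "Re (complex_of_real x * y + complex_of_real x' * y') = x * Re y + x' * Re y'" for x x' y y'
      by simp
    ultimately have "Re (T r i z) = umap z $ i / 8 * c + (- 2 * (cmod (W z))\<^sup>2 / (D z)\<^sup>2) * Re (X r i z)"
      unfolding c_def by (simp only:)
    then show ?thesis unfolding l grad_sq_umap by (simp add: var_def)
  qed
  then have "laplacian (var r) z = - (grad_sq umap z *\<^sub>R var r z) + c *\<^sub>R umap z"
    by (simp add: vec_eq_iff)
  then show ?thesis ..
qed

lemma var_in_kernel:
  assumes "harmonic_map umap" "degree r \<le> 2 * m"
  shows "var r \<in> bounded_kernel umap"
proof -
  have C: "Ck 2 (var r)" by (rule tame_vec_Ck[OF tame_vec_var[OF assms(2)]])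
  have "lin_op umap (var r) z = 0" for z
  proof -
    obtain c where "laplacian (var r) z = - (grad_sq umap z *\<^sub>R var r z) + c *\<^sub>R umap z"
      using var_laplacian[OF assms(2)] by blast
    then show ?thesis by (rule lin_op_eq_0I[OF assms(1) C var_tangent])
  qed
  then show ?thesis
    using C tame_vec_bounded_C2[OF tame_vec_var[OF assms(2)]] var_tangent by (simp add: bounded_kernel_def)
qed

end

subsection \<open>Elements of the bounded kernel are variations\<close>

lemma dx_eq_Re_dz: "dx f z $ i = 2 * Re (dz f i z)"
  by (simp add: dz_def)

lemma norm_dz_le: "norm (dz f i z) \<le> norm (dx f z) + norm (dy f z)"
proof -
  have "norm (dz f i z) \<le> \<bar>dx f z $ i / 2\<bar> + \<bar>- dy f z $ i / 2\<bar>"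
    using cmod_le[of "dz f i z"] by (simp add: dz_def)
  then show ?thesis
    using component_le_norm_cart[of "dx f z" i] component_le_norm_cart[of "dy f z" i]
      norm_ge_zero[of "dx f z"] norm_ge_zero[of "dy f z"] by linarith
qed

lemma bounded_kernelD:
  assumes "v \<in> bounded_kernel u"
  shows "Ck 2 v" "v z \<bullet> u z = 0" "lin_op u v z = 0"
    "\<exists>B. \<forall>z. norm (v z) \<le> B \<and> norm (dx v z) \<le> B \<and> norm (dy v z) \<le> B"
proof -
  from assms show "Ck 2 v" "v z \<bullet> u z = 0" "lin_op u v z = 0" by (auto simp: bounded_kernel_def)
  from assms obtain B where B: "\<And>z. norm (v z) + norm (dx v z, dy v z)
      + norm ((dx (dx v) z, dx (dy v) z), (dy (dx v) z, dy (dy v) z)) \<le> B"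
    unfolding bounded_kernel_def bounded_C2_def bdd_above_def by blast
  have "norm (v z) \<le> B \<and> norm (dx v z) \<le> B \<and> norm (dy v z) \<le> B" for z
  proof -
    have "norm (dx v z) \<le> norm (dx v z, dy v z)" "norm (dy v z) \<le> norm (dx v z, dy v z)"
      using norm_fst_le[of "dx v z" "dy v z"] norm_snd_le[of "dy v z" "dx v z"] by auto
    then show ?thesis
      using B[of z] norm_ge_zero[of "v z"]
        norm_ge_zero[of "((dx (dx v) z, dx (dy v) z), (dy (dx v) z, dy (dy v) z))"]
        norm_ge_zero[of "(dx v z, dy v z)"] by linarith
  qed
  then show "\<exists>B. \<forall>z. norm (v z) \<le> B \<and> norm (dx v z) \<le> B \<and> norm (dy v z) \<le> B" by blast
qed

text \<open>The linearized Hopf differential.\<close>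

lemma kernel_hopf_holomorphic:
  assumes u: "harmonic_map u" and v: "v \<in> bounded_kernel u"
  shows "hopf u v holomorphic_on UNIV"
proof (rule hopf_holomorphic)
  note vD = bounded_kernelD[OF v]
  show "Ck 2 u" by (rule harmonic_mapD(1)[OF u])
  show "Ck 2 v" by (rule vD)
  fix z
  have lap: "laplacian v z = - (grad_sq u z *\<^sub>R v z) - (2 * grad_inner u v z) *\<^sub>R u z"
    using vD(3)[of z] by (simp add: lin_op_def add_eq_0_iff2 algebra_simps)
  have "(\<Sum>i\<in>UNIV. of_real (laplacian u z $ i) * dz v i z + dz u i z * of_real (laplacian v z $ i))
    = - of_real (grad_sq u z) * (\<Sum>i\<in>UNIV. dz u i z * of_real (v z $ i) + of_real (u z $ i) * dz v i z)
      - of_real (2 * grad_inner u v z) * (\<Sum>i\<in>UNIV. of_real (u z $ i) * dz u i z)"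
    by (simp add: harmonic_mapD(4)[OF u] lap sum_distrib_left sum_subtractf[symmetric] sum.distrib[symmetric] algebra_simps)
  moreover have "(\<Sum>i\<in>UNIV. dz u i z * of_real (v z $ i) + of_real (u z $ i) * dz v i z) = 0"
    by (rule dz_inner_const[OF harmonic_mapD(2)[OF u] Ck_2D(1)[OF vD(1)]]) (use vD(2) in \<open>simp add: inner_commute\<close>)
  ultimately show "(\<Sum>i\<in>UNIV. of_real (laplacian u z $ i) * dz v i z + dz u i z * of_real (laplacian v z $ i)) = 0"
    by (simp add: harmonic_tangent[OF u])
qed

context rational_pair
begin

text \<open>As \<open>null_vec\<close> is holomorphic, the conjugate of the isotropy hypothesis is
  the Cauchy-Riemann equation for the coordinate \<open>R\<close> of \<open>v\<close>. Boundedness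
  of \<open>v\<close> limits the growth of \<open>R\<close> to that of \<open>null_vec\<close>,
  whose entries have degree at most \<open>2 * m\<close>.\<close>

lemma isotropic_imp_var:
  assumes C: "Ck 2 v" and t: "\<And>z. v z \<bullet> umap z = 0" and B: "\<And>z. norm (v z) \<le> B"
    and iso: "\<And>z. (\<Sum>i\<in>UNIV. dz v i z * cnj (null_vec z $ i)) = 0"
  shows "\<exists>r. degree r \<le> 2 * m \<and> v = var r"
proof -
  define R where "R z = (1/2) * (\<Sum>j\<in>UNIV. of_real (v z $ j) * null_vec z $ j)" for z
  have wF: "wirt (\<lambda>z. null_vec z $ i) (null_vec' z $ i) 0 z" for i z
    using wirt_cnj[OF wirt_cnj_null_vec[of i z]] by simp
  have "R holomorphic_on UNIV"
  proof -
    have "\<exists>d. (R has_field_derivative d) (at z)" for z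
    proof -
      have "\<exists>d. wirt R d ((1/2) * (\<Sum>j\<in>UNIV. cnj (dz v j z) * null_vec z $ j)) z"
        unfolding R_def[abs_def]
        by (rule exI, rule wirt_cong[OF wirt_mult[OF wirt_const wirt_sum[OF wirt_mult[OF
                  wirt_component[OF Ck_2D(1)[OF C]] wF]]] refl]) simp
      moreover have "(\<Sum>j\<in>UNIV. cnj (dz v j z) * null_vec z $ j) = 0"
        using arg_cong[OF iso[of z], of cnj] by simp
      ultimately show ?thesis using field_derivative_wirt by fastforce
    qed
    then show ?thesis by (auto simp: holomorphic_on_def field_differentiable_def)
  qed
  moreover have "\<exists>K. \<forall>z. 1 \<le> norm z \<longrightarrow> norm (R z) \<le> K * norm z ^ (2 * m)"
  proof -
    have "\<forall>j. \<exists>K. K \<ge> 0 \<and> (\<forall>z. norm (null_vec z $ j) \<le> K * (1 + norm z) ^ (2 * m))"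
      using bipoly_bound[OF bipoly_null_vec] by blast
    then obtain K where "\<forall>j. K j \<ge> 0 \<and> (\<forall>z. norm (null_vec z $ j) \<le> K j * (1 + norm z) ^ (2 * m))"
      by (rule choice[THEN exE])
    then have K: "K j \<ge> 0" "norm (null_vec z $ j) \<le> K j * (1 + norm z) ^ (2 * m)" for j z by blast+
    have B0: "B \<ge> 0" using B[of 0] norm_ge_zero[of "v 0"] by linarith
    have "norm (R z) \<le> ((\<Sum>j\<in>UNIV. B * K j) * 2 ^ (2 * m)) * norm z ^ (2 * m)" if z: "1 \<le> norm z" for z
    proof -
      have "norm (R z) \<le> norm (\<Sum>j\<in>UNIV. of_real (v z $ j) * null_vec z $ j)"
        unfolding R_def norm_mult by simp
      also have "\<dots> \<le> (\<Sum>j\<in>UNIV. B * (K j * (1 + norm z) ^ (2 * m)))"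
      proof (rule order_trans[OF norm_sum sum_mono])
        fix j
        have "\<bar>v z $ j\<bar> \<le> B" using component_le_norm_cart[of "v z" j] B[of z] by linarith
        then show "norm (of_real (v z $ j) * null_vec z $ j) \<le> B * (K j * (1 + norm z) ^ (2 * m))"
          unfolding norm_mult using K B0 by (intro mult_mono) auto
      qed
      also have "\<dots> = (\<Sum>j\<in>UNIV. B * K j) * (1 + norm z) ^ (2 * m)" by (simp add: sum_distrib_right mult.assoc)
      also have "\<dots> \<le> (\<Sum>j\<in>UNIV. B * K j) * (2 * norm z) ^ (2 * m)"
        using z K(1) B0 by (intro mult_left_mono power_mono sum_nonneg mult_nonneg_nonneg) auto
      finally show ?thesis by (simp add: power_mult_distrib mult.assoc)
    qed
    then show ?thesis by blast
  qed
  ultimately obtain r where r: "degree r \<le> 2 * m" "\<And>z. R z = poly r z"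
    using entire_polynomial_growth by blast
  have "v z $ i = var r z $ i" for z i
    using tangent_projection[OF t, of z i] unfolding var_def X_def r(2)[symmetric] R_def by simp
  then show ?thesis using r(1) by (auto simp: vec_eq_iff fun_eq_iff)
qed

lemma coprime_pq: "coprime p q"
  using no_common_zero by (rule coprime_polyI)

text \<open>The linearized Hopf differential is \<open>W\<close> over the square of \<open>D\<close>
  times the isotropy sum. Once it vanishes, so does the sum off the finitely many zeros of
  \<open>W\<close>, and by continuity everywhere.\<close>

lemma kernel_var_pos_degree:
  assumes h: "harmonic_map umap" and v: "v \<in> bounded_kernel umap" and m: "m > 0"
  shows "\<exists>r. degree r \<le> 2 * m \<and> v = var r"
proof -
  note vD = bounded_kernelD[OF v]
  obtain B where B: "\<And>z. norm (v z) \<le> B" "\<And>z. norm (dx v z) \<le> B" "\<And>z. norm (dy v z) \<le> B"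
    using vD(4) by blast
  have B0: "B \<ge> 0" using B(1)[of 0] norm_ge_zero[of "v 0"] by linarith
  define Wp where "Wp = pderiv q * p - q * pderiv p"
  have Wp: "W z = poly Wp z" for z by (simp add: W_def Wp_def)
  \<comment> \<open>A zero Wronskian would make each of the coprime polynomials divide its own
    derivative, so both would be constant.\<close>
  have "Wp \<noteq> 0"
  proof
    assume "Wp = 0"
    then have eq: "pderiv q * p = q * pderiv p" by (simp add: Wp_def)
    have *: "degree a = 0" if "coprime a b" "a dvd b * pderiv a" for a b :: "complex poly"
    proof (rule ccontr)
      assume d: "degree a \<noteq> 0"
      have "a dvd pderiv a" using that coprime_dvd_mult_right_iff by blast
      moreover have "pderiv a \<noteq> 0" using d by (simp add: pderiv_eq_0_iff)
      ultimately have "degree a \<le> degree (pderiv a)" by (rule dvd_imp_degree_le)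
      then show False using d by (simp add: degree_pderiv)
    qed
    have "p dvd q * pderiv p" by (metis eq dvd_triv_right)
    then have "degree p = 0" using *[OF coprime_pq] by blast
    moreover have "q dvd p * pderiv q" by (metis eq dvd_triv_left mult.commute)
    then have "degree q = 0" using *[of q p] coprime_pq by (simp add: coprime_commute)
    ultimately show False using m degree_eq by simp
  qed
  have hv: "hopf umap v z = W z / (of_real (D z))\<^sup>2 * (\<Sum>i\<in>UNIV. dz v i z * cnj (null_vec z $ i))" for z
    by (simp add: hopf_def umap_dz sum_distrib_left mult_ac)
  have "hopf umap v z = 0" for z
  proof (rule Liouville_weak_0[OF kernel_hopf_holomorphic[OF h v]])
    \<comment> \<open>Differentiation costs one degree, which gives the decay of the gradient of
      \<open>umap\<close>; the first derivatives of \<open>v\<close> are bounded.\<close>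
    have "degree (pderiv q * p) \<le> 2 * m - 1" "degree (q * pderiv p) \<le> 2 * m - 1"
      using degree_mult_le[of "pderiv q" p] degree_mult_le[of q "pderiv p"] degrees m
      by (auto simp: degree_pderiv)
    then have "degree Wp \<le> 2 * m - 1" unfolding Wp_def by (rule degree_diff_le)
    then have "bipoly (2 * m - 1) W" unfolding Wp[abs_def] by (rule bipoly_poly)
    then obtain C where C: "C \<ge> 0" "\<And>z. norm (W z) / D z \<le> C / (1 + norm z)"
      using bipoly_over_D_decay m by blast
    \<comment> \<open>The 12 collects three components, a factor 2 from the gradient of
      \<open>umap\<close> and a factor 2 from that of \<open>v\<close>.\<close>
    have "norm (hopf umap v z) \<le> (12 * B * C) * inverse (1 + norm z)" for z
    proof -
      have du: "norm (dz umap i z) \<le> 2 * (norm (W z) / D z)" for i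
      proof -
        have "(norm (dz umap i z))\<^sup>2 \<le> (\<Sum>i\<in>UNIV. (norm (dz umap i z))\<^sup>2)"
          by (rule member_le_sum) auto
        also have "\<dots> = 2 * (norm (W z) / D z)\<^sup>2"
          using grad_sq_dz[of umap z] by (simp add: grad_sq_umap power_divide)
        also have "\<dots> \<le> (2 * (norm (W z) / D z))\<^sup>2"
          unfolding power_mult_distrib by (rule mult_right_mono) simp_all
        finally show ?thesis
          by (rule power2_le_imp_le) (simp add: divide_nonneg_pos D_pos)
      qed
      have dv: "norm (dz v i z) \<le> 2 * B" for i
        using norm_dz_le[of v i z] B(2,3)[of z] by linarith
      have "norm (hopf umap v z) \<le> (\<Sum>i\<in>(UNIV::3 set). (2 * (norm (W z) / D z)) * (2 * B))"
        unfolding hopf_def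
      proof (rule order_trans[OF norm_sum sum_mono])
        fix i
        show "norm (dz umap i z * dz v i z) \<le> (2 * (norm (W z) / D z)) * (2 * B)"
          unfolding norm_mult using du dv D_pos[of z] by (intro mult_mono) auto
      qed
      also have "\<dots> = 12 * B * (norm (W z) / D z)" by simp
      also have "\<dots> \<le> 12 * B * (C / (1 + norm z))" using C(2) B0 by (intro mult_left_mono) auto
      finally show ?thesis by (simp add: divide_inverse mult.assoc)
    qed
    moreover have "((\<lambda>z::complex. (12 * B * C) * inverse (1 + norm z)) \<longlongrightarrow> 0) at_infinity"
    proof -
      have "filterlim (\<lambda>z::complex. 1 + norm z) at_top at_infinity"
        by (intro filterlim_tendsto_add_at_top[OF tendsto_const] filterlim_norm_at_top)
      then have "((\<lambda>z::complex. inverse (1 + norm z)) \<longlongrightarrow> 0) at_infinity"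
        by (rule tendsto_inverse_0_at_top)
      from tendsto_mult_left[OF this, of "12 * B * C"] show ?thesis by simp
    qed
    ultimately show "(hopf umap v \<longlongrightarrow> 0) at_infinity"
      by (intro Lim_null_comparison[of "hopf umap v" "\<lambda>z. (12 * B * C) * inverse (1 + norm z)"]) auto
  qed
  then have off: "(\<Sum>i\<in>UNIV. dz v i z * cnj (null_vec z $ i)) = 0" if "W z \<noteq> 0" for z
    using hv[of z] that D_ne[of z] by simp
  have "(\<Sum>i\<in>UNIV. dz v i z * cnj (null_vec z $ i)) = 0" for z
  proof (rule continuous_zero_off_finite[of "\<lambda>z. \<Sum>i\<in>UNIV. dz v i z * cnj (null_vec z $ i)" "{z. poly Wp z = 0}"])
    show "continuous_on UNIV (\<lambda>z. \<Sum>i\<in>UNIV. dz v i z * cnj (null_vec z $ i))"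
      by (intro continuous_at_imp_continuous_on ballI continuous_sum continuous_mult isCont_dz[OF vD(1)]
          wirt_isCont[OF wirt_cnj_null_vec])
    show "finite {z. poly Wp z = 0}" by (rule poly_roots_finite[OF \<open>Wp \<noteq> 0\<close>])
  qed (use off Wp in auto)
  then show ?thesis by (rule isotropic_imp_var[OF vD(1,2) B(1)])
qed

lemma umap_const:
  assumes "m = 0" shows "umap z = umap w"
proof -
  have "degree p = 0" "degree q = 0" using assms degree_eq by auto
  then show ?thesis by (auto simp: umap_def elim!: degree_eq_zeroE)
qed

text \<open>For a constant map the operator is the Laplacian. Each \<open>dz v i\<close> is then
  entire and bounded, hence constant, so \<open>v\<close> is affine, and being bounded it is
  constant.\<close>

lemma kernel_var_degree_0:
  assumes h: "harmonic_map umap" and v: "v \<in> bounded_kernel umap" and m: "m = 0"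
  shows "\<exists>r. degree r \<le> 2 * m \<and> v = var r"
proof -
  note vD = bounded_kernelD[OF v]
  obtain B where B: "\<And>z. norm (v z) \<le> B" "\<And>z. norm (dx v z) \<le> B" "\<And>z. norm (dy v z) \<le> B"
    using vD(4) by blast
  have c: "umap = (\<lambda>_. umap 0)" using umap_const[OF m] by blast
  have p0: "partial w umap z = 0" for w z
    by (subst c) (simp add: partial_def)
  have lap: "laplacian v z = 0" for z
    using vD(3)[of z] by (simp add: lin_op_def grad_sq_def grad_inner_def p0)
  have "dz v i z = 0" for i z
  proof -
    have d: "(dz v i has_field_derivative a) (at z)" if "wirt (dz v i) a (of_real (laplacian v z $ i / 4)) z" for a z
      using that lap by (intro field_derivative_wirt) simp
    then have "dz v i holomorphic_on UNIV"
      using wirt_dz[OF vD(1)] unfolding holomorphic_on_def field_differentiable_def by fastforce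
    moreover have "bounded (range (dz v i))"
      unfolding bounded_iff
    proof (intro exI[of _ "2 * B"] ballI)
      fix x assume "x \<in> range (dz v i)"
      then obtain z where x: "x = dz v i z" by blast
      show "norm x \<le> 2 * B" unfolding x using norm_dz_le[of v i z] B(2,3)[of z] by linarith
    qed
    ultimately have "dz v i constant_on UNIV" by (rule Liouville_theorem)
    then obtain c where c: "\<And>z. dz v i z = c" unfolding constant_on_def by blast
    define f where "f z = complex_of_real (v z $ i) - (c * z + cnj c * cnj z)" for z
    have "(f has_derivative (\<lambda>h. 0)) (at z within UNIV)" for z
    proof -
      have "wirt f 0 0 z"
        unfolding f_def[abs_def]
        by (rule wirt_cong[OF wirt_diff[OF wirt_component[OF Ck_2D(1)[OF vD(1)]]
                wirt_add[OF wirt_mult[OF wirt_const wirt_ident] wirt_mult[OF wirt_const wirt_cnj[OF wirt_ident]]]]])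
          (simp_all add: c)
      then show ?thesis by (simp add: wirt_def)
    qed
    then obtain k where k: "\<And>z. f z = k" using has_derivative_zero_constant[of UNIV f] by auto
    have lin: "t * (2 * (cmod c)\<^sup>2) \<le> B + norm k" if "t \<ge> 0" for t :: real
    proof -
      \<comment> \<open>In the direction \<open>cnj c\<close> the real-linear part of
        \<open>v\<close> grows at the rate \<open>2 * (cmod c)\<^sup>2\<close>.\<close>
      let ?z = "of_real t * cnj c"
      have e: "c * ?z + cnj c * cnj ?z = of_real (t * (2 * (cmod c)\<^sup>2))"
        using complex_norm_square[of c] by (simp add: mult_ac)
      have "x = a - k" if "a - x = k" for a x :: complex using that by auto
      from this[OF k[of ?z, unfolded f_def e]]
      have "complex_of_real (t * (2 * (cmod c)\<^sup>2)) = of_real (v ?z $ i) - k" .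
      then have "norm (complex_of_real (t * (2 * (cmod c)\<^sup>2))) \<le> \<bar>v ?z $ i\<bar> + norm k"
        by (metis norm_of_real norm_triangle_ineq4)
      also have "\<bar>v ?z $ i\<bar> \<le> B" using component_le_norm_cart[of "v ?z" i] B(1)[of ?z] by linarith
      finally show ?thesis
        using abs_ge_self[of "t * (2 * (cmod c)\<^sup>2)"] unfolding norm_of_real by linarith
    qed
    have "c = 0"
    proof (rule ccontr)
      assume "c \<noteq> 0"
      then have pos: "2 * (cmod c)\<^sup>2 > 0" by simp
      have "B + norm k \<ge> 0" using lin[of 0] by simp
      then have "((B + norm k + 1) / (2 * (cmod c)\<^sup>2)) * (2 * (cmod c)\<^sup>2) \<le> B + norm k"
        using pos by (intro lin) auto
      then show False using pos by simp
    qed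
    then show ?thesis using c by simp
  qed
  then show ?thesis by (intro isotropic_imp_var[OF vD(1,2) B(1)]) simp
qed

lemma kernel_eq_var:
  assumes "harmonic_map umap"
  shows "bounded_kernel umap = var ` {r. degree r \<le> 2 * m}"
proof
  show "bounded_kernel umap \<subseteq> var ` {r. degree r \<le> 2 * m}"
  proof
    fix v assume v: "v \<in> bounded_kernel umap"
    have "\<exists>r. degree r \<le> 2 * m \<and> v = var r"
      using kernel_var_pos_degree[OF assms v] kernel_var_degree_0[OF assms v] by (cases "m = 0") simp_all
    then show "v \<in> var ` {r. degree r \<le> 2 * m}" by (elim exE) simp
  qed
  show "var ` {r. degree r \<le> 2 * m} \<subseteq> bounded_kernel umap"
    by (rule image_subsetI) (simp add: var_in_kernel[OF assms])
qed


section \<open>Linear structure of the variations and their dimension\<close>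

lemma null_vec_isotropic: "(\<Sum>i\<in>UNIV. null_vec z $ i * null_vec z $ i) = 0"
  by (simp add: sum_3 null_vec_def algebra_simps power2_eq_square)

text \<open>Contraction with \<open>null_vec\<close> kills the conjugate part by isotropy and
  returns the coefficient of the other. Hence \<open>r\<close> is determined by
  \<open>var r\<close>.\<close>

lemma poly_from_var: "poly r z = (1/2) * (\<Sum>j\<in>UNIV. of_real (var r z $ j) * null_vec z $ j)"
proof -
  have n: "(\<Sum>i\<in>UNIV. cnj (null_vec z $ i) * null_vec z $ i) = 2 * (of_real (D z))\<^sup>2"
  proof -
    have "(\<Sum>i\<in>UNIV. cnj (null_vec z $ i) * null_vec z $ i) = of_real (\<Sum>i\<in>UNIV. (cmod (null_vec z $ i))\<^sup>2)"
      unfolding of_real_sum complex_norm_square by (simp add: mult.commute)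
    then show ?thesis by (simp add: null_vec_norm)
  qed
  have "(\<Sum>j\<in>UNIV. of_real (var r z $ j) * null_vec z $ j)
      = (\<Sum>j\<in>UNIV. (X r j z + cnj (X r j z)) * null_vec z $ j)"
    by (simp add: var_def complex_add_cnj)
  also have "\<dots> = poly r z / (of_real (D z))\<^sup>2 * (\<Sum>i\<in>UNIV. cnj (null_vec z $ i) * null_vec z $ i)
      + cnj (poly r z / (of_real (D z))\<^sup>2) * (\<Sum>i\<in>UNIV. null_vec z $ i * null_vec z $ i)"
    by (simp add: X_def sum_distrib_left sum.distrib[symmetric] distrib_left distrib_right mult_ac)
  also have "\<dots> = 2 * poly r z" unfolding n null_vec_isotropic using D_ne[of z] by simp
  finally show ?thesis by simp
qed

lemma var_eq_0: "(\<And>z. var r z = 0) \<Longrightarrow> r = 0"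
  using poly_from_var[of r] by (simp flip: poly_all_0_iff_0)

lemma var_add: "var (r + s) z = var r z + var s z"
  by (simp add: var_def X_def vec_eq_iff distrib_right add_divide_distrib)

lemma var_smult: "var (smult (of_real c) r) z = c *\<^sub>R var r z"
proof -
  have "X (smult (of_real c) r) i z = of_real c * X r i z" for i by (simp add: X_def)
  then show ?thesis by (simp add: var_def vec_eq_iff)
qed

lemma var_0: "var 0 z = 0"
  by (simp add: var_def X_def vec_eq_iff)

lemma var_sum:
  "finite I \<Longrightarrow> var (\<Sum>x\<in>I. smult (of_real (w x)) (f x)) z = (\<Sum>x\<in>I. w x *\<^sub>R var (f x) z)"
  by (induction I rule: finite_induct) (simp_all add: var_add var_smult var_0)

text \<open>
  As a function of the parameter \<open>t\<close>, extended to complex values, the family is itself a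
  quotient of polynomials, so the formula for the derivative of \<open>umap\<close> applies to it.
\<close>

lemma stereo_quot_variation:
  "((\<lambda>t::real. stereo_quot (poly (q + smult (of_real t) b) z) (poly (p + smult (of_real t) a) z))
    has_vector_derivative var (b * p - a * q) z) (at 0)"
proof (cases "\<forall>\<tau>. poly [:poly p z, poly a z:] \<tau> \<noteq> 0 \<or> poly [:poly q z, poly b z:] \<tau> \<noteq> 0")
  case True
  interpret R: rational_pair "[:poly p z, poly a z:]" "[:poly q z, poly b z:]"
    "max (degree [:poly p z, poly a z:]) (degree [:poly q z, poly b z:])"
    by unfold_locales (use True in auto)
  have "((\<lambda>t::real. R.umap (0 + t *\<^sub>R 1)) has_vector_derivative dx R.umap 0) (at 0)"
    by (rule differentiable_line[OF R.umap_dz(1)])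
  moreover have "(\<lambda>t::real. R.umap (0 + t *\<^sub>R 1))
      = (\<lambda>t. stereo_quot (poly (q + smult (of_real t) b) z) (poly (p + smult (of_real t) a) z))"
    by (simp add: R.umap_def fun_eq_iff scaleR_conv_of_real)
  moreover have "dx R.umap 0 = var (b * p - a * q) z"
  proof -
    \<comment> \<open>In the parameter the derivatives of the two linear polynomials are
      \<open>b\<close> and \<open>a\<close> at \<open>z\<close>, so the Wronskian at 0 is the
      polynomial \<open>r\<close>.\<close>
    have "R.W 0 = poly (b * p - a * q) z" by (simp add: R.W_def pderiv_pCons algebra_simps)
    moreover have "R.null_vec 0 = null_vec z" by (simp add: R.null_vec_def null_vec_def)
    moreover have "R.D 0 = D z" by (simp add: R.D_def D_def)
    ultimately show ?thesis by (simp add: vec_eq_iff dx_eq_Re_dz R.umap_dz var_def X_def)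
  qed
  ultimately show ?thesis by simp
next
  case False
  \<comment> \<open>A common zero in the parameter makes \<open>(a, b)\<close> proportional to
    \<open>(p, q)\<close> at this \<open>z\<close>. The quotient then does not move while |t| <
    |\<tau>|, and \<open>b p - a q\<close> vanishes at \<open>z\<close>.\<close>
  then obtain \<tau> where \<tau>: "poly p z + \<tau> * poly a z = 0" "poly q z + \<tau> * poly b z = 0" by auto
  have \<tau>0: "\<tau> \<noteq> 0" using \<tau> no_common_zero[of z] by auto
  have a: "poly a z = - poly p z / \<tau>" and b: "poly b z = - poly q z / \<tau>"
    using \<tau> \<tau>0 by (simp_all add: field_simps add_eq_0_iff)
  have "poly (b * p - a * q) z = 0" by (simp add: a b)
  then have v0: "var (b * p - a * q) z = 0" by (simp add: var_def X_def vec_eq_iff del: poly_diff poly_mult)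
  have "((\<lambda>t::real. stereo_quot (poly q z) (poly p z)) has_vector_derivative 0) (at 0)" by simp
  then show ?thesis
    unfolding v0
  proof (rule has_vector_derivative_transform_within_open)
    show "open (ball (0::real) (norm \<tau>))" "0 \<in> ball (0::real) (norm \<tau>)" using \<tau>0 by auto
    fix t :: real assume t: "t \<in> ball 0 (norm \<tau>)"
    define c where "c = 1 - of_real t / \<tau>"
    have "of_real t \<noteq> \<tau>" using t by auto
    then have c: "c \<noteq> 0" using \<tau>0 by (simp add: c_def)
    have "poly (q + smult (of_real t) b) z = c * poly q z" "poly (p + smult (of_real t) a) z = c * poly p z"
      by (simp_all add: a b c_def algebra_simps)
    then show "stereo_quot (poly q z) (poly p z)
        = stereo_quot (poly (q + smult (of_real t) b) z) (poly (p + smult (of_real t) a) z)"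
      using c by (simp add: stereo_quot_def)
  qed
qed

text \<open>The formula for a single variation gives one inclusion and Bezout with degree bounds the
  other. In particular the variations already form a real subspace.\<close>

lemma variations_eq:
  assumes M: "nat \<bar>M\<bar> = m"
  shows "variations M q p = (\<lambda>r z. var r (coord M z)) ` {r. degree r \<le> 2 * m}"
proof (intro equalityI subsetI)
  fix v assume "v \<in> variations M q p"
  then obtain a b where ab: "degree a \<le> m" "degree b \<le> m"
    "\<And>z. ((\<lambda>t::real. rational_map M (q + smult (of_real t) b) (p + smult (of_real t) a) z)
              has_vector_derivative v z) (at 0)"
    unfolding variations_def M by blast
  have "v z = var (b * p - a * q) (coord M z)" for z
    using vector_derivative_unique_at[OF ab(3)[unfolded rational_map_def] stereo_quot_variation] .
  moreover have "degree (b * p - a * q) \<le> 2 * m"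
    using degree_mult_le[of b p] degree_mult_le[of a q] ab(1,2) degrees by (intro degree_diff_le) auto
  ultimately show "v \<in> (\<lambda>r z. var r (coord M z)) ` {r. degree r \<le> 2 * m}"
    by (intro image_eqI[of _ _ "b * p - a * q"]) (simp_all add: fun_eq_iff)
next
  fix v assume "v \<in> (\<lambda>r z. var r (coord M z)) ` {r. degree r \<le> 2 * m}"
  then obtain r where r: "degree r \<le> 2 * m" "v = (\<lambda>z. var r (coord M z))" by blast
  obtain a b where ab: "degree a \<le> m" "degree b \<le> m" "r = b * p - a * q"
    using coprime_bezout_degree[OF coprime_pq degree_eq r(1)] by blast
  have "((\<lambda>t::real. rational_map M (q + smult (of_real t) b) (p + smult (of_real t) a) z)
              has_vector_derivative v z) (at 0)" for z
    unfolding rational_map_def r(2) ab(3) by (rule stereo_quot_variation)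
  then show "v \<in> variations M q p" unfolding variations_def M using ab(1,2) by blast
qed

text \<open>The basis consists of the images of the monomials up to degree \<open>2 * m\<close> and
  of their multiples by \<i>. Surjectivity of \<kappa> ensures that composing with it loses no
  information.\<close>

lemma dim_var:
  assumes \<kappa>: "surj \<kappa>"
    and eq: "V = (\<lambda>r z. var r (\<kappa> z)) ` {r. degree r \<le> 2 * m}"
  shows "dim V = 4 * m + 2"
proof -
  define I where "I = {..2 * m} \<times> (UNIV :: bool set)"
  define mon where "mon x = monom (if snd x then \<i> else 1) (fst x)" for x :: "nat \<times> bool"
  define b where "b x = (\<lambda>z. var (mon x) (\<kappa> z))" for x
  have finI: "finite I" by (simp add: I_def)
  have cardI: "card I = 4 * m + 2" by (simp add: I_def)
  have comb: "(\<Sum>x\<in>I. w x *\<^sub>R b x) z = var (\<Sum>x\<in>I. smult (of_real (w x)) (mon x)) (\<kappa> z)" for w z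
  proof -
    have "(\<Sum>x\<in>J. w x *\<^sub>R b x) z = (\<Sum>x\<in>J. w x *\<^sub>R b x z)" if "finite J" for J
      using that by (induction J rule: finite_induct) simp_all
    then show ?thesis using finI by (simp add: var_sum b_def)
  qed
  have coef: "coeff (\<Sum>x\<in>I. smult (of_real (w x)) (mon x)) k = Complex (w (k, False)) (w (k, True))"
    if "k \<le> 2 * m" for w k
  proof -
    have "coeff (\<Sum>x\<in>I. smult (of_real (w x)) (mon x)) k = (\<Sum>x\<in>I. coeff (smult (of_real (w x)) (mon x)) k)"
      by (rule coeff_sum)
    also have "\<dots> = (\<Sum>j\<le>2 * m. \<Sum>e\<in>UNIV. coeff (smult (of_real (w (j, e))) (mon (j, e))) k)"
      unfolding I_def by (simp add: sum.cartesian_product)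
    also have "\<dots> = (\<Sum>j\<le>2 * m. if j = k then Complex (w (k, False)) (w (k, True)) else 0)"
      by (intro sum.cong refl) (auto simp: UNIV_bool mon_def complex_eq_iff)
    also have "\<dots> = Complex (w (k, False)) (w (k, True))" using that by simp
    finally show ?thesis .
  qed
  have zero: "w x = 0" if wb: "(\<Sum>x\<in>I. w x *\<^sub>R b x) = 0" and xI: "x \<in> I" for w x
  proof -
    have "var (\<Sum>x\<in>I. smult (of_real (w x)) (mon x)) z = 0" for z
    proof -
      obtain y where "z = \<kappa> y" using \<kappa> by (rule surjE)
      then show ?thesis using comb[of w y] wb by simp
    qed
    then have "(\<Sum>x\<in>I. smult (of_real (w x)) (mon x)) = 0" by (rule var_eq_0)
    moreover obtain k e where x: "x = (k, e)" "k \<le> 2 * m" using xI by (auto simp: I_def)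
    ultimately have "Complex (w (k, False)) (w (k, True)) = 0" using coef[OF x(2), of w] by simp
    then show ?thesis using x(1) by (cases e) (simp_all add: complex_eq_iff)
  qed
  have inj: "inj_on b I"
  proof (rule inj_onI)
    fix x y assume xy: "x \<in> I" "y \<in> I" "b x = b y"
    show "x = y"
    proof (rule ccontr)
      assume ne: "x \<noteq> y"
      define w where "w = (\<lambda>t. if t = x then 1 else if t = y then -1 else (0::real))"
      have "(\<Sum>t\<in>I. w t *\<^sub>R b t) = (\<Sum>t\<in>{x, y}. w t *\<^sub>R b t)"
        using xy finI by (intro sum.mono_neutral_right) (auto simp: w_def)
      also have "\<dots> = 0" using ne xy(3) by (simp add: w_def)
      finally have "w x = 0" using zero xy(1) by blast
      then show False by (simp add: w_def)
    qed
  qed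
  have indep: "independent (b ` I)"
  proof
    assume "dependent (b ` I)"
    then obtain u where u: "\<exists>v\<in>b ` I. u v \<noteq> 0" "(\<Sum>v\<in>b ` I. u v *\<^sub>R v) = 0"
      using real_vector.dependent_finite[of "b ` I"] finI by auto
    then have "(\<Sum>x\<in>I. u (b x) *\<^sub>R b x) = 0" by (simp add: sum.reindex[OF inj])
    then show False using zero[of "\<lambda>x. u (b x)"] u(1) by blast
  qed
  have "b x \<in> V" if "x \<in> I" for x
  proof -
    have "degree (mon x) \<le> 2 * m"
      unfolding mon_def using that by (intro order_trans[OF degree_monom_le]) (auto simp: I_def)
    then show ?thesis unfolding eq b_def by blast
  qed
  then have 1: "b ` I \<subseteq> V" by blast
  have 2: "V \<subseteq> span (b ` I)"
  proof
    fix v assume "v \<in> V"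
    then obtain r where r: "degree r \<le> 2 * m" "v = (\<lambda>z. var r (\<kappa> z))" unfolding eq by blast
    define w where "w x = (if snd x then Im (coeff r (fst x)) else Re (coeff r (fst x)))" for x :: "nat \<times> bool"
    have "r = (\<Sum>x\<in>I. smult (of_real (w x)) (mon x))"
    proof (rule poly_eqI)
      fix k
      show "coeff r k = coeff (\<Sum>x\<in>I. smult (of_real (w x)) (mon x)) k"
      proof (cases "k \<le> 2 * m")
        case True
        then show ?thesis by (simp add: coef w_def)
      next
        case False
        then have "coeff r k = 0" using r(1) by (intro coeff_eq_0) simp
        moreover have "coeff (\<Sum>x\<in>I. smult (of_real (w x)) (mon x)) k = 0"
          unfolding coeff_sum by (intro sum.neutral) (use False in \<open>auto simp: I_def mon_def\<close>)
        ultimately show ?thesis by simp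
      qed
    qed
    then have v: "v = (\<Sum>x\<in>I. w x *\<^sub>R b x)" unfolding r(2) using comb[of w] by (intro ext) simp
    show "v \<in> span (b ` I)" unfolding v by (intro span_sum span_scale span_base) blast
  qed
  show ?thesis
    by (rule dim_unique[OF 1 2 indep]) (simp add: card_image[OF inj] cardI)
qed

end

subsection \<open>The degree of a rational map\<close>

text \<open>Twice the derivative in the conjugate variable is \<open>L_x + \<i> L_y\<close>; each
  term is integrated along its own variable. Squares instead of discs reduce Green's formula to
  one-dimensional integrals and an exchange of order.\<close>

lemma green_square:
  assumes w: "\<And>z. wirt L (A z) (B z) z" and cA: "continuous_on UNIV A" and cB: "continuous_on UNIV B"
    and R: "R > 0"
  shows "integral {-R..R} (\<lambda>x. integral {-R..R} (\<lambda>y. 2 * B (Complex x y)))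
    = integral {-R..R} (\<lambda>t. (L (Complex R t) - L (Complex (-R) t)) + \<i> * (L (Complex t R) - L (Complex t (-R))))"
proof -
  have cL: "continuous_on UNIV L"
    by (intro continuous_at_imp_continuous_on ballI wirt_isCont[OF w])
  note cL = continuous_on_Complex_args[OF cL] and cA = continuous_on_Complex_args[OF cA]
    and cB = continuous_on_Complex_args[OF cB]
  define f1 where "f1 x y = A (Complex x y) + B (Complex x y)" for x y
  define f2 where "f2 x y = \<i> * (A (Complex x y) - B (Complex x y))" for x y
  have c2: "continuous_on U (\<lambda>(x, y). f1 x y)" for U
    using continuous_on_add[OF cA(3) cB(3), of U] by (simp add: f1_def case_prod_beta)
  have i2: "integral {-R..R} (f2 x) = L (Complex x R) - L (Complex x (-R))" for x
    by (rule integral_unique, rule fundamental_theorem_of_calculus)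
      (use R in \<open>auto simp: f2_def intro: wirt_vector_derivative_y[OF w]\<close>)
  have i1: "integral {-R..R} (\<lambda>x. f1 x y) = L (Complex R y) - L (Complex (-R) y)" for y
    by (rule integral_unique, rule fundamental_theorem_of_calculus)
      (use R in \<open>auto simp: f1_def intro: wirt_vector_derivative_x[OF w]\<close>)
  have int1: "f1 x integrable_on {-R..R}" for x
    unfolding f1_def by (intro integrable_continuous_real continuous_on_add cA cB)
  have int2: "f2 x integrable_on {-R..R}" for x
    unfolding f2_def by (intro integrable_continuous_real continuous_intros cA cB)
  have inner: "integral {-R..R} (\<lambda>y. 2 * B (Complex x y))
      = integral {-R..R} (f1 x) + \<i> * (L (Complex x R) - L (Complex x (-R)))" for x
  proof -
    have "(\<lambda>y. 2 * B (Complex x y)) = (\<lambda>y. f1 x y + \<i> * f2 x y)"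
      by (simp add: f1_def f2_def fun_eq_iff)
    then show ?thesis
      using integral_add[OF int1[of x] integrable_on_mult_right[OF int2[of x], of \<i>]]
      by (simp add: i2)
  qed
  have outer1: "(\<lambda>x. integral {-R..R} (f1 x)) integrable_on {-R..R}"
    using integral_continuous_on_param[OF c2, of "{-R..R}" "-R" R] by (intro integrable_continuous_real) simp
  have intL: "(\<lambda>t. L (Complex R t) - L (Complex (-R) t)) integrable_on {-R..R}"
    by (intro integrable_continuous_real continuous_intros cL)
  have intL': "(\<lambda>t. \<i> * (L (Complex t R) - L (Complex t (-R)))) integrable_on {-R..R}"
    by (intro integrable_continuous_real continuous_intros cL)
  have "integral {-R..R} (\<lambda>x. integral {-R..R} (f1 x)) = integral {-R..R} (\<lambda>y. integral {-R..R} (\<lambda>x. f1 x y))"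
    using integral_swap_continuous[where f = f1 and a = "-R" and b = R and c = "-R" and d = R, OF c2] by simp
  then have sw: "integral {-R..R} (\<lambda>x. integral {-R..R} (f1 x)) = integral {-R..R} (\<lambda>t. L (Complex R t) - L (Complex (-R) t))"
    by (simp add: i1)
  show ?thesis
    unfolding inner integral_add[OF outer1 intL'] integral_add[OF intL intL'] sw ..
qed

text \<open>The integrand is the boundary term of \<open>green_square\<close> for the function
  1/z.\<close>

lemma integral_arctan:
  assumes "R > 0"
  shows "((\<lambda>t. 4 * R / (R\<^sup>2 + t\<^sup>2)) has_integral 2 * pi) {-R..R}"
proof -
  have "((\<lambda>t. 4 * arctan (t / R)) has_vector_derivative 4 * R / (R\<^sup>2 + t\<^sup>2)) (at t within {-R..R})" for t
  proof -
    have "((\<lambda>t. 4 * arctan (t / R)) has_real_derivative 4 * ((1 / R) * inverse (1 + (t / R)\<^sup>2))) (at t within {-R..R})"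
      using assms by (auto intro!: derivative_eq_intros)
    also have "4 * ((1 / R) * inverse (1 + (t / R)\<^sup>2)) = 4 * R / (R\<^sup>2 + t\<^sup>2)"
    proof -
      have "R\<^sup>2 + t\<^sup>2 > 0" using assms by (simp add: add_pos_nonneg)
      then show ?thesis using assms by (simp add: field_simps power2_eq_square)
    qed
    finally show ?thesis by (simp add: has_real_derivative_iff_has_vector_derivative)
  qed
  note d = this
  have "((\<lambda>t. 4 * R / (R\<^sup>2 + t\<^sup>2)) has_integral 4 * arctan (R / R) - 4 * arctan (- R / R)) {-R..R}"
    by (rule fundamental_theorem_of_calculus[OF _ d]) (use assms in simp)
  moreover have "4 * arctan (R / R) - 4 * arctan (- R / R) = 2 * pi"
    using assms by (simp add: arctan_one arctan_minus)
  ultimately show ?thesis by simp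
qed

section \<open>Exhaustion of the plane by squares\<close>

abbreviation square :: "real \<Rightarrow> complex set"
  where "square R \<equiv> cbox (Complex (- R) (- R)) (Complex R R)"

lemma nn_integral_square:
  assumes c: "continuous_on UNIV f" and nn: "\<And>z. f z \<ge> (0::real)"
  shows "(\<integral>\<^sup>+ z. ennreal (f z) * indicator (square R) z \<partial>lborel)
    = ennreal (integral {-R..R} (\<lambda>x. integral {-R..R} (\<lambda>y. f (Complex x y))))"
proof -
  have fm [measurable]: "f \<in> borel_measurable borel" using c by (rule borel_measurable_continuous_onI)
  have one: "(\<integral>\<^sup>+ t. ennreal (g t) * indicator {-R..R} t \<partial>lborel) = ennreal (integral {-R..R} g)"
    if "continuous_on {-R..R} g" "\<And>t. g t \<ge> 0" for g :: "real \<Rightarrow> real"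
  proof -
    have si: "set_integrable lborel {-R..R} g" by (rule borel_integrable_atLeastAtMost'[OF that(1)])
    have "(\<integral>\<^sup>+ t. ennreal (g t) * indicator {-R..R} t \<partial>lborel) = (\<integral>\<^sup>+ t. ennreal (indicator {-R..R} t *\<^sub>R g t) \<partial>lborel)"
      by (intro nn_integral_cong) (auto simp: indicator_def)
    also have "\<dots> = ennreal (integral\<^sup>L lborel (\<lambda>t. indicator {-R..R} t *\<^sub>R g t))"
      using si that(2) by (intro nn_integral_eq_integral) (auto simp: set_integrable_def)
    also have "integral\<^sup>L lborel (\<lambda>t. indicator {-R..R} t *\<^sub>R g t) = integral {-R..R} g"
      using set_borel_integral_eq_integral(2)[OF si] by (simp add: set_lebesgue_integral_def)
    finally show ?thesis .
  qed
  note cy = continuous_on_Complex_args(2)[OF c] and c2 = continuous_on_Complex_args(3)[OF c]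
  have cG: "continuous_on {-R..R} (\<lambda>x. integral {-R..R} (\<lambda>y. f (Complex x y)))"
    using integral_continuous_on_param[OF c2, of "{-R..R}" "-R" R] by simp
  have "(\<integral>\<^sup>+ z. ennreal (f z) * indicator (square R) z \<partial>lborel)
    = (\<integral>\<^sup>+ x. \<integral>\<^sup>+ y. ennreal (f (Complex x y)) * indicator (square R) (Complex x y) \<partial>lborel \<partial>lborel)"
    by (rule nn_integral_complex) measurable
  also have "\<dots> = (\<integral>\<^sup>+ x. ennreal (integral {-R..R} (\<lambda>y. f (Complex x y))) * indicator {-R..R} x \<partial>lborel)"
  proof (rule nn_integral_cong)
    fix x
    have "(\<integral>\<^sup>+ y. ennreal (f (Complex x y)) * indicator (square R) (Complex x y) \<partial>lborel)
      = (\<integral>\<^sup>+ y. (ennreal (f (Complex x y)) * indicator {-R..R} y) * indicator {-R..R} x \<partial>lborel)"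
      by (intro nn_integral_cong) (auto simp: indicator_def in_cbox_complex_iff)
    also have "\<dots> = (\<integral>\<^sup>+ y. ennreal (f (Complex x y)) * indicator {-R..R} y \<partial>lborel) * indicator {-R..R} x"
      by (intro nn_integral_multc) (use borel_measurable_continuous_onI[OF cy] in measurable)
    also have "\<dots> = ennreal (integral {-R..R} (\<lambda>y. f (Complex x y))) * indicator {-R..R} x"
      by (subst one) (use cy nn in auto)
    finally show "(\<integral>\<^sup>+ y. ennreal (f (Complex x y)) * indicator (square R) (Complex x y) \<partial>lborel)
      = ennreal (integral {-R..R} (\<lambda>y. f (Complex x y))) * indicator {-R..R} x" .
  qed
  also have "\<dots> = ennreal (integral {-R..R} (\<lambda>x. integral {-R..R} (\<lambda>y. f (Complex x y))))"
    by (rule one[OF cG]) (intro integral_nonneg integrable_continuous_real cy nn)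
  finally show ?thesis .
qed

lemma nn_integral_exhaust_squares:
  assumes fm [measurable]: "f \<in> borel_measurable borel"
    and lim: "(\<lambda>n. \<integral>\<^sup>+ z. f z * indicator (square (real n)) z \<partial>lborel)
      \<longlonglongrightarrow> l"
  shows "(\<integral>\<^sup>+ z. f z \<partial>lborel) = l"
proof -
  let ?A = "\<lambda>n. square (real n)"
  let ?M = "density lborel f"
  have "range ?A \<subseteq> sets ?M" by auto
  moreover have "incseq ?A" by (auto simp: incseq_def in_cbox_complex_iff)
  ultimately have "(\<lambda>n. emeasure ?M (?A n)) \<longlonglongrightarrow> emeasure ?M (\<Union>n. ?A n)"
    by (rule Lim_emeasure_incseq)
  moreover have "(\<Union>n. ?A n) = UNIV"
  proof -
    have "z \<in> (\<Union>n. ?A n)" for z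
    proof -
      obtain n where n: "norm z \<le> real n" using real_arch_simple by blast
      have "z \<in> ?A n" using n abs_Re_le_cmod[of z] abs_Im_le_cmod[of z] by (auto simp: in_cbox_complex_iff)
      then show ?thesis by blast
    qed
    then show ?thesis by blast
  qed
  moreover have "emeasure ?M (?A n) = (\<integral>\<^sup>+ z. f z * indicator (?A n) z \<partial>lborel)" for n
    by (rule emeasure_density) auto
  moreover have "emeasure ?M UNIV = (\<integral>\<^sup>+ z. f z \<partial>lborel)"
    by (subst emeasure_density) auto
  ultimately have "(\<lambda>n. \<integral>\<^sup>+ z. f z * indicator (?A n) z \<partial>lborel) \<longlonglongrightarrow> (\<integral>\<^sup>+ z. f z \<partial>lborel)" by simp
  then show ?thesis using lim by (rule LIMSEQ_unique)
qed

context rational_pair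
begin

text \<open>\<open>L\<close> is the \<open>z\<close>-derivative of \<open>log D\<close>.\<close>

definition L :: "complex \<Rightarrow> complex"
  where "L z = Dz z / of_real (D z)"

definition L_z :: "complex \<Rightarrow> complex"
  where "L_z z = ((poly (pderiv (pderiv p)) z * cnj (poly p z) + poly (pderiv (pderiv q)) z * cnj (poly q z))
    * of_real (D z) - Dz z * Dz z) / (of_real (D z))\<^sup>2"

definition L_zb :: "complex \<Rightarrow> complex"
  where "L_zb z = W z * cnj (W z) / (of_real (D z))\<^sup>2"

lemma wirt_L: "wirt L (L_z z) (L_zb z) z"
proof -
  have "wirt Dz (poly (pderiv (pderiv p)) z * cnj (poly p z) + poly (pderiv (pderiv q)) z * cnj (poly q z)) (Dzz z) z"
    unfolding Dz_def[abs_def]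
    by (rule wirt_cong[OF wirt_add[OF wirt_mult[OF wirt_poly wirt_cnj_poly]
            wirt_mult[OF wirt_poly wirt_cnj_poly]]]) (simp_all add: Dzz_def)
  then show ?thesis
    unfolding L_def[abs_def]
    by (rule wirt_cong[OF wirt_divide[OF _ wirt_D D_ne]]) (simp_all add: L_z_def L_zb_def lagrange_identity)
qed

lemma continuous_on_D: "continuous_on U (\<lambda>z. complex_of_real (D z))"
  by (intro continuous_at_imp_continuous_on ballI wirt_isCont[OF wirt_D])

lemma continuous_on_Dz: "continuous_on U Dz"
  unfolding Dz_def by (intro continuous_intros)

lemma continuous_on_W: "continuous_on U W"
  unfolding W_def by (intro continuous_intros)

text \<open>The difference is governed by z P' - m P for P = p and P = q, in which the coefficient
  of degree \<open>m\<close> cancels. So the numerator has total degree below that of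
  \<open>D\<close>; for \<open>m = 0\<close> it is zero.\<close>

lemma L_asymptotics: "\<exists>K\<ge>0. \<forall>z. z \<noteq> 0 \<longrightarrow> norm (L z - of_nat m / z) \<le> K / (norm z)\<^sup>2"
proof -
  define E where "E P = [:0, 1:] * pderiv P - smult (of_nat m) P" for P :: "complex poly"
  have Ec: "coeff (E P) k = (of_nat k - of_nat m) * coeff P k" for P k
    by (cases k) (simp_all add: E_def coeff_pderiv algebra_simps)
  have E0: "E P = 0" if "m = 0" "degree P \<le> m" for P
  proof (rule poly_eqI)
    fix k
    show "coeff (E P) k = coeff 0 k" using that by (cases "k = 0") (simp_all add: Ec coeff_eq_0)
  qed
  have Edeg: "bipoly (2 * m - 1) (\<lambda>z. poly (E P) z * cnj (poly P z))" if "degree P \<le> m" for P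
  proof (cases "m = 0")
    case True
    then show ?thesis using E0[OF True that] by (simp add: bipoly.const)
  next
    case False
    have "degree (E P) \<le> m - 1"
    proof (rule degree_le, intro allI impI)
      fix i assume "m - 1 < i"
      then have "i = m \<or> i > m" using False by linarith
      then show "coeff (E P) i = 0" using that by (auto simp: Ec coeff_eq_0)
    qed
    then have "bipoly ((m - 1) + m) (\<lambda>z. poly (E P) z * cnj (poly P z))"
      using that by (intro bipoly.mult bipoly_poly bipoly_cnj)
    then show ?thesis using False by (simp add: mult_2)
  qed
  define N where "N z = poly (E p) z * cnj (poly p z) + poly (E q) z * cnj (poly q z)" for z
  have N0: "N z = 0" if "m = 0" for z
    using E0[OF that degrees(1)] E0[OF that degrees(2)] by (simp add: N_def)
  have "\<exists>C\<ge>0. \<forall>z. norm (N z) / D z \<le> C / (1 + norm z)"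
  proof (cases "m = 0")
    case True
    then show ?thesis using N0 by (intro exI[of _ 0]) simp
  next
    case False
    have "bipoly (2 * m - 1) N" unfolding N_def by (intro bipoly.add Edeg degrees)
    then show ?thesis using bipoly_over_D_decay False by simp
  qed
  then obtain C where C: "C \<ge> 0" "\<And>z. norm (N z) / D z \<le> C / (1 + norm z)" by blast
  have "norm (L z - of_nat m / z) \<le> C / (norm z)\<^sup>2" if z: "z \<noteq> 0" for z
  proof -
    have "(L z - of_nat m / z) * (z * of_real (D z)) = N z"
    proof -
      have "(L z - of_nat m / z) * (z * of_real (D z)) = z * Dz z - of_nat m * of_real (D z)"
        using z D_ne[of z] by (simp add: L_def field_simps)
      then show ?thesis unfolding D_complex by (simp add: Dz_def N_def E_def algebra_simps)
    qed
    then have eq: "L z - of_nat m / z = N z / (z * of_real (D z))"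
      using z D_ne[of z] by (metis mult_eq_0_iff nonzero_mult_div_cancel_right)
    have "C / (1 + norm z) \<le> C / norm z" using C(1) z by (intro frac_le) auto
    then have "norm (N z) / D z \<le> C / norm z" using C(2)[of z] by linarith
    then have "norm (N z) / D z / norm z \<le> C / norm z / norm z" by (rule divide_right_mono) simp
    then show ?thesis unfolding eq using D_pos[of z]
      by (simp add: norm_divide norm_mult power2_eq_square mult_ac)
  qed
  then show ?thesis using C(1) by (intro exI[of _ C]) auto
qed

text \<open>Up to an error of order 1/|z|^2, \<open>L\<close> is \<open>m/z\<close> on the boundary,
  and the latter contributes \<open>2 * pi * m\<close> for every size of the square.\<close>

lemma boundary_limit:
  "(\<lambda>n. integral {-real n..real n} (\<lambda>x. integral {-real n..real n} (\<lambda>y. 2 * L_zb (Complex x y))))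
    \<longlonglongrightarrow> of_real (2 * pi * real m)"
proof -
  have cL: "continuous_on UNIV L"
    by (intro continuous_at_imp_continuous_on ballI wirt_isCont[OF wirt_L])
  have cA: "continuous_on UNIV L_z"
    unfolding L_z_def by (intro continuous_intros continuous_on_D continuous_on_Dz) (use D_ne in auto)
  have cB: "continuous_on UNIV L_zb"
    unfolding L_zb_def by (intro continuous_intros continuous_on_D continuous_on_W) (use D_ne in auto)
  obtain K where K: "K \<ge> 0" "\<And>z. z \<noteq> 0 \<Longrightarrow> norm (L z - of_nat m / z) \<le> K / (norm z)\<^sup>2"
    using L_asymptotics by blast
  let ?I = "\<lambda>R. integral {-R..R} (\<lambda>x. integral {-R..R} (\<lambda>y. 2 * L_zb (Complex x y)))"
  have bound: "norm (?I R - of_real (2 * pi * real m)) \<le> 8 * K * inverse R" if R: "R > 0" for R :: real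
  proof -
    define s where "s t = (L (Complex R t) - L (Complex (-R) t)) + \<i> * (L (Complex t R) - L (Complex t (-R)))" for t
    have cs: "continuous_on {-R..R} s"
      unfolding s_def by (intro continuous_intros continuous_on_Complex_args cL)
    have "?I R = integral {-R..R} s"
      unfolding s_def by (rule green_square[OF wirt_L cA cB R])
    moreover have "(s has_integral integral {-R..R} s) {-R..R}"
      using cs by (intro integrable_integral integrable_continuous_real)
    ultimately have hs: "(s has_integral ?I R) {-R..R}" by simp
    have "((\<lambda>t. complex_of_real (real m * (4 * R / (R\<^sup>2 + t\<^sup>2)))) has_integral of_real (real m * (2 * pi))) {-R..R}"
      by (intro has_integral_of_real has_integral_mult_right integral_arctan[OF R])
    from has_integral_diff[OF hs this]
    have hd: "((\<lambda>t. s t - of_real (real m * (4 * R / (R\<^sup>2 + t\<^sup>2)))) has_integral ?I R - of_real (2 * pi * real m)) {-R..R}"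
      by (simp add: mult_ac)
    have "norm (s t - of_real (real m * (4 * R / (R\<^sup>2 + t\<^sup>2)))) \<le> 4 * (K / R\<^sup>2)" for t
    proof -
      define e where "e z = L z - of_nat m / z" for z
      have pos: "R\<^sup>2 + t\<^sup>2 > 0" using R by (simp add: add_pos_nonneg)
      have inv: "1 / Complex x y = Complex (x / (x\<^sup>2 + y\<^sup>2)) (- y / (x\<^sup>2 + y\<^sup>2))" for x y
        by (simp add: complex_eq_iff Re_divide Im_divide)
      have "1 / Complex R t - 1 / Complex (-R) t + \<i> * (1 / Complex t R - 1 / Complex t (-R)) = of_real (4 * R / (R\<^sup>2 + t\<^sup>2))"
        unfolding inv by (simp add: complex_eq_iff add.commute)
      then have "of_nat m * (1 / Complex R t - 1 / Complex (-R) t + \<i> * (1 / Complex t R - 1 / Complex t (-R)))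
          = complex_of_real (real m * (4 * R / (R\<^sup>2 + t\<^sup>2)))" by (simp only: of_real_mult of_real_of_nat_eq)
      then have "s t - of_real (real m * (4 * R / (R\<^sup>2 + t\<^sup>2)))
          = e (Complex R t) - e (Complex (-R) t) + \<i> * (e (Complex t R) - e (Complex t (-R)))"
        unfolding s_def e_def by (simp add: algebra_simps)
      also have "norm \<dots> \<le> (norm (e (Complex R t)) + norm (e (Complex (-R) t)))
          + (norm (e (Complex t R)) + norm (e (Complex t (-R))))"
        by (intro norm_triangle_le add_mono norm_triangle_ineq4) (simp add: norm_mult norm_triangle_ineq4)
      also have "\<dots> \<le> (K / R\<^sup>2 + K / R\<^sup>2) + (K / R\<^sup>2 + K / R\<^sup>2)"
      proof -
        have "norm (e z) \<le> K / R\<^sup>2" if z: "R \<le> norm z" for z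
        proof -
          have "norm (e z) \<le> K / (norm z)\<^sup>2" unfolding e_def using R z by (intro K(2)) auto
          also have "\<dots> \<le> K / R\<^sup>2" using R z K(1) by (intro frac_le power_mono) auto
          finally show ?thesis .
        qed
        moreover have "R \<le> norm (Complex R t)" "R \<le> norm (Complex (-R) t)" "R \<le> norm (Complex t R)" "R \<le> norm (Complex t (-R))"
          using R by (auto simp: cmod_def intro: real_le_rsqrt)
        ultimately show ?thesis by (intro add_mono) auto
      qed
      finally show ?thesis by simp
    qed
    \<comment> \<open>Four sides with error \<open>K / R\<^sup>2\<close> each, over length
      \<open>2 * R\<close>.\<close>
    then have "norm (?I R - of_real (2 * pi * real m)) \<le> 4 * (K / R\<^sup>2) * measure lborel {-R..R}"
      using K(1) by (intro has_integral_bound_real[OF _ _ hd, of _ "{}"]) auto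
    also have "\<dots> = 8 * K * inverse R" using R by (simp add: field_simps power2_eq_square)
    finally show ?thesis .
  qed
  have "(\<lambda>n. ?I (real n) - of_real (2 * pi * real m)) \<longlonglongrightarrow> 0"
  proof (rule Lim_null_comparison)
    show "\<forall>\<^sub>F n in sequentially. norm (?I (real n) - of_real (2 * pi * real m)) \<le> 8 * K * inverse (real n)"
      using eventually_gt_at_top[of 0] by eventually_elim (intro bound, simp)
    show "(\<lambda>n. 8 * K * inverse (real n)) \<longlonglongrightarrow> 0"
      using tendsto_mult_left[OF lim_inverse_n, of "8 * K"] by simp
  qed
  then show ?thesis by (rule LIM_zero_cancel)
qed

text \<open>The integrand is \<open>4 * L_zb\<close>, half the energy density: the area of the
  sphere covered \<open>m\<close> times.\<close>

lemma area_formula: "(\<integral>\<^sup>+ z. ennreal (4 * (cmod (W z))\<^sup>2 / (D z)\<^sup>2) \<partial>lborel) = ennreal (4 * pi * real m)"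
proof (rule nn_integral_exhaust_squares)
  let ?f = "\<lambda>z. 4 * (cmod (W z))\<^sup>2 / (D z)\<^sup>2"
  have cf: "continuous_on UNIV ?f"
  proof -
    have "continuous_on UNIV D" unfolding D_def by (intro continuous_intros)
    then show ?thesis by (intro continuous_intros continuous_on_W) (use D_pos in \<open>auto simp: less_imp_neq[symmetric]\<close>)
  qed
  show "(\<lambda>z. ennreal (?f z)) \<in> borel_measurable borel"
    by (rule measurable_compose[OF borel_measurable_continuous_onI[OF cf] measurable_ennreal])
  note cy = continuous_on_Complex_args(2)[OF cf] and c2 = continuous_on_Complex_args(3)[OF cf]
  define J where "J R = integral {-R..R} (\<lambda>x. integral {-R..R} (\<lambda>y. ?f (Complex x y)))" for R :: real
  have "2 * integral {-R..R} (\<lambda>x. integral {-R..R} (\<lambda>y. 2 * L_zb (Complex x y))) = of_real (J R)" for R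
  proof -
    have e: "4 * L_zb z = of_real (?f z)" for z
      using complex_norm_square[of "W z"] by (simp add: L_zb_def)
    have "2 * integral {-R..R} (\<lambda>x. integral {-R..R} (\<lambda>y. 2 * L_zb (Complex x y)))
        = integral {-R..R} (\<lambda>x. integral {-R..R} (\<lambda>y. 4 * L_zb (Complex x y)))"
      unfolding integral_mult_right[symmetric] by simp
    also have "\<dots> = integral {-R..R} (\<lambda>x. integral {-R..R} (\<lambda>y. complex_of_real (?f (Complex x y))))"
      unfolding e ..
    also have "\<dots> = integral {-R..R} (\<lambda>x. complex_of_real (integral {-R..R} (\<lambda>y. ?f (Complex x y))))"
      by (intro integral_cong integral_unique has_integral_of_real integrable_integral integrable_continuous_real cy)
    also have "\<dots> = of_real (J R)"
      unfolding J_def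
      by (intro integral_unique has_integral_of_real integrable_integral integrable_continuous_real)
        (use integral_continuous_on_param[OF c2, of "{-R..R}" "-R" R] in simp)
    finally show ?thesis .
  qed
  then have "(\<lambda>n. complex_of_real (J (real n))) \<longlonglongrightarrow> 2 * of_real (2 * pi * real m)"
    using tendsto_mult_left[OF boundary_limit, of 2] by simp
  then have "(\<lambda>n. Re (complex_of_real (J (real n)))) \<longlonglongrightarrow> Re (2 * of_real (2 * pi * real m))"
    by (rule tendsto_Re)
  then have "(\<lambda>n. J (real n)) \<longlonglongrightarrow> 4 * pi * real m" by (simp add: mult.assoc)
  then have "(\<lambda>n. ennreal (J (real n))) \<longlonglongrightarrow> ennreal (4 * pi * real m)"
    by (rule tendsto_ennrealI)
  then show "(\<lambda>n. \<integral>\<^sup>+ z. ennreal (?f z) * indicator (square (real n)) z \<partial>lborel)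
      \<longlonglongrightarrow> ennreal (4 * pi * real m)"
    unfolding J_def by (subst nn_integral_square[OF cf]) auto
qed

end

subsection \<open>Reflection of the domain\<close>

definition reflect :: "(complex \<Rightarrow> real^3) \<Rightarrow> complex \<Rightarrow> real^3"
  where "reflect f z = f (cnj z)"

lemma reflect_reflect [simp]: "reflect (reflect f) = f"
  by (simp add: reflect_def fun_eq_iff)

lemma partial_uminus:
  assumes "f differentiable (at z)" shows "partial (- w) f z = - partial w f z"
proof -
  have e: "partial w f z = Re w *\<^sub>R dx f z + Im w *\<^sub>R dy f z" for w
    by (rule partial_eqI[OF has_derivative_partial[OF assms]])
  show ?thesis by (subst (1 2) e) simp
qed

lemma reflect_differentiable:
  assumes "\<And>z. f differentiable (at z)" shows "reflect f differentiable (at z)"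
proof -
  have "cnj differentiable (at z)"
    unfolding differentiable_def
    by (rule exI, rule bounded_linear_imp_has_derivative[OF bounded_linear_cnj])
  from differentiable_chain_at[OF this assms[of "cnj z"]] show ?thesis
    by (simp add: reflect_def[abs_def] o_def)
qed

lemma dx_reflect: "dx (reflect f) = reflect (dx f)"
  by (simp add: partial_def reflect_def fun_eq_iff scaleR_conv_of_real)

lemma dy_reflect:
  assumes "\<And>z. f differentiable (at z)"
  shows "dy (reflect f) = (-1) *\<^sub>R reflect (dy f)"
proof
  fix z
  have "dy (reflect f) z = partial (- \<i>) f (cnj z)"
    by (simp add: partial_def reflect_def scaleR_conv_of_real)
  then show "dy (reflect f) z = ((-1) *\<^sub>R reflect (dy f)) z"
    using partial_uminus[OF assms, of \<i> "cnj z"] by (simp add: reflect_def)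
qed

lemma Ck_reflect: "Ck k f \<Longrightarrow> Ck k (reflect f)"
proof (induction k arbitrary: f)
  case 0
  then show ?case
    unfolding reflect_def[abs_def] by (auto intro!: continuous_on_compose2[of UNIV f] continuous_intros)
next
  case (Suc k)
  then have d: "\<And>z. f differentiable (at z)" by simp
  show ?case
    using Suc reflect_differentiable[OF d] Ck_scaleR[OF Suc.IH, of "dy f" "-1"]
    by (simp add: dx_reflect dy_reflect[OF d] del: scaleR_minus_left scaleR_minus1_left)
qed

lemma second_partials_reflect:
  assumes "Ck 2 f"
  shows "dx (dx (reflect f)) z = dx (dx f) (cnj z)" "dx (dy (reflect f)) z = - dx (dy f) (cnj z)"
    "dy (dx (reflect f)) z = - dy (dx f) (cnj z)" "dy (dy (reflect f)) z = dy (dy f) (cnj z)"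
proof -
  note d = Ck_2D(1-3)[OF assms]
  note r = reflect_differentiable[OF d(3)]
  show "dx (dx (reflect f)) z = dx (dx f) (cnj z)" by (simp add: dx_reflect reflect_def)
  show "dx (dy (reflect f)) z = - dx (dy f) (cnj z)"
    unfolding dy_reflect[OF d(1)] partial_scaleR[OF r] by (simp add: dx_reflect reflect_def)
  show "dy (dx (reflect f)) z = - dy (dx f) (cnj z)"
    unfolding dx_reflect dy_reflect[OF d(2)] by (simp add: reflect_def)
  show "dy (dy (reflect f)) z = dy (dy f) (cnj z)"
    unfolding dy_reflect[OF d(1)] partial_scaleR[OF r] dy_reflect[OF d(3)] by (simp add: reflect_def)
qed

lemma first_partials_reflect:
  assumes "\<And>z. f differentiable (at z)"
  shows "dx (reflect f) z = dx f (cnj z)" "dy (reflect f) z = - dy f (cnj z)"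
  by (simp_all add: dx_reflect dy_reflect[OF assms] reflect_def)

lemma harmonic_map_reflect:
  assumes u: "harmonic_map u" shows "harmonic_map (reflect u)"
proof -
  note C = harmonic_mapD(1)[OF u, of 2]
  have "smooth (reflect u)" using u Ck_reflect by (auto simp: harmonic_map_def smooth_def)
  moreover have "laplacian (reflect u) z = laplacian u (cnj z)" for z
    by (simp add: laplacian_def second_partials_reflect[OF C])
  moreover have "grad_sq (reflect u) z = grad_sq u (cnj z)" for z
    by (simp add: grad_sq_def first_partials_reflect[OF Ck_2D(1)[OF C]])
  ultimately show ?thesis using u by (simp add: harmonic_map_def reflect_def)
qed

lemma bounded_kernel_reflect:
  assumes u: "harmonic_map u" and v: "v \<in> bounded_kernel u"
  shows "reflect v \<in> bounded_kernel (reflect u)"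
proof -
  note C = bounded_kernelD(1)[OF v] and Cu = harmonic_mapD(1)[OF u, of 2]
  note s = second_partials_reflect[OF C] first_partials_reflect[OF Ck_2D(1)[OF C]]
    first_partials_reflect[OF Ck_2D(1)[OF Cu]]
  have "lin_op (reflect u) (reflect v) z = lin_op u v (cnj z)" for z
    by (simp add: lin_op_def laplacian_def grad_sq_def grad_inner_def s) (simp add: reflect_def)
  moreover have "bounded_C2 (reflect v)"
  proof -
    from v obtain B where B: "\<And>z. norm (v z) + norm (dx v z, dy v z)
      + norm ((dx (dx v) z, dx (dy v) z), (dy (dx v) z, dy (dy v) z)) \<le> B"
      unfolding bounded_kernel_def bounded_C2_def bdd_above_def by blast
    show ?thesis
      unfolding bounded_C2_def
    proof (rule bdd_aboveI2)
      fix z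
      show "norm (reflect v z) + norm (dx (reflect v) z, dy (reflect v) z)
        + norm ((dx (dx (reflect v)) z, dx (dy (reflect v)) z), (dy (dx (reflect v)) z, dy (dy (reflect v)) z)) \<le> B"
        unfolding s using B[of "cnj z"] by (simp add: norm_Pair reflect_def)
    qed
  qed
  moreover have "reflect v z \<bullet> reflect u z = 0" for z
    using bounded_kernelD(2)[OF v] by (simp add: reflect_def)
  ultimately show ?thesis
    using Ck_reflect[OF C] bounded_kernelD(3)[OF v] by (simp add: bounded_kernel_def)
qed

lemma measurable_cnj [measurable]: "cnj \<in> borel_measurable borel"
  by (intro borel_measurable_continuous_onI continuous_intros)

lemma lborel_cnj: "lborel = distr lborel borel cnj"
proof (rule lborel_eqI)
  fix l u :: complex assume le: "\<And>b. b \<in> Basis \<Longrightarrow> l \<bullet> b \<le> u \<bullet> b"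
  have le': "Re l \<le> Re u" "Im l \<le> Im u" using le[of 1] le[of \<i>] by auto
  have "cnj -` box l u = box (Complex (Re l) (- Im u)) (Complex (Re u) (- Im l))"
    by (auto simp: box_def Basis_complex_def)
  moreover have "emeasure lborel (box (Complex (Re l) (- Im u)) (Complex (Re u) (- Im l)))
      = (\<Prod>b\<in>Basis. (Complex (Re u) (- Im l) - Complex (Re l) (- Im u)) \<bullet> b)"
    by (rule emeasure_lborel_box) (use le' in \<open>auto simp: Basis_complex_def\<close>)
  ultimately show "emeasure (distr lborel borel cnj) (box l u) = (\<Prod>b\<in>Basis. (u - l) \<bullet> b)"
    by (simp add: emeasure_distr Basis_complex_def)
qed simp

lemma jac_reflect:
  assumes "harmonic_map u" shows "jac (reflect u) z = - jac u (cnj z)"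
  using first_partials_reflect[OF harmonic_mapD(2)[OF assms]]
  by (simp add: jac_def reflect_def cross_minus_right)

lemma energy_reflect:
  assumes u: "harmonic_map u" shows "energy (reflect u) = energy u"
proof -
  have [measurable]: "grad_sq u \<in> borel_measurable borel"
    by (rule borel_measurable_continuous_onI[OF grad_sq_continuous[OF harmonic_mapD(1)[OF u]]])
  have "energy (reflect u) = (\<integral>\<^sup>+ z. ennreal (grad_sq u (cnj z)) \<partial>lborel)"
    by (simp add: energy_def grad_sq_def first_partials_reflect[OF harmonic_mapD(2)[OF u]])
  also have "\<dots> = (\<integral>\<^sup>+ z. ennreal (grad_sq u z) \<partial>distr lborel borel cnj)"
    by (subst nn_integral_distr) auto
  finally show ?thesis by (simp add: energy_def flip: lborel_cnj)
qed

lemma map_degree_jac: "map_degree u = 1 / (4 * pi) * (\<integral>z. jac u z \<partial>lborel)"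
  by (simp add: map_degree_def jac_def)

lemma jac_measurable:
  assumes u: "harmonic_map u" shows "jac u \<in> borel_measurable borel"
proof -
  have c: "continuous_on UNIV (\<lambda>z. u z $ i)" for i
    by (intro continuous_at_imp_continuous_on ballI bounded_linear.continuous[OF bounded_linear_vec_nth]
        differentiable_imp_continuous_within harmonic_mapD(2)[OF u])
  have d: "continuous_on UNIV (dz u i)" for i
    by (intro continuous_at_imp_continuous_on ballI isCont_dz harmonic_mapD(1)[OF u])
  show ?thesis
    unfolding jac_dz[abs_def] by (intro borel_measurable_continuous_onI continuous_intros c d)
qed

lemma map_degree_reflect:
  assumes u: "harmonic_map u" shows "map_degree (reflect u) = - map_degree u"
proof -
  note [measurable] = jac_measurable[OF u]
  have "(\<integral>z. jac (reflect u) z \<partial>lborel) = - (\<integral>z. jac u (cnj z) \<partial>lborel)"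
    by (simp add: jac_reflect[OF u])
  also have "(\<integral>z. jac u (cnj z) \<partial>lborel) = (\<integral>z. jac u z \<partial>distr lborel borel cnj)"
    by (subst integral_distr) auto
  finally show ?thesis by (simp add: map_degree_jac flip: lborel_cnj)
qed

lemma (in rational_pair) map_degree_umap:
  assumes h: "harmonic_map umap" and pos: "\<And>z. jac umap z = grad_sq umap z / 2"
  shows "map_degree umap = real m"
proof -
  have j: "jac umap z = 4 * (cmod (W z))\<^sup>2 / (D z)\<^sup>2" for z by (simp add: pos grad_sq_umap)
  have "0 \<le> jac umap z" for z by (simp add: j)
  then have "(\<integral>z. jac umap z \<partial>lborel) = enn2real (\<integral>\<^sup>+ z. ennreal (jac umap z) \<partial>lborel)"
    using jac_measurable[OF h] by (intro integral_eq_nn_integral) simp_all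
  also have "\<dots> = 4 * pi * real m" unfolding j area_formula by simp
  finally show ?thesis by (simp add: map_degree_jac)
qed

text \<open>In negative degree \<open>u\<close> is the reflection of a rational map in
  \<open>z\<close>, and reflection carries one bounded kernel onto the other.\<close>

lemma represents_kernel:
  assumes u: "harmonic_map u" and r: "represents M q p u"
  shows "bounded_kernel u = variations M q p" "dim (bounded_kernel u) = 4 * nat \<bar>M\<bar> + 2"
proof -
  from r have cop: "coprime p q" and deg: "max (degree p) (degree q) = nat \<bar>M\<bar>"
    and uM: "u = rational_map M q p" by (simp_all add: represents_def)
  interpret rational_pair p q "nat \<bar>M\<bar>"
    by unfold_locales (use coprime_poly_0[OF cop] deg in auto)
  have uc: "u = (\<lambda>z. umap (coord M z))" by (simp add: uM rational_map_def umap_def fun_eq_iff)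
  have eq: "bounded_kernel u = (\<lambda>r z. var r (coord M z)) ` {r. degree r \<le> 2 * nat \<bar>M\<bar>}"
  proof (cases "M \<ge> 0")
    case True
    then have c: "coord M z = z" for z by (simp add: coord_def)
    have "harmonic_map umap" using u unfolding uc c .
    from kernel_eq_var[OF this] show ?thesis unfolding uc c .
  next
    case False
    then have c: "coord M z = cnj z" for z by (simp add: coord_def)
    have ur: "u = reflect umap" unfolding uc c by (simp add: reflect_def fun_eq_iff)
    then have h: "harmonic_map umap" using harmonic_map_reflect[OF u] by simp
    have "bounded_kernel u = reflect ` bounded_kernel umap"
    proof (intro equalityI subsetI)
      fix v assume "v \<in> bounded_kernel u"
      from bounded_kernel_reflect[OF u this] have "reflect v \<in> bounded_kernel umap" by (simp add: ur)
      then show "v \<in> reflect ` bounded_kernel umap" by (rule rev_image_eqI) simp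
    next
      fix v assume "v \<in> reflect ` bounded_kernel umap"
      then show "v \<in> bounded_kernel u" using bounded_kernel_reflect[OF h] by (auto simp: ur)
    qed
    then show ?thesis unfolding kernel_eq_var[OF h] image_image c by (simp add: reflect_def[abs_def])
  qed
  then show "bounded_kernel u = variations M q p" using variations_eq[OF refl] by simp
  have "surj (coord M)"
  proof (rule surjI[of _ "coord M"])
    show "coord M (coord M z) = z" for z by (simp add: coord_def)
  qed
  from dim_var[OF this eq] show "dim (bounded_kernel u) = 4 * nat \<bar>M\<bar> + 2" .
qed

lemma harmonic_positive_represents:
  assumes u: "harmonic_map u" and fin: "energy u < \<infinity>"
    and pos: "\<And>z. jac u z = grad_sq u z / 2"
  shows "\<exists>q p. coprime p q \<and> u = (\<lambda>z. stereo_quot (poly q z) (poly p z)) \<and>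
    map_degree u = real (max (degree p) (degree q))"
proof -
  obtain p q where pq: "coprime p q" "\<And>z. u z = stereo_quot (poly q z) (poly p z)"
    using harmonic_rational[OF u fin pos] by blast
  interpret rational_pair p q "max (degree p) (degree q)"
    by unfold_locales (use coprime_poly_0[OF pq(1)] in auto)
  have "u = umap" using pq(2) by (simp add: umap_def fun_eq_iff)
  then have "map_degree u = real (max (degree p) (degree q))"
    using map_degree_umap u pos by metis
  then show ?thesis using pq by blast
qed

lemma represents_exists:
  assumes u: "harmonic_map u" and fin: "energy u < \<infinity>" and deg: "map_degree u = of_int M"
  shows "\<exists>q p. represents M q p u"
  using harmonic_orientation[OF u fin]
proof
  assume "\<forall>z. jac u z = grad_sq u z / 2"
  then obtain q p where pq: "coprime p q" "u = (\<lambda>z. stereo_quot (poly q z) (poly p z))"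
    "map_degree u = real (max (degree p) (degree q))"
    using harmonic_positive_represents[OF u fin] by blast
  then have "M = int (max (degree p) (degree q))" using deg by linarith
  then have "represents M q p u"
    using pq(1,2) by (simp add: represents_def rational_map_def[abs_def] coord_def)
  then show ?thesis by blast
next
  assume neg: "\<forall>z. jac u z = - grad_sq u z / 2"
  let ?u = "reflect u"
  have h: "harmonic_map ?u" by (rule harmonic_map_reflect[OF u])
  have pos: "jac ?u z = grad_sq ?u z / 2" for z
    using neg first_partials_reflect[OF harmonic_mapD(2)[OF u]] by (simp add: jac_reflect[OF u] grad_sq_def)
  obtain q p where pq: "coprime p q" "?u = (\<lambda>z. stereo_quot (poly q z) (poly p z))"
    "map_degree ?u = real (max (degree p) (degree q))"
    using harmonic_positive_represents[OF h _ pos] fin energy_reflect[OF u] by auto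
  have M: "M = - int (max (degree p) (degree q))"
    using pq(3) deg unfolding map_degree_reflect[OF u] by linarith
  have uz: "u z = stereo_quot (poly q (cnj z)) (poly p (cnj z))" for z
    using fun_cong[OF pq(2), of "cnj z"] by (simp add: reflect_def)
  have "u = rational_map M q p"
  proof (cases "M < 0")
    case True
    then show ?thesis using uz by (simp add: rational_map_def coord_def fun_eq_iff)
  next
    \<comment> \<open>Here \<open>coord M\<close> is the identity although \<open>u\<close> was
      found in the conjugate variable; this is consistent because in degree 0 both polynomials are
      constant.\<close>
    case False
    then have "degree p = 0" "degree q = 0" "M = 0" using M by auto
    then show ?thesis using uz by (auto simp: rational_map_def coord_def fun_eq_iff elim!: degree_eq_zeroE)
  qed
  then have "represents M q p u" using pq(1) M by (simp add: represents_def)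
  then show ?thesis by blast
qed

theorem theorem1p1:
  fixes u :: "complex \<Rightarrow> real^3" and m :: int
  assumes "harmonic_map u"
    and "energy u < \<infinity>"
    and "map_degree u = of_int m"
  shows "(\<forall>v \<in> bounded_kernel u. generated_by_harmonic_maps m u v)
    \<and> dim (bounded_kernel u) = 4 * nat \<bar>m\<bar> + 2"
proof -
  have ex: "\<exists>q p. represents m q p u" by (rule represents_exists[OF assms])
  then have "dim (bounded_kernel u) = 4 * nat \<bar>m\<bar> + 2"
    using represents_kernel(2)[OF assms(1)] by blast
  moreover have "generated_by_harmonic_maps m u v" if "v \<in> bounded_kernel u" for v
    unfolding generated_by_harmonic_maps_def
  proof (intro conjI ex allI impI)
    fix q p assume "represents m q p u"
    \<comment> \<open>No genuine linear combination is needed: each kernel element is itself a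
      single variation.\<close>
    then have "v \<in> variations m q p" using represents_kernel(1)[OF assms(1)] that by blast
    then show "v \<in> span (variations m q p)" by (rule span_base)
  qed
  ultimately show ?thesis by blast
qed

end
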